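(* Let $N\ge 1$ be an integer, $s\in(0,1)$, $p>1$ and $u_0,f\in L^\infty(\mathbb{H}^N)$. Consider the Cauchy problem $$(\ast)\qquad \partial_t u+(-\Delta_{\mathbb{H}^N})^s u=|u|^p+f \ \text{ in } \mathbb{H}^N\times(0,T),\qquad u(0,\cdot)=u_0 \ \text{ in } \mathbb{H}^N .$$ Then the following holds: (i) There exists a fixed $T=T(u_0)>0$ and a unique mild solution $u\in C([0,T],L^\infty(\mathbb{H}^N))$ to $(\ast)$. (ii) The solution can be uniquely extended to a maximal interval $[0,T_{\max})$. Moreover, if $T_{\max}$ is finite, then $\|u(t)\|_{L^\infty(\mathbb{H}^N)}\to\infty$ as $t\to T_{\max}$. (iii) If $u_0,f\in L^\infty(\mathbb{H}^N)\cap L^q(\mathbb{H}^N)$ for some $q\in[1,\infty]$, then $$u\in C([0,T_{\max}),L^\infty(\mathbb{H}^N))\cap C([0,T_{\max}),L^q(\mathbb{H}^N)).$$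
   Context: The Heisenberg group $\mathbb{H}^N$ is $\mathbb{R}^{2N+1}$, with points $\xi=(x,y,w)$, $x,y\in\mathbb{R}^N$, $w\in\mathbb{R}$, and group law $\xi\circ\xi'=(x+x',\,y+y',\,w+w'+2\langle y,x'\rangle-2\langle x,y'\rangle)$; the inverse is $\xi^{-1}=-\xi$. Integrals and $L^q$ spaces are with respect to Lebesgue measure (the Haar measure). The homogeneous dimension is $Q=2N+2$. The homogeneous norm is $\|\xi\|_{\mathbb{H}^N}=\big[\sum_{i=1}^N(x_i^2+y_i^2)^2+w^2\big]^{1/4}$. Fractional sub-Laplacian of order $s\in(0,1)$: $$(-\Delta_{\mathbb{H}^N})^s u(\xi)=-\tfrac12 c(N,s)\int_{\mathbb{H}^N}\frac{u(\xi\circ\eta)+u(\xi\circ\eta^{-1})-2u(\xi)}{\|\eta\|_{\mathbb{H}^N}^{Q+2s}}\,d\eta,$$ for $u$ in the Schwartz class, where $c(N,s)>0$ is a constant depending only on $N$ and $s$. The heat semigroup associated with $(-\Delta_{\mathbb{H}^N})^s$ is $$e^{-t(-\Delta_{\mathbb{H}^N})^s}g(\xi)=\int_{\mathbb{H}^N}h_s(t,\eta^{-1}\circ\xi)\,g(\eta)\,d\eta,$$ where $h_s$ is the integral (heat) kernel of this semigroup. Mild solution: $u\in C([0,T],L^\infty(\mathbb{H}^N))$ is a (local-in-time) mild solution of $(\ast)$ if for every $t\in(0,T]$ $$u(t)=e^{-t(-\Delta_{\mathbb{H}^N})^s}u_0+\int_0^t e^{-(t-\tau)(-\Delta_{\mathbb{H}^N})^s}\big(|u(\tau)|^p+f\big)\,d\tau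 .$$ Here $T_{\max}$ is the supremum of all $T>0$ for which $(\ast)$ admits a mild solution $u\in C([0,T],L^\infty(\mathbb{H}^N))$.
   Formalization: In C([0,T],L^∞), continuity at t=0 is weak-* instead of in norm, as norm continuity there fails for discontinuous u_0 (e.g. a half-space indicator); it is proved in norm on all of [0,T] whenever e^{-t(-Δ)^s}u_0→u_0 in L^∞. *)

theory Defs
  imports "HOL-Probability.Essential_Supremum"
begin

section \<open>The Heisenberg group\<close>

text \<open>The dimension \<open>N \<ge> 1\<close> is \<open>CARD('n)\<close>; a point is \<open>(x, y, w)\<close>.\<close>

type_synonym 'n heis = "(real^'n) \<times> (real^'n) \<times> real"

fun hmul :: "'n::finite heis \<Rightarrow> 'n heis \<Rightarrow> 'n heis" (infixl "\<circ>\<^sub>H" 70) where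
  "(x, y, w) \<circ>\<^sub>H (x', y', w') = (x + x', y + y', w + w' + 2 * (y \<bullet> x') - 2 * (x \<bullet> y'))"

definition hinv :: "'n::finite heis \<Rightarrow> 'n heis" where
  "hinv \<xi> = - \<xi>"

fun hnorm :: "'n::finite heis \<Rightarrow> real" where
  "hnorm (x, y, w) = root 4 ((\<Sum>i\<in>UNIV. ((x $ i)\<^sup>2 + (y $ i)\<^sup>2)\<^sup>2) + w\<^sup>2)"

definition hdim :: "'n::finite itself \<Rightarrow> nat" where
  "hdim _ = 2 * CARD('n) + 2"

section \<open>Lebesgue spaces\<close>

text \<open>Elements of \<open>L\<^sup>q\<close> are represented by Borel functions; statements about them are
  made up to null sets. The exponent ranges over \<open>[1,\<infinity>]\<close>.\<close>

definition Lq_norm :: "ennreal \<Rightarrow> ('a::euclidean_space \<Rightarrow> real) \<Rightarrow> ennreal" where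
  "Lq_norm q g =
    (if q = \<infinity> then esssup lborel (\<lambda>x. ennreal \<bar>g x\<bar>)
     else let I = \<integral>\<^sup>+ x. ennreal (\<bar>g x\<bar> powr enn2real q) \<partial>lborel
          in if I = \<infinity> then \<infinity> else ennreal (enn2real I powr (1 / enn2real q)))"

definition Lq :: "ennreal \<Rightarrow> ('a::euclidean_space \<Rightarrow> real) set" where
  "Lq q = {g \<in> borel_measurable lborel. Lq_norm q g < \<infinity>}"

definition norm_continuous :: "ennreal \<Rightarrow> real set \<Rightarrow> (real \<Rightarrow> 'a::euclidean_space \<Rightarrow> real) \<Rightarrow> real \<Rightarrow> bool" where
  "norm_continuous q I u t \<longleftrightarrow> ((\<lambda>\<tau>. Lq_norm q (\<lambda>x. u \<tau> x - u t x)) \<longlongrightarrow> 0) (at t within I)"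

text \<open>Continuity for the topology of \<open>L\<^sup>\<infinity>\<close> as the dual space of \<open>L\<^sup>1\<close>.\<close>

definition weak_star_continuous :: "real set \<Rightarrow> (real \<Rightarrow> 'a::euclidean_space \<Rightarrow> real) \<Rightarrow> real \<Rightarrow> bool" where
  "weak_star_continuous I u t \<longleftrightarrow>
    (\<forall>g\<in>Lq 1. ((\<lambda>\<tau>. LINT x|lborel. u \<tau> x * g x) \<longlongrightarrow> (LINT x|lborel. u t x * g x)) (at t within I))"

text \<open>The space \<open>C(I, L\<^sup>q)\<close> for a time interval \<open>I\<close> starting at \<open>0\<close>. Continuity is in norm,
  with one exception: for \<open>q = \<infinity>\<close>, at the initial time \<open>t = 0\<close> only, it is weak-*. Norm continuity
  at \<open>0\<close> cannot be required there: for \<open>t > 0\<close> the heat semigroup maps \<open>L\<^sup>\<infinity>\<close> into the bounded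
  continuous functions and the Duhamel term is \<open>O(t)\<close> in norm, so a mild solution that is norm
  continuous at \<open>0\<close> forces \<open>u\<^sub>0\<close> to be almost everywhere equal to a continuous function.\<close>

definition C_Lq :: "ennreal \<Rightarrow> real set \<Rightarrow> (real \<Rightarrow> 'a::euclidean_space \<Rightarrow> real) set" where
  "C_Lq q I = {u. \<forall>t\<in>I. u t \<in> Lq q \<and>
    (if q = \<infinity> \<and> t = 0 then weak_star_continuous I u t else norm_continuous q I u t)}"

section \<open>Schwartz functions and the fractional sub-Laplacian\<close>

fun iter_partial :: "'a::euclidean_space list \<Rightarrow> ('a \<Rightarrow> real) \<Rightarrow> 'a \<Rightarrow> real" where
  "iter_partial [] \<phi> = \<phi>"
| "iter_partial (b # bs) \<phi> = (\<lambda>x. frechet_derivative (iter_partial bs \<phi>) (at x) b)"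

definition schwartz :: "('a::euclidean_space \<Rightarrow> real) set" where
  "schwartz = {\<phi>. \<forall>bs\<in>lists Basis.
     (\<forall>x. iter_partial bs \<phi> differentiable (at x)) \<and>
     (\<forall>k. bounded (range (\<lambda>x. norm x ^ k * iter_partial bs \<phi> x)))}"

definition frac_sublap :: "real \<Rightarrow> real \<Rightarrow> ('n::finite heis \<Rightarrow> real) \<Rightarrow> 'n heis \<Rightarrow> real" where
  "frac_sublap c s \<phi> \<xi> =
    - (1/2) * c * (LINT \<eta>|lborel. (\<phi> (\<xi> \<circ>\<^sub>H \<eta>) + \<phi> (\<xi> \<circ>\<^sub>H hinv \<eta>) - 2 * \<phi> \<xi>)
       / hnorm \<eta> powr (real (hdim TYPE('n)) + 2 * s))"

section \<open>Heat semigroup and mild solutions\<close>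

definition heat_op :: "(real \<Rightarrow> 'n::finite heis \<Rightarrow> real) \<Rightarrow> real \<Rightarrow> ('n heis \<Rightarrow> real) \<Rightarrow> 'n heis \<Rightarrow> real" where
  "heat_op h t g \<xi> = (LINT \<eta>|lborel. h t (hinv \<eta> \<circ>\<^sub>H \<xi>) * g \<eta>)"

text \<open>\<open>h\<close> is the heat kernel, that is, the integral kernel of the positive (Markovian) semigroup
  generated by minus the fractional sub-Laplacian: the operators \<open>heat_op h t\<close> form a strongly
  continuous semigroup on \<open>L\<^sup>1\<close> whose generator is minus the fractional sub-Laplacian on Schwartz
  functions. The space is \<open>L\<^sup>1\<close> because its dual \<open>L\<^sup>\<infinity>\<close> is where the equation is solved. The
  Schwartz class is a core for the generator, so these conditions determine \<open>h t\<close> almost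
  everywhere for \<open>t > 0\<close>; the values \<open>h t\<close> for \<open>t \<le> 0\<close> are irrelevant. Existence of \<open>h\<close> is
  Hunt's theorem together with absolute continuity, the jump kernel being symmetric, absolutely
  continuous and of infinite mass.\<close>

definition heat_kernel :: "real \<Rightarrow> real \<Rightarrow> (real \<Rightarrow> 'n::finite heis \<Rightarrow> real) \<Rightarrow> bool" where
  "heat_kernel c s h \<longleftrightarrow>
    (\<forall>t>0. h t \<in> Lq 1 \<and> (AE \<xi> in lborel. 0 \<le> h t \<xi>)) \<and>
    (\<forall>t>0. \<forall>\<tau>>0. \<forall>g\<in>Lq 1. AE \<xi> in lborel. heat_op h (t + \<tau>) g \<xi> = heat_op h t (heat_op h \<tau> g) \<xi>) \<and>
    (\<forall>g\<in>Lq 1. ((\<lambda>t. Lq_norm 1 (\<lambda>\<xi>. heat_op h t g \<xi> - g \<xi>)) \<longlongrightarrow> 0) (at_right 0)) \<and>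
    (\<forall>\<phi>\<in>schwartz. ((\<lambda>t. Lq_norm 1 (\<lambda>\<xi>. (heat_op h t \<phi> \<xi> - \<phi> \<xi>) / t - (- frac_sublap c s \<phi> \<xi>)))
       \<longlongrightarrow> 0) (at_right 0))"

text \<open>The Duhamel integral is taken pointwise in \<open>\<xi>\<close>. For \<open>u \<in> C_Lq \<infinity> {0..T}\<close> the integrand is,
  for every \<open>\<xi>\<close>, a bounded continuous function of \<open>\<tau> \<in> (0,t)\<close>, so this is the
  \<open>L\<^sup>\<infinity>\<close>-valued integral.\<close>

definition mild_solution ::
  "(real \<Rightarrow> 'n::finite heis \<Rightarrow> real) \<Rightarrow> real \<Rightarrow> ('n heis \<Rightarrow> real) \<Rightarrow> ('n heis \<Rightarrow> real)
    \<Rightarrow> real \<Rightarrow> (real \<Rightarrow> 'n heis \<Rightarrow> real) \<Rightarrow> bool" where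
  "mild_solution h p u0 f T u \<longleftrightarrow>
    u \<in> C_Lq \<infinity> {0..T} \<and>
    (\<forall>t\<in>{0<..T}. AE \<xi> in lborel.
       u t \<xi> = heat_op h t u0 \<xi>
         + (LINT \<tau>:{0<..<t}|lborel. heat_op h (t - \<tau>) (\<lambda>\<eta>. \<bar>u \<tau> \<eta>\<bar> powr p + f \<eta>) \<xi>))"

definition T_max ::
  "(real \<Rightarrow> 'n::finite heis \<Rightarrow> real) \<Rightarrow> real \<Rightarrow> ('n heis \<Rightarrow> real) \<Rightarrow> ('n heis \<Rightarrow> real) \<Rightarrow> ereal" where
  "T_max h p u0 f = Sup {ereal T |T. T > 0 \<and> (\<exists>u. mild_solution h p u0 f T u)}"

text \<open>A mild solution on \<open>[0, T\<^sub>m\<^sub>a\<^sub>x)\<close>.\<close>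

definition maximal_solution ::
  "(real \<Rightarrow> 'n::finite heis \<Rightarrow> real) \<Rightarrow> real \<Rightarrow> ('n heis \<Rightarrow> real) \<Rightarrow> ('n heis \<Rightarrow> real)
    \<Rightarrow> (real \<Rightarrow> 'n heis \<Rightarrow> real) \<Rightarrow> bool" where
  "maximal_solution h p u0 f u \<longleftrightarrow>
    (\<forall>T. 0 < T \<and> ereal T < T_max h p u0 f \<longrightarrow> mild_solution h p u0 f T u)"

end

theory Submission
  imports Defs
begin

text \<open>
  The operators \<open>heat_op h t\<close> are right convolutions with \<open>h t\<close>. Testing the semigroup law on
  indicator functions gives \<open>h (t + \<tau>) = h t * h \<tau>\<close> almost everywhere, so the total mass of \<open>h t\<close> is
  multiplicative, tends to \<open>1\<close> at \<open>0\<close> and is bounded on bounded intervals, and \<open>t \<mapsto> h t\<close> is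
  continuous into \<open>L\<^sup>1\<close> for \<open>t > 0\<close>. Since \<open>x \<mapsto> \<bar>x\<bar>\<^sup>p\<close> is locally Lipschitz, Picard iteration yields a solution on a time interval whose length
  depends only on the size of the datum; restarting it gives continuation and blow-up.

  The Duhamel integrand \<open>S (t - \<tau>) F(\<tau>)\<close> is controlled through left continuity of \<open>F\<close> in \<open>\<tau>\<close>: this is
  stable under gluing of solutions and already makes the integrand jointly measurable. Weak-*
  continuity at time \<open>0\<close> bounds a mild solution near \<open>0\<close> by the uniform boundedness principle,
  after which uniqueness follows by iterating the integral inequality.
\<close>

section \<open>Haar measure of the Heisenberg group\<close>

text \<open>\<open>heat_kernel\<close> speaks of data in \<open>L^1\<close>, while the equation
  lives in \<open>L^\<infinity>\<close>. The transfer goes through the kernel: identities between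
  the functions \<open>h t\<close> hold almost everywhere, and since a convolution ignores null sets
  they become identities for bounded data at every point.

  Time 0 shapes the rest. The semigroup is in general not norm continuous there on
  \<open>L^\<infinity>\<close>, so a curve in \<open>C_Lq \<infinity>\<close> is not bounded near 0
  by compactness alone. For the same reason a solution restarted at \<open>T\<close> is at first
  only weak-* continuous from the right at the junction, while from the left it is norm continuous.
  This is why source terms are asked to be left continuous and nothing more; full continuity comes
  back from the Duhamel formula itself.

  For (iii) the fixed point is found in \<open>L^\<infinity>\<close>, so the finiteness of the
  \<open>L^q\<close> norm of the solution is part of the claim. An integral inequality for this norm
  has to start from a quantity known to be finite; here it starts from the zero function.\<close>

lemma nn_integral_affine_unit:
  fixes f :: "'a::euclidean_space \<Rightarrow> ennreal"
  assumes [measurable]: "f \<in> borel_measurable borel" and c: "\<bar>c\<bar> = 1"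
  shows "(\<integral>\<^sup>+x. f (t + c *\<^sub>R x) \<partial>lborel) = (\<integral>\<^sup>+x. f x \<partial>lborel)"
proof -
  have "lborel = density (distr lborel borel (\<lambda>x::'a. t + c *\<^sub>R x)) (\<lambda>_. 1)"
    using lborel_affine[of c t] c by (auto simp: one_ennreal_def)
  also have "\<dots> = distr lborel borel (\<lambda>x::'a. t + c *\<^sub>R x)"
    by (simp add: density_1)
  finally have *: "lborel = distr lborel borel (\<lambda>x::'a. t + c *\<^sub>R x)" .
  show ?thesis
    by (subst (2) *) (simp add: nn_integral_distr)
qed

lemma nn_integral_lborel_pair:
  fixes F :: "'a::euclidean_space \<times> 'b::euclidean_space \<Rightarrow> ennreal"
  assumes F: "F \<in> borel_measurable borel"
  shows "(\<integral>\<^sup>+p. F p \<partial>lborel) = (\<integral>\<^sup>+x. \<integral>\<^sup>+y. F (x, y) \<partial>lborel \<partial>lborel)"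
proof -
  have "F \<in> borel_measurable (lborel \<Otimes>\<^sub>M lborel)"
    using F by (simp add: lborel_prod)
  from sigma_finite_measure.nn_integral_fst[OF lborel.sigma_finite_measure_axioms this]
  show ?thesis by (simp add: lborel_prod)
qed

lemma nn_integral_lborel_triple:
  fixes F :: "'a::euclidean_space \<times> 'b::euclidean_space \<times> 'c::euclidean_space \<Rightarrow> ennreal"
  assumes F[measurable]: "F \<in> borel_measurable borel"
  shows "(\<integral>\<^sup>+p. F p \<partial>lborel) = (\<integral>\<^sup>+x. \<integral>\<^sup>+y. \<integral>\<^sup>+w. F (x, y, w) \<partial>lborel \<partial>lborel \<partial>lborel)"
proof -
  have "(\<integral>\<^sup>+p. F p \<partial>lborel) = (\<integral>\<^sup>+x. \<integral>\<^sup>+q. F (x, q) \<partial>lborel \<partial>lborel)"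
    by (subst nn_integral_lborel_pair) simp_all
  also have "\<dots> = (\<integral>\<^sup>+x. \<integral>\<^sup>+y. \<integral>\<^sup>+w. F (x, y, w) \<partial>lborel \<partial>lborel \<partial>lborel)"
    by (intro nn_integral_cong nn_integral_lborel_pair) measurable
  finally show ?thesis .
qed

text \<open>Translations and inversion are all triangular: the last coordinate is moved by a
  function of the first two. In Tonelli's order that function is a constant when the last coordinate
  is integrated, so every layer is an affine map with factor of modulus 1.\<close>

lemma distr_heis_shear:
  fixes l :: "real^'n \<Rightarrow> real^'n \<Rightarrow> real" and a b :: "real^'n"
  assumes c: "\<bar>c\<bar> = 1" and l[measurable]: "case_prod l \<in> borel_measurable borel"
  shows "distr lborel borel (\<lambda>(x, y, w). (a + c *\<^sub>R x, b + c *\<^sub>R y, l x y + c *\<^sub>R w)) = (lborel :: 'n::finite heis measure)"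
    (is "distr _ _ ?T = _")
proof (rule measure_eqI)
  have l'[measurable]: "(\<lambda>(x, y). l x y) \<in> borel_measurable (borel \<Otimes>\<^sub>M borel)"
    using l by (simp add: borel_prod)
  have lm: "(\<lambda>p. l (fst p) (fst (snd p))) \<in> borel_measurable (borel :: 'n heis measure)"
    using measurable_compose[OF _ l, of "\<lambda>p. (fst p, fst (snd p))" "borel :: 'n heis measure"]
    by (simp add: borel_measurable_continuous_onI continuous_intros)
  have T[measurable]: "?T \<in> borel_measurable borel"
    unfolding case_prod_beta'
    by (intro borel_measurable_Pair borel_measurable_add lm)
       (auto intro!: borel_measurable_continuous_onI continuous_intros)
  show "sets (distr lborel borel ?T) = sets lborel" by simp
  fix A assume "A \<in> sets (distr lborel borel ?T)"
  then have [measurable]: "A \<in> sets borel" by simp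
  let ?F = "indicator A :: 'n heis \<Rightarrow> ennreal"
  have m: "?F \<in> borel_measurable (borel \<Otimes>\<^sub>M borel \<Otimes>\<^sub>M borel)"
    by (simp add: borel_prod)
  note m[measurable]
  have i: "(\<integral>\<^sup>+w. ?F (x, y, l' + c *\<^sub>R w) \<partial>lborel) = (\<integral>\<^sup>+w. ?F (x, y, w) \<partial>lborel)" for x y l'
    by (rule nn_integral_affine_unit[OF _ c, of "\<lambda>w. ?F (x, y, w)"]) measurable
  have "emeasure (distr lborel borel ?T) A = (\<integral>\<^sup>+p. ?F (?T p) \<partial>lborel)"
    using nn_integral_distr[of ?T lborel borel ?F] T by simp
  also have "\<dots> = (\<integral>\<^sup>+x. \<integral>\<^sup>+y. \<integral>\<^sup>+w. ?F (a + c *\<^sub>R x, b + c *\<^sub>R y, w) \<partial>lborel \<partial>lborel \<partial>lborel)"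
    using measurable_compose[OF T, of ?F borel]
    by (subst nn_integral_lborel_triple) (simp_all add: i[unfolded real_scaleR_def])
  also have "\<dots> = (\<integral>\<^sup>+x. \<integral>\<^sup>+y. \<integral>\<^sup>+w. ?F (a + c *\<^sub>R x, y, w) \<partial>lborel \<partial>lborel \<partial>lborel)"
    by (intro nn_integral_cong nn_integral_affine_unit[OF _ c, where f = "\<lambda>y. \<integral>\<^sup>+w. ?F (a + c *\<^sub>R x, y, w) \<partial>lborel" for x]) measurable
  also have "\<dots> = (\<integral>\<^sup>+x. \<integral>\<^sup>+y. \<integral>\<^sup>+w. ?F (x, y, w) \<partial>lborel \<partial>lborel \<partial>lborel)"
    by (intro nn_integral_affine_unit[OF _ c, where f = "\<lambda>x. \<integral>\<^sup>+y. \<integral>\<^sup>+w. ?F (x, y, w) \<partial>lborel \<partial>lborel"]) measurable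
  also have "\<dots> = emeasure lborel A"
    by (subst nn_integral_lborel_triple[symmetric]) simp_all
  finally show "emeasure (distr lborel borel ?T) A = emeasure lborel A" .
qed

lemma hmul_eq: "\<xi> \<circ>\<^sub>H \<eta> = (fst \<xi> + fst \<eta>, fst (snd \<xi>) + fst (snd \<eta>),
   snd (snd \<xi>) + snd (snd \<eta>) + 2 * (fst (snd \<xi>) \<bullet> fst \<eta>) - 2 * (fst \<xi> \<bullet> fst (snd \<eta>)))"
  by (cases \<xi>; cases \<eta>) simp

lemma hmul_assoc: "(\<xi> \<circ>\<^sub>H \<eta>) \<circ>\<^sub>H \<zeta> = \<xi> \<circ>\<^sub>H (\<eta> \<circ>\<^sub>H \<zeta>)"
  by (simp add: hmul_eq algebra_simps inner_add_left inner_add_right)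

lemma hinv_hmul: "hinv (\<xi> \<circ>\<^sub>H \<eta>) = hinv \<eta> \<circ>\<^sub>H hinv \<xi>"
  by (simp add: hmul_eq hinv_def inner_commute)

lemma hinv_hinv [simp]: "hinv (hinv \<xi>) = \<xi>"
  by (simp add: hinv_def)

lemma hmul_hinv_cancel [simp]:
  "\<xi> \<circ>\<^sub>H (hinv \<xi> \<circ>\<^sub>H \<eta>) = \<eta>" "hinv \<xi> \<circ>\<^sub>H (\<xi> \<circ>\<^sub>H \<eta>) = \<eta>"
  by (simp_all add: hmul_eq hinv_def prod_eq_iff algebra_simps inner_commute inner_add_right inner_diff_right)

lemma measurable_hmul [measurable (raw)]:
  fixes f g :: "'a \<Rightarrow> 'n::finite heis"
  assumes "f \<in> borel_measurable M" "g \<in> borel_measurable M"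
  shows "(\<lambda>x. f x \<circ>\<^sub>H g x) \<in> borel_measurable M"
proof -
  have "(\<lambda>p. fst p \<circ>\<^sub>H snd p) \<in> borel_measurable (borel :: ('n heis \<times> 'n heis) measure)"
    unfolding hmul_eq by (intro borel_measurable_continuous_onI continuous_intros)
  from measurable_compose[OF borel_measurable_Pair[OF assms] this] show ?thesis by simp
qed

lemma measurable_hinv [measurable (raw)]:
  assumes "f \<in> borel_measurable M"
  shows "(\<lambda>x. hinv (f x)) \<in> borel_measurable M"
  unfolding hinv_def using assms by measurable

lemma distr_hmul_right: "distr lborel borel (\<lambda>\<eta>. \<eta> \<circ>\<^sub>H \<xi>) = lborel"
proof -
  obtain x' y' w' where \<xi>: "\<xi> = (x', y', w')" by (cases \<xi>)
  have "(\<lambda>\<eta>. \<eta> \<circ>\<^sub>H \<xi>) = (\<lambda>(x, y, w). (x' + 1 *\<^sub>R x, y' + 1 *\<^sub>R y, (w' + 2 * (y \<bullet> x') - 2 * (x \<bullet> y')) + 1 *\<^sub>R w))"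
    by (auto simp: \<xi> fun_eq_iff)
  then show ?thesis
    by (simp only:) (intro distr_heis_shear, auto intro!: borel_measurable_continuous_onI continuous_intros simp: case_prod_beta')
qed

lemma distr_hmul_left: "distr lborel borel (\<lambda>\<eta>. \<xi> \<circ>\<^sub>H \<eta>) = lborel"
proof -
  obtain x' y' w' where \<xi>: "\<xi> = (x', y', w')" by (cases \<xi>)
  have "(\<lambda>\<eta>. \<xi> \<circ>\<^sub>H \<eta>) = (\<lambda>(x, y, w). (x' + 1 *\<^sub>R x, y' + 1 *\<^sub>R y, (w' + 2 * (y' \<bullet> x) - 2 * (x' \<bullet> y)) + 1 *\<^sub>R w))"
    by (auto simp: \<xi> fun_eq_iff)
  then show ?thesis
    by (simp only:) (intro distr_heis_shear, auto intro!: borel_measurable_continuous_onI continuous_intros simp: case_prod_beta')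
qed

lemma distr_hinv: "distr lborel borel hinv = (lborel :: 'n::finite heis measure)"
proof -
  have *: "hinv = (\<lambda>(x, y, w). (0 + (-1) *\<^sub>R x :: real^'n, 0 + (-1) *\<^sub>R y :: real^'n, 0 + (-1) *\<^sub>R w))"
    by (auto simp: hinv_def fun_eq_iff)
  show ?thesis
    unfolding * by (intro distr_heis_shear) auto
qed

lemma distr_hinv_hmul: "distr lborel borel (\<lambda>\<eta>. hinv \<eta> \<circ>\<^sub>H \<xi>) = lborel"
proof -
  have "distr (distr lborel borel hinv) borel (\<lambda>\<eta>. \<eta> \<circ>\<^sub>H \<xi>) = distr lborel borel (\<lambda>\<eta>. hinv \<eta> \<circ>\<^sub>H \<xi>)"
    by (subst distr_distr) (auto simp: comp_def)
  then show ?thesis by (simp add: distr_hinv distr_hmul_right)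
qed

section \<open>Convolution\<close>

text \<open>One predicate for both translations and for
  \<open>\<eta> \<mapsto> hinv \<eta> \<circ>\<^sub>H \<xi>\<close>, so that each change of
  variables rule is proved once. That the last map qualifies expresses unimodularity of the
  group.\<close>

definition haar_preserving :: "('a::euclidean_space \<Rightarrow> 'a) \<Rightarrow> bool" where
  "haar_preserving T \<longleftrightarrow> T \<in> borel_measurable borel \<and> distr lborel borel T = lborel"

lemma haar_preserving_hmul:
  "haar_preserving (\<lambda>\<eta>. \<eta> \<circ>\<^sub>H \<xi>)" "haar_preserving (\<lambda>\<eta>. \<xi> \<circ>\<^sub>H \<eta>)" "haar_preserving (\<lambda>\<eta>. hinv \<eta> \<circ>\<^sub>H \<xi>)"
  by (auto simp: haar_preserving_def distr_hmul_right distr_hmul_left distr_hinv_hmul)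

context
  fixes T :: "'a::euclidean_space \<Rightarrow> 'a"
  assumes T: "haar_preserving T"
begin

lemma haar_preserving_measurable: "T \<in> borel_measurable borel"
  and haar_preserving_distr: "distr lborel borel T = lborel"
  using T by (auto simp: haar_preserving_def)

lemma haar_preserving_nn_integral:
  "F \<in> borel_measurable borel \<Longrightarrow> (\<integral>\<^sup>+x. F (T x) \<partial>lborel) = (\<integral>\<^sup>+x. F x \<partial>lborel)"
  using nn_integral_distr[of T lborel borel F] by (simp add: haar_preserving_distr haar_preserving_measurable)

lemma haar_preserving_integral:
  fixes F :: "'a \<Rightarrow> real"
  shows "F \<in> borel_measurable borel \<Longrightarrow> (LINT x|lborel. F (T x)) = (LINT x|lborel. F x)"
  using integral_distr[of T lborel borel F] by (simp add: haar_preserving_distr haar_preserving_measurable)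

lemma haar_preserving_integrable:
  fixes F :: "'a \<Rightarrow> real"
  shows "F \<in> borel_measurable borel \<Longrightarrow> integrable lborel (\<lambda>x. F (T x)) \<longleftrightarrow> integrable lborel F"
  using integrable_distr_eq[of T lborel borel F] by (simp add: haar_preserving_distr haar_preserving_measurable)

lemma haar_preserving_AE:
  "{x. P x} \<in> sets borel \<Longrightarrow> (AE x in lborel. P (T x)) \<longleftrightarrow> (AE x in lborel. P x)"
  using AE_distr_iff[of T lborel borel P] unfolding haar_preserving_distr by (simp add: haar_preserving_measurable)

text \<open>The exceptional set need not be measurable: it lies in a Borel null set, and the
  preimage of that set is null.\<close>

lemma haar_preserving_AE':
  assumes "AE x in lborel. P x" shows "AE x in lborel. P (T x)"
proof -
  obtain N where N: "{x \<in> space lborel. \<not> P x} \<subseteq> N" "N \<in> null_sets lborel"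
    using assms by (auto simp: eventually_ae_filter)
  have "AE x in lborel. x \<notin> N" using N by (simp add: AE_not_in)
  then have "AE x in lborel. T x \<notin> N"
    using N by (subst haar_preserving_AE) (auto simp: Compl_eq[symmetric] null_setsD2)
  then show ?thesis by eventually_elim (use N in auto)
qed

end

section \<open>Convolution operators with an integrable kernel\<close>

lemma integrable_indicator_bounded:
  fixes A :: "'a::euclidean_space set"
  assumes "A \<in> sets borel" "bounded A"
  shows "integrable lborel (indicator A :: 'a \<Rightarrow> real)"
  using assms emeasure_bounded_finite[of A] by (intro integrable_real_indicator) auto

text \<open>In group notation this is the convolution \<open>g * k\<close>, with the arguments in
  reverse order. The group is not commutative, so the order matters; with this one, composition of
  operators corresponds to \<open>hconv k l\<close> without a swap.\<close>

definition hconv :: "('n::finite heis \<Rightarrow> real) \<Rightarrow> ('n heis \<Rightarrow> real) \<Rightarrow> 'n heis \<Rightarrow> real" where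
  "hconv k g \<xi> = (LINT \<eta>|lborel. k (hinv \<eta> \<circ>\<^sub>H \<xi>) * g \<eta>)"

lemma heat_op_eq_hconv: "heat_op h t g = hconv (h t) g"
  by (simp add: heat_op_def hconv_def fun_eq_iff)

text \<open>Real-valued, hence informative only for integrable \<open>k\<close>: the integral of a
  non-integrable function defaults to 0.\<close>

definition L1_norm :: "('a::euclidean_space \<Rightarrow> real) \<Rightarrow> real" where
  "L1_norm k = (LINT x|lborel. \<bar>k x\<bar>)"

lemma L1_norm_nonneg [simp]: "0 \<le> L1_norm k"
  by (simp add: L1_norm_def)

lemma measurable_hconv [measurable]:
  assumes [measurable]: "k \<in> borel_measurable borel" "g \<in> borel_measurable borel"
  shows "hconv k g \<in> borel_measurable borel"
  unfolding hconv_def by measurable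

lemma hconv_translate_integrable:
  fixes k :: "'n::finite heis \<Rightarrow> real"
  assumes k: "integrable lborel k"
  shows "integrable lborel (\<lambda>\<eta>. k (hinv \<eta> \<circ>\<^sub>H \<xi>))"
  using haar_preserving_integrable[OF haar_preserving_hmul(3), of k] k by simp

text \<open>Young's inequality for \<open>L^1\<close> against \<open>L^\<infinity>\<close>. It holds
  at every point \<open>\<xi>\<close>, although \<open>g\<close> is bounded only almost everywhere,
  and this makes pointwise work with Duhamel integrals possible.\<close>

lemma hconv_bounded:
  assumes k: "integrable lborel k" and [measurable]: "g \<in> borel_measurable borel"
    and g: "AE x in lborel. \<bar>g x\<bar> \<le> M"
  shows hconv_integrable: "integrable lborel (\<lambda>\<eta>. k (hinv \<eta> \<circ>\<^sub>H \<xi>) * g \<eta>)"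
    and hconv_bound: "\<bar>hconv k g \<xi>\<bar> \<le> L1_norm k * M"
proof -
  have [measurable]: "k \<in> borel_measurable borel" using k by auto
  have i: "integrable lborel (\<lambda>\<eta>. \<bar>k (hinv \<eta> \<circ>\<^sub>H \<xi>)\<bar> * M)"
    using hconv_translate_integrable[OF k] by auto
  have ae: "AE \<eta> in lborel. \<bar>k (hinv \<eta> \<circ>\<^sub>H \<xi>) * g \<eta>\<bar> \<le> \<bar>k (hinv \<eta> \<circ>\<^sub>H \<xi>)\<bar> * M"
    using g by eventually_elim (auto simp: abs_mult intro: mult_left_mono)
  show *: "integrable lborel (\<lambda>\<eta>. k (hinv \<eta> \<circ>\<^sub>H \<xi>) * g \<eta>)"
    by (rule Bochner_Integration.integrable_bound[OF i]) (use ae in \<open>auto elim!: eventually_mono\<close>)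
  have "\<bar>hconv k g \<xi>\<bar> \<le> (LINT \<eta>|lborel. \<bar>k (hinv \<eta> \<circ>\<^sub>H \<xi>) * g \<eta>\<bar>)"
    unfolding hconv_def by (rule integral_abs_bound)
  also have "\<dots> \<le> (LINT \<eta>|lborel. \<bar>k (hinv \<eta> \<circ>\<^sub>H \<xi>)\<bar> * M)"
    using ae by (intro integral_mono_AE integrable_abs * i)
  also have "\<dots> = (LINT \<eta>|lborel. \<bar>k (hinv \<eta> \<circ>\<^sub>H \<xi>)\<bar>) * M"
    by simp
  also have "(LINT \<eta>|lborel. \<bar>k (hinv \<eta> \<circ>\<^sub>H \<xi>)\<bar>) = L1_norm k"
    unfolding L1_norm_def by (rule haar_preserving_integral[OF haar_preserving_hmul(3), of "\<lambda>x. \<bar>k x\<bar>"]) auto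
  finally show "\<bar>hconv k g \<xi>\<bar> \<le> L1_norm k * M" .
qed

text \<open>The integral does not see null sets, and the map carrying \<open>k\<close> preserves
  them. Almost everywhere identities of kernels thus act as identities at every
  \<open>\<xi>\<close>.\<close>

lemma hconv_cong_AE:
  assumes [measurable]: "k \<in> borel_measurable borel" "k' \<in> borel_measurable borel"
      "g \<in> borel_measurable borel" "g' \<in> borel_measurable borel"
    and "AE x in lborel. k x = k' x" "AE x in lborel. g x = g' x"
  shows "hconv k g \<xi> = hconv k' g' \<xi>"
  unfolding hconv_def
proof (rule integral_cong_AE)
  have "AE \<eta> in lborel. k (hinv \<eta> \<circ>\<^sub>H \<xi>) = k' (hinv \<eta> \<circ>\<^sub>H \<xi>)"
    by (rule haar_preserving_AE'[OF haar_preserving_hmul(3)]) fact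
  then show "AE \<eta> in lborel. k (hinv \<eta> \<circ>\<^sub>H \<xi>) * g \<eta> = k' (hinv \<eta> \<circ>\<^sub>H \<xi>) * g' \<eta>"
    using assms(6) by eventually_elim simp
qed auto

text \<open>Substituting \<open>\<zeta> = hinv \<eta> \<circ>\<^sub>H \<xi>\<close> moves the
  translation from the kernel to \<open>g\<close>. As a function of \<open>\<xi>\<close> the
  integrand then consists of right translates of \<open>g\<close>, whose norms do not depend on
  \<open>\<zeta>\<close>.\<close>

lemma hconv_alt:
  assumes [measurable]: "k \<in> borel_measurable borel" "g \<in> borel_measurable borel"
  shows "hconv k g \<xi> = (LINT \<zeta>|lborel. k \<zeta> * g (\<xi> \<circ>\<^sub>H hinv \<zeta>))"
  using haar_preserving_integral[OF haar_preserving_hmul(3), of "\<lambda>\<zeta>. k \<zeta> * g (\<xi> \<circ>\<^sub>H hinv \<zeta>)" \<xi>]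
  by (simp add: hconv_def hinv_hmul)

lemma hconv_alt_integrable:
  fixes k :: "'n::finite heis \<Rightarrow> real"
  assumes [measurable]: "k \<in> borel_measurable borel" "g \<in> borel_measurable borel"
  shows "integrable lborel (\<lambda>\<eta>. k (hinv \<eta> \<circ>\<^sub>H \<xi>) * g \<eta>) \<longleftrightarrow> integrable lborel (\<lambda>\<zeta>. k \<zeta> * g (\<xi> \<circ>\<^sub>H hinv \<zeta>))"
  using haar_preserving_integrable[OF haar_preserving_hmul(3), of "\<lambda>\<zeta>. k \<zeta> * g (\<xi> \<circ>\<^sub>H hinv \<zeta>)" \<xi>]
  by (simp add: hinv_hmul)

context
  fixes k g :: "'n::finite heis \<Rightarrow> real"
  assumes k: "integrable lborel k" and g: "integrable lborel g"
begin

private lemma meas[measurable]: "k \<in> borel_measurable borel" "g \<in> borel_measurable borel"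
  using k g by auto

private lemma shift_integrable: "integrable lborel (\<lambda>\<xi>. g (\<xi> \<circ>\<^sub>H \<eta>))"
    and shift_integral: "(LINT \<xi>|lborel. g (\<xi> \<circ>\<^sub>H \<eta>)) = (LINT \<xi>|lborel. g \<xi>)"
    and shift_abs_integral: "(LINT \<xi>|lborel. \<bar>g (\<xi> \<circ>\<^sub>H \<eta>)\<bar>) = L1_norm g"
  using g haar_preserving_integrable[OF haar_preserving_hmul(1), of g \<eta>]
    haar_preserving_integral[OF haar_preserving_hmul(1), of g \<eta>]
    haar_preserving_integral[OF haar_preserving_hmul(1), of "\<lambda>x. \<bar>g x\<bar>" \<eta>] by (auto simp: L1_norm_def)

private lemma pair_integrable: "integrable (lborel \<Otimes>\<^sub>M lborel) (\<lambda>(\<zeta>, \<xi>). k \<zeta> * g (\<xi> \<circ>\<^sub>H hinv \<zeta>))"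
proof (rule lborel_pair.Fubini_integrable)
  show "integrable lborel (\<lambda>\<zeta>. LINT \<xi>|lborel. norm (case (\<zeta>, \<xi>) of (\<zeta>, \<xi>) \<Rightarrow> k \<zeta> * g (\<xi> \<circ>\<^sub>H hinv \<zeta>)))"
    using k by (simp add: abs_mult shift_abs_integral)
qed (auto simp: shift_integrable)

text \<open>Fubini in the form with the translation on \<open>g\<close>: the integral over
  \<open>\<xi>\<close> of a translate of \<open>g\<close> is a constant, so the double integral
  factorises.\<close>

lemma hconv_L1_integrable: "integrable lborel (hconv k g)"
  and hconv_L1_AE: "AE \<xi> in lborel. integrable lborel (\<lambda>\<eta>. k (hinv \<eta> \<circ>\<^sub>H \<xi>) * g \<eta>)"
  and hconv_L1_integral: "(LINT \<xi>|lborel. hconv k g \<xi>) = (LINT \<xi>|lborel. k \<xi>) * (LINT \<xi>|lborel. g \<xi>)"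
proof -
  have e: "hconv k g = (\<lambda>\<xi>. LINT \<zeta>|lborel. k \<zeta> * g (\<xi> \<circ>\<^sub>H hinv \<zeta>))"
    by (intro ext hconv_alt meas)
  show "integrable lborel (hconv k g)"
    unfolding e using pair_integrable by (rule lborel_pair.integrable_snd)
  show "AE \<xi> in lborel. integrable lborel (\<lambda>\<eta>. k (hinv \<eta> \<circ>\<^sub>H \<xi>) * g \<eta>)"
    unfolding hconv_alt_integrable[OF meas] using pair_integrable by (rule lborel_pair.AE_integrable_snd)
  show "(LINT \<xi>|lborel. hconv k g \<xi>) = (LINT \<xi>|lborel. k \<xi>) * (LINT \<xi>|lborel. g \<xi>)"
    unfolding e using lborel_pair.Fubini_integral[OF pair_integrable] by (simp add: shift_integral)
qed

end

lemma hconv_L1_norm: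
  assumes k: "integrable lborel k" and g: "integrable lborel g"
  shows "L1_norm (hconv k g) \<le> L1_norm k * L1_norm g"
proof -
  have [measurable]: "k \<in> borel_measurable borel" "g \<in> borel_measurable borel"
    using k g by auto
  have le: "\<bar>hconv k g \<xi>\<bar> \<le> hconv (\<lambda>x. \<bar>k x\<bar>) (\<lambda>x. \<bar>g x\<bar>) \<xi>" for \<xi>
    unfolding hconv_def using integral_abs_bound[of lborel "\<lambda>\<eta>. k (hinv \<eta> \<circ>\<^sub>H \<xi>) * g \<eta>"] by (simp add: abs_mult)
  have "L1_norm (hconv k g) \<le> (LINT \<xi>|lborel. hconv (\<lambda>x. \<bar>k x\<bar>) (\<lambda>x. \<bar>g x\<bar>) \<xi>)"
    unfolding L1_norm_def using k g le by (intro integral_mono integrable_abs hconv_L1_integrable) auto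
  also have "\<dots> = L1_norm k * L1_norm g"
    unfolding L1_norm_def using k g by (intro hconv_L1_integral) auto
  finally show ?thesis .
qed

text \<open>Fubini, which applies because the convolution of \<open>\<bar>l\<bar>\<close> with
  \<open>\<bar>g\<bar>\<close> is again bounded and so may serve as datum for
  \<open>\<bar>k\<bar>\<close>. A left translation by \<open>hinv \<zeta>\<close> then recognises
  the inner integral as a convolution of kernels.\<close>

lemma hconv_assoc:
  assumes k: "integrable lborel k" and l: "integrable lborel l"
    and [measurable]: "g \<in> borel_measurable borel" and g: "AE x in lborel. \<bar>g x\<bar> \<le> M"
  shows "hconv k (hconv l g) \<xi> = hconv (hconv k l) g \<xi>"
proof -
  have [measurable]: "k \<in> borel_measurable borel" "l \<in> borel_measurable borel"
    using k l by auto
  let ?\<Phi> = "\<lambda>\<eta> \<zeta>. k (hinv \<eta> \<circ>\<^sub>H \<xi>) * (l (hinv \<zeta> \<circ>\<^sub>H \<eta>) * g \<zeta>)"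
  have "integrable (lborel \<Otimes>\<^sub>M lborel) (case_prod ?\<Phi>)"
  proof (rule lborel_pair.Fubini_integrable)
    have bd: "\<bar>hconv (\<lambda>x. \<bar>l x\<bar>) (\<lambda>x. \<bar>g x\<bar>) \<eta>\<bar> \<le> L1_norm (\<lambda>x. \<bar>l x\<bar>) * M" for \<eta>
      by (rule hconv_bound) (use l g in auto)
    have "integrable lborel (\<lambda>\<eta>. \<bar>k (hinv \<eta> \<circ>\<^sub>H \<xi>)\<bar> * hconv (\<lambda>x. \<bar>l x\<bar>) (\<lambda>x. \<bar>g x\<bar>) \<eta>)"
      by (rule hconv_integrable[where k = "\<lambda>x. \<bar>k x\<bar>" and M = "L1_norm (\<lambda>x. \<bar>l x\<bar>) * M"])
         (use k l bd in auto)
    then show "integrable lborel (\<lambda>\<eta>. LINT \<zeta>|lborel. norm (case (\<eta>, \<zeta>) of (\<eta>, \<zeta>) \<Rightarrow> ?\<Phi> \<eta> \<zeta>))"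
      by (simp add: abs_mult hconv_def)
    show "AE \<eta> in lborel. integrable lborel (\<lambda>\<zeta>. case (\<eta>, \<zeta>) of (\<eta>, \<zeta>) \<Rightarrow> ?\<Phi> \<eta> \<zeta>)"
      using hconv_integrable[OF l _ g] by simp
  qed measurable
  note F = lborel_pair.Fubini_integral[OF this]
  have i: "(LINT \<eta>|lborel. k (hinv \<eta> \<circ>\<^sub>H \<xi>) * l (hinv \<zeta> \<circ>\<^sub>H \<eta>)) = hconv k l (hinv \<zeta> \<circ>\<^sub>H \<xi>)" for \<zeta>
    using haar_preserving_integral[OF haar_preserving_hmul(2), of "\<lambda>\<eta>. k (hinv \<eta> \<circ>\<^sub>H (hinv \<zeta> \<circ>\<^sub>H \<xi>)) * l \<eta>" "hinv \<zeta>"]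
    by (simp add: hconv_def hinv_hmul hmul_assoc)
  have "hconv k (hconv l g) \<xi> = (LINT \<eta>|lborel. LINT \<zeta>|lborel. ?\<Phi> \<eta> \<zeta>)"
    by (simp add: hconv_def)
  also have "\<dots> = (LINT \<zeta>|lborel. LINT \<eta>|lborel. (k (hinv \<eta> \<circ>\<^sub>H \<xi>) * l (hinv \<zeta> \<circ>\<^sub>H \<eta>)) * g \<zeta>)"
    by (subst F[symmetric]) (simp add: mult.assoc)
  also have "\<dots> = (LINT \<zeta>|lborel. hconv k l (hinv \<zeta> \<circ>\<^sub>H \<xi>) * g \<zeta>)"
    by (simp add: i)
  finally show ?thesis by (simp add: hconv_def)
qed

lemma hconv_diff_left:
  assumes "integrable lborel k" "integrable lborel l"
    and "g \<in> borel_measurable borel" and g: "AE x in lborel. \<bar>g x\<bar> \<le> M"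
  shows "hconv (\<lambda>x. k x - l x) g \<xi> = hconv k g \<xi> - hconv l g \<xi>"
  unfolding hconv_def left_diff_distrib
  by (intro Bochner_Integration.integral_diff hconv_integrable[OF _ _ g] assms)

lemma hconv_add_right:
  assumes "integrable lborel k"
    and "g \<in> borel_measurable borel" and g: "AE x in lborel. \<bar>g x\<bar> \<le> M"
    and "f \<in> borel_measurable borel" and f: "AE x in lborel. \<bar>f x\<bar> \<le> M'"
  shows "hconv k (\<lambda>x. g x + f x) \<xi> = hconv k g \<xi> + hconv k f \<xi>"
  unfolding hconv_def distrib_left
  by (intro Bochner_Integration.integral_add hconv_integrable[OF _ _ g] hconv_integrable[OF _ _ f] assms)

lemma hconv_diff_right:
  assumes "integrable lborel k"
    and "g \<in> borel_measurable borel" and g: "AE x in lborel. \<bar>g x\<bar> \<le> M"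
    and "f \<in> borel_measurable borel" and f: "AE x in lborel. \<bar>f x\<bar> \<le> M'"
  shows "hconv k (\<lambda>x. g x - f x) \<xi> = hconv k g \<xi> - hconv k f \<xi>"
  unfolding hconv_def right_diff_distrib
  by (intro Bochner_Integration.integral_diff hconv_integrable[OF _ _ g] hconv_integrable[OF _ _ f] assms)

lemma hconv_cmult_right: "hconv k (\<lambda>x. c * g x) \<xi> = c * hconv k g \<xi>"
  by (simp add: hconv_def mult.left_commute)

lemma hconv_mono:
  assumes "integrable lborel k" and k: "AE x in lborel. 0 \<le> k x"
    and "g \<in> borel_measurable borel" and g: "AE x in lborel. \<bar>g x\<bar> \<le> M"
    and "f \<in> borel_measurable borel" and f: "AE x in lborel. \<bar>f x\<bar> \<le> M'"
    and le: "AE x in lborel. g x \<le> f x"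
  shows "hconv k g \<xi> \<le> hconv k f \<xi>"
  unfolding hconv_def
proof (intro integral_mono_AE hconv_integrable[OF _ _ g] hconv_integrable[OF _ _ f] assms)
  show "AE \<eta> in lborel. k (hinv \<eta> \<circ>\<^sub>H \<xi>) * g \<eta> \<le> k (hinv \<eta> \<circ>\<^sub>H \<xi>) * f \<eta>"
    using haar_preserving_AE'[OF haar_preserving_hmul(3) k] le
    by eventually_elim (rule mult_left_mono)
qed

text \<open>A countable \<open>\<pi>\<close>-system lets one exchange ``for every set'' with ``for almost every point''.\<close>

lemma countable_pi_system_borel:
  obtains E :: "'a::euclidean_space set set"
  where "countable E" "Int_stable E" "UNIV \<in> E" "sets borel = sigma_sets UNIV E"
proof -
  obtain B :: "'a set set" where B: "countable B" "topological_basis B"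
    using ex_countable_basis by auto
  define E where "E = Inter ` {F. finite F \<and> F \<subseteq> B}"
  have oB: "open b" if "b \<in> B" for b using B(2) that by (auto simp: topological_basis_open)
  have "countable E" unfolding E_def using B by (intro countable_image countable_Collect_finite_subset)
  moreover have "Int_stable E"
  proof (rule Int_stableI)
    fix a b assume "a \<in> E" "b \<in> E"
    then obtain F G where "finite F" "F \<subseteq> B" "a = \<Inter>F" "finite G" "G \<subseteq> B" "b = \<Inter>G" by (auto simp: E_def)
    then show "a \<inter> b \<in> E" unfolding E_def by (intro image_eqI[of _ _ "F \<union> G"]) auto
  qed
  moreover have "UNIV \<in> E" unfolding E_def by (intro image_eqI[of _ _ "{}"]) auto
  moreover have "sets borel = sigma_sets UNIV E"
  proof (rule antisym)
    have "sets borel = sigma_sets UNIV B"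
      by (subst borel_eq_countable_basis[OF B]) (auto intro!: sets_measure_of)
    also have "\<dots> \<subseteq> sigma_sets UNIV E"
    proof (rule sigma_sets_mono')
      show "B \<subseteq> E" unfolding E_def by (auto intro!: image_eqI[of _ _ "{b}" for b])
    qed
    finally show "sets borel \<subseteq> sigma_sets UNIV E" .
    have "E \<subseteq> sets borel" unfolding E_def using oB by (auto intro!: borel_open open_Inter)
    then show "sigma_sets UNIV E \<subseteq> sets borel"
      using sets.sigma_sets_subset[of E borel] by simp
  qed
  ultimately show ?thesis by (rule that)
qed

text \<open>The positive and negative parts of \<open>\<kappa>\<close> are densities of two finite
  measures that agree on a generating \<pi>-system, hence everywhere. Equal densities force both
  parts to vanish, since at each point one of them does.\<close>

lemma AE_zero_if_integrals_zero:
  fixes \<kappa> :: "'a::euclidean_space \<Rightarrow> real"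
  assumes E: "Int_stable E" "UNIV \<in> E" "sets borel = sigma_sets UNIV E"
    and k: "integrable lborel \<kappa>"
    and z: "\<And>A. A \<in> E \<Longrightarrow> (LINT x|lborel. indicator A x * \<kappa> x) = 0"
  shows "AE x in lborel. \<kappa> x = 0"
proof -
  have [measurable]: "\<kappa> \<in> borel_measurable borel" using k by auto
  let ?p = "\<lambda>x. max 0 (\<kappa> x)" and ?n = "\<lambda>x. max 0 (- \<kappa> x)"
  have ip: "integrable lborel ?p" "integrable lborel ?n" using k by auto
  have fin: "(\<integral>\<^sup>+x. ennreal (?p x) \<partial>lborel) \<noteq> \<infinity>"
    using nn_integral_eq_integral[OF ip(1)] by simp
  have e: "emeasure (density lborel (\<lambda>x. ennreal (q x))) A = ennreal (LINT x|lborel. indicator A x * q x)"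
    if "integrable lborel q" "\<And>x. 0 \<le> q x" and [measurable]: "A \<in> sets borel" for q :: "'a \<Rightarrow> real" and A
  proof -
    have [measurable]: "q \<in> borel_measurable borel" using that(1) by auto
    have "emeasure (density lborel (\<lambda>x. ennreal (q x))) A = (\<integral>\<^sup>+x. ennreal (indicator A x * q x) \<partial>lborel)"
      by (subst emeasure_density) (auto intro!: nn_integral_cong split: split_indicator)
    also have "\<dots> = ennreal (LINT x|lborel. indicator A x * q x)"
      using that integrable_mult_indicator[of A lborel q] by (intro nn_integral_eq_integral) (auto simp: mult.commute)
    finally show ?thesis .
  qed
  have eq: "emeasure (density lborel (\<lambda>x. ennreal (?p x))) A = emeasure (density lborel (\<lambda>x. ennreal (?n x))) A"
    if "A \<in> E" for A
  proof -
    have A: "A \<in> sets borel" using that E(3) by auto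
    have "(LINT x|lborel. indicator A x * ?p x) - (LINT x|lborel. indicator A x * ?n x) = (LINT x|lborel. indicator A x * \<kappa> x)"
      using ip A integrable_mult_indicator[of A lborel ?p] integrable_mult_indicator[of A lborel ?n]
      by (subst Bochner_Integration.integral_diff[symmetric])
         (auto simp: right_diff_distrib[symmetric] max_def intro!: Bochner_Integration.integral_cong)
    then show ?thesis using z[OF that] e[OF ip(1) _ A] e[OF ip(2) _ A] by simp
  qed
  have "density lborel (\<lambda>x. ennreal (?p x)) = density lborel (\<lambda>x. ennreal (?n x))"
    using E fin by (intro measure_eqI_generator_eq[OF E(1) _ eq, where \<Omega> = UNIV and A = "\<lambda>_. UNIV"])
      (auto simp: emeasure_density)
  then have "AE x in lborel. ennreal (?p x) = ennreal (?n x)"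
    using fin by (subst (asm) finite_density_unique) auto
  then show ?thesis by eventually_elim (auto simp: max_def split: if_splits)
qed

text \<open>An operator determines its kernel: at a single good point \<open>\<xi>\<close> the
  translated kernel has integral zero over all sets of the \<pi>-system, cut down to balls. The
  balls keep the test functions integrable and are exhausted at the end.\<close>

lemma AE_zero_if_hconv_zero:
  fixes k :: "'n::finite heis \<Rightarrow> real"
  assumes k: "integrable lborel k"
    and z: "\<And>A. A \<in> sets borel \<Longrightarrow> bounded A \<Longrightarrow> AE \<xi> in lborel. hconv k (indicator A) \<xi> = 0"
  shows "AE x in lborel. k x = 0"
proof -
  have [measurable]: "k \<in> borel_measurable borel" using k by auto
  obtain E :: "'n heis set set" where E: "countable E" "Int_stable E" "UNIV \<in> E" "sets borel = sigma_sets UNIV E"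
    by (rule countable_pi_system_borel)
  have Eb: "A \<in> sets borel" if "A \<in> E" for A using that E by blast
  have "AE \<xi> in lborel. \<forall>A\<in>E. \<forall>n::nat. hconv k (indicator (A \<inter> ball 0 n)) \<xi> = 0"
    unfolding AE_ball_countable[OF E(1)] AE_all_countable
    by (intro ballI allI z sets.Int[OF Eb] borel_open open_ball bounded_subset[OF bounded_ball Int_lower2])
  then obtain N where N: "{\<xi> \<in> space lborel. \<not> (\<forall>A\<in>E. \<forall>n::nat. hconv k (indicator (A \<inter> ball 0 n)) \<xi> = 0)} \<subseteq> N"
      "N \<in> null_sets lborel"
    unfolding eventually_ae_filter by blast
  \<comment> \<open>The space has infinite measure, so a null set leaves out at least one point, and
    one point is enough.\<close>
  have "N \<noteq> UNIV" using N(2) by (auto simp: null_sets_def emeasure_lborel_UNIV)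
  then obtain \<xi> where "\<xi> \<notin> N" by blast
  with N(1) have \<xi>: "\<forall>A\<in>E. \<forall>n::nat. hconv k (indicator (A \<inter> ball 0 n)) \<xi> = 0" by (auto simp: space_lborel simp del: split_paired_All)
  have "AE \<eta> in lborel. \<forall>n::nat. indicator (ball 0 n) \<eta> * k (hinv \<eta> \<circ>\<^sub>H \<xi>) = 0"
    unfolding AE_all_countable
  proof
    fix n :: nat
    show "AE \<eta> in lborel. indicator (ball 0 n) \<eta> * k (hinv \<eta> \<circ>\<^sub>H \<xi>) = 0"
    proof (rule AE_zero_if_integrals_zero[OF E(2-4)])
      show "integrable lborel (\<lambda>\<eta>. indicator (ball 0 n) \<eta> * k (hinv \<eta> \<circ>\<^sub>H \<xi>))"
        using integrable_mult_indicator[OF _ hconv_translate_integrable[OF k, of \<xi>], of "ball 0 n"] by simp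
      fix A assume "A \<in> E"
      then show "(LINT \<eta>|lborel. indicator A \<eta> * (indicator (ball 0 n) \<eta> * k (hinv \<eta> \<circ>\<^sub>H \<xi>))) = 0"
        using \<xi> by (simp add: hconv_def indicator_inter_arith mult_ac)
    qed
  qed
  then have "AE \<eta> in lborel. k (hinv \<eta> \<circ>\<^sub>H \<xi>) = 0"
  proof eventually_elim
    case (elim \<eta>)
    obtain n :: nat where "norm \<eta> < n" using reals_Archimedean2 by blast
    with elim show ?case by (auto simp: indicator_def dest!: spec[of _ n])
  qed
  then show ?thesis
    by (subst (asm) haar_preserving_AE[OF haar_preserving_hmul(3), of "\<lambda>x. k x = 0"]) auto
qed

section \<open>The heat semigroup\<close>

text \<open>The measure is not zero, so some point satisfies the bound. Signs of essential bounds
  can therefore be deduced instead of assumed.\<close>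

lemma ess_bound_nonneg:
  assumes "AE x in lborel. \<bar>g x\<bar> \<le> (M::real)" shows "0 \<le> M"
proof -
  have "\<exists>x. \<bar>g x\<bar> \<le> M" using eventually_happens[OF assms] by (simp add: ae_filter_eq_bot_iff emeasure_lborel_UNIV)
  then show ?thesis using abs_ge_zero order_trans by blast
qed

text \<open>Positivity, semigroup law and strong continuity on \<open>L^1\<close>, restated with a
  real-valued norm. All statements about bounded data and about \<open>L^q\<close> are derived from
  these.\<close>

locale heis_semigroup =
  fixes h :: "real \<Rightarrow> 'n::finite heis \<Rightarrow> real"
  assumes kernel_integrable: "0 < t \<Longrightarrow> integrable lborel (h t)"
    and kernel_nonneg: "0 < t \<Longrightarrow> AE x in lborel. 0 \<le> h t x"
    and hconv_semigroup_L1: "\<lbrakk>0 < t; 0 < \<tau>; integrable lborel g\<rbrakk> \<Longrightarrow>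
      AE \<xi> in lborel. hconv (h (t + \<tau>)) g \<xi> = hconv (h t) (hconv (h \<tau>) g) \<xi>"
    and hconv_at_zero_L1: "integrable lborel g \<Longrightarrow>
      ((\<lambda>t. L1_norm (\<lambda>\<xi>. hconv (h t) g \<xi> - g \<xi>)) \<longlongrightarrow> 0) (at_right 0)"
begin

lemma kernel_measurable [measurable]: "0 < t \<Longrightarrow> h t \<in> borel_measurable borel"
  using kernel_integrable by auto

text \<open>The difference of the two kernels annihilates indicators of bounded sets. These are
  integrable, as the semigroup law on \<open>L^1\<close> demands, and bounded, as associativity
  demands.\<close>

lemma kernel_add:
  assumes "0 < t" "0 < \<tau>"
  shows "AE x in lborel. h (t + \<tau>) x = hconv (h t) (h \<tau>) x"
proof -
  have i: "integrable lborel (h t)" "integrable lborel (h \<tau>)" "integrable lborel (h (t + \<tau>))"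
    using assms by (auto intro: kernel_integrable)
  note j = hconv_L1_integrable[OF i(1,2)]
  have "AE x in lborel. h (t + \<tau>) x - hconv (h t) (h \<tau>) x = 0"
  proof (rule AE_zero_if_hconv_zero)
    fix A :: "'n heis set" assume A[measurable]: "A \<in> sets borel" and "bounded A"
    have iA: "integrable lborel (indicator A :: _ \<Rightarrow> real)"
      using A \<open>bounded A\<close> by (rule integrable_indicator_bounded)
    have b: "AE x in lborel. \<bar>indicator A x :: real\<bar> \<le> 1" by (auto simp: indicator_def)
    show "AE \<xi> in lborel. hconv (\<lambda>x. h (t + \<tau>) x - hconv (h t) (h \<tau>) x) (indicator A) \<xi> = 0"
      using hconv_semigroup_L1[OF assms iA]
    proof eventually_elim
      case (elim \<xi>)
      then show ?case
        by (simp add: hconv_diff_left[OF i(3) j _ b] hconv_assoc[OF i(1,2) _ b])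
    qed
  qed (use i j in auto)
  then show ?thesis by eventually_elim simp
qed

text \<open>The kernel identity carries the semigroup law from integrable to bounded data, and from
  almost every to every point.\<close>

lemma hconv_kernel_add:
  assumes "0 < t" "0 < \<tau>" and [measurable]: "g \<in> borel_measurable borel"
    and g: "AE x in lborel. \<bar>g x\<bar> \<le> M"
  shows "hconv (h (t + \<tau>)) g \<xi> = hconv (h t) (hconv (h \<tau>) g) \<xi>"
proof -
  have "hconv (h (t + \<tau>)) g \<xi> = hconv (hconv (h t) (h \<tau>)) g \<xi>"
    using assms kernel_add[OF assms(1,2)] by (intro hconv_cong_AE) auto
  then show ?thesis using hconv_assoc[OF _ _ _ g] assms kernel_integrable by simp
qed

section \<open>Total mass and continuity in time of the kernel\<close>

definition mass :: "real \<Rightarrow> real" where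
  "mass t = (LINT x|lborel. h t x)"

lemma L1_norm_kernel: "0 < t \<Longrightarrow> L1_norm (h t) = mass t"
  unfolding L1_norm_def mass_def
  using kernel_nonneg[of t] by (intro integral_cong_AE) (auto elim!: eventually_mono)

lemma mass_nonneg: "0 < t \<Longrightarrow> 0 \<le> mass t"
  using L1_norm_kernel[of t] L1_norm_nonneg[of "h t"] by simp

lemma mass_add:
  assumes "0 < t" "0 < \<tau>" shows "mass (t + \<tau>) = mass t * mass \<tau>"
proof -
  have "mass (t + \<tau>) = (LINT x|lborel. hconv (h t) (h \<tau>) x)"
    unfolding mass_def using assms kernel_add[OF assms] by (intro integral_cong_AE) auto
  then show ?thesis using assms by (simp add: hconv_L1_integral kernel_integrable mass_def)
qed

lemma integral_diff_le_L1_norm: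
  assumes "integrable lborel f" "integrable lborel g"
  shows "\<bar>(LINT x|lborel. f x) - (LINT x|lborel. g x)\<bar> \<le> L1_norm (\<lambda>x. f x - g x)"
  using integral_abs_bound[of lborel "\<lambda>x. f x - g x"] assms by (simp add: L1_norm_def)

text \<open>Tested on a normalised indicator \<open>g\<close>, strong continuity controls the
  difference of integrals, and the integral of \<open>hconv (h t) g\<close> is \<open>mass t\<close>
  by Fubini.\<close>

lemma mass_at_zero: "(mass \<longlongrightarrow> 1) (at_right 0)"
proof -
  define V where "V = measure lborel (ball 0 1 :: 'n heis set)"
  have V: "V > 0" unfolding V_def by (simp add: content_ball_pos)
  define g :: "'n heis \<Rightarrow> real" where "g x = indicator (ball 0 1) x / V" for x
  have g: "integrable lborel g"
    unfolding g_def by (intro integrable_divide_zero integrable_indicator_bounded) auto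
  have g1: "(LINT x|lborel. g x) = 1"
    using V unfolding g_def by (simp add: V_def)
  have "((\<lambda>t. mass t - 1) \<longlongrightarrow> 0) (at_right 0)"
  proof (rule Lim_null_comparison[OF _ hconv_at_zero_L1[OF g]])
    show "\<forall>\<^sub>F t in at_right 0. norm (mass t - 1) \<le> L1_norm (\<lambda>\<xi>. hconv (h t) g \<xi> - g \<xi>)"
      unfolding eventually_at_right_field
    proof (intro exI[of _ 1] conjI allI impI)
      fix t :: real assume "0 < t"
      then show "norm (mass t - 1) \<le> L1_norm (\<lambda>\<xi>. hconv (h t) g \<xi> - g \<xi>)"
        using integral_diff_le_L1_norm[OF hconv_L1_integrable[OF _ g] g, of "h t"] kernel_integrable[of t]
        by (simp add: hconv_L1_integral g g1 mass_def)
    qed simp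
  qed
  then show ?thesis using Lim_null by blast
qed

lemma mass_power: "0 < t \<Longrightarrow> mass (real (Suc n) * t) = mass t ^ Suc n"
proof (induction n)
  case (Suc n)
  have "mass (real (Suc (Suc n)) * t) = mass (t + real (Suc n) * t)"
    by (simp add: algebra_simps)
  also have "\<dots> = mass t * mass (real (Suc n) * t)"
    using Suc.prems by (intro mass_add) auto
  finally show ?case using Suc by simp
qed simp

text \<open>Multiplicativity spreads the bound 2, valid near 0, over any bounded interval: a time up
  to \<open>T\<close> is cut into equally many short steps.\<close>

lemma mass_bounded:
  obtains C where "1 \<le> C" "\<And>t. 0 < t \<Longrightarrow> t \<le> T \<Longrightarrow> mass t \<le> C"
proof -
  have "\<forall>\<^sub>F t in at_right 0. mass t < 2"
    using mass_at_zero by (rule order_tendstoD) simp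
  then obtain b where b: "b > 0" "\<And>t. 0 < t \<Longrightarrow> t < b \<Longrightarrow> mass t < 2"
    unfolding eventually_at_right_field by auto
  \<comment> \<open>With \<open>Suc n\<close> steps each step is shorter than \<open>b\<close>,
    whence the constant \<open>2 ^ Suc n\<close>.\<close>
  obtain n :: nat where n: "T / b < n" using reals_Archimedean2 by blast
  show ?thesis
  proof
    show "(1::real) \<le> 2 ^ Suc n" by (rule one_le_power) simp
    fix t assume t: "0 < t" "t \<le> T"
    let ?r = "t / real (Suc n)"
    have "T < real n * b" using n b by (simp add: divide_less_eq)
    then have "t < real (Suc n) * b" using t b by (simp add: distrib_right)
    then have "?r < b" by (simp add: divide_less_eq mult.commute)
    then have "mass ?r ^ Suc n \<le> 2 ^ Suc n"
      using b(2)[of ?r] t by (intro power_mono mass_nonneg) auto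
    moreover have "mass t = mass ?r ^ Suc n"
      using mass_power[of ?r n] t by simp
    ultimately show "mass t \<le> 2 ^ Suc n" by simp
  qed
qed

text \<open>Both kernels contain the factor \<open>h (\<sigma> - \<epsilon>)\<close>. Taking it out
  reduces an increment at time \<open>\<sigma>\<close> to one at the earlier time
  \<open>\<epsilon>\<close>.\<close>

lemma kernel_L1_diff:
  assumes "0 < \<epsilon>" "\<epsilon> < \<sigma>" "0 \<le> d"
  shows "L1_norm (\<lambda>x. h (\<sigma> + d) x - h \<sigma> x) \<le> mass (\<sigma> - \<epsilon>) * L1_norm (\<lambda>x. h (\<epsilon> + d) x - h \<epsilon> x)"
proof -
  let ?D = "\<lambda>x. h (\<epsilon> + d) x - h \<epsilon> x"
  have i: "integrable lborel (h (\<sigma> - \<epsilon>))" "integrable lborel (h (\<epsilon> + d))" "integrable lborel (h \<epsilon>)"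
    using assms by (auto intro!: kernel_integrable)
  have [measurable]: "h (\<sigma> + d) \<in> borel_measurable borel" "h \<sigma> \<in> borel_measurable borel"
    using assms by auto
  have a: "AE x in lborel. h (\<sigma> + d) x = hconv (h (\<sigma> - \<epsilon>)) (h (\<epsilon> + d)) x"
      "AE x in lborel. h \<sigma> x = hconv (h (\<sigma> - \<epsilon>)) (h \<epsilon>) x"
    using kernel_add[of "\<sigma> - \<epsilon>" "\<epsilon> + d"] kernel_add[of "\<sigma> - \<epsilon>" "\<epsilon>"] assms by (simp_all add: algebra_simps)
  have "L1_norm (\<lambda>x. h (\<sigma> + d) x - h \<sigma> x) = L1_norm (hconv (h (\<sigma> - \<epsilon>)) ?D)"
    unfolding L1_norm_def
  proof (rule integral_cong_AE)
    show "AE x in lborel. \<bar>h (\<sigma> + d) x - h \<sigma> x\<bar> = \<bar>hconv (h (\<sigma> - \<epsilon>)) ?D x\<bar>"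
      using a hconv_L1_AE[OF i(1,2)] hconv_L1_AE[OF i(1,3)]
      by eventually_elim (simp add: hconv_def right_diff_distrib)
  qed (use i in measurable)
  also have "\<dots> \<le> L1_norm (h (\<sigma> - \<epsilon>)) * L1_norm ?D"
    using i by (intro hconv_L1_norm) auto
  finally show ?thesis using assms by (simp add: L1_norm_kernel)
qed

text \<open>The increment at \<open>\<epsilon>\<close> is
  \<open>hconv (h d) (h \<epsilon>) - h \<epsilon>\<close>, so strong continuity applied to the
  integrable function \<open>h \<epsilon>\<close> makes it small. \<open>kernel_L1_diff\<close>
  passes this on to all later times, with the same \<open>\<delta>\<close>; dividing
  \<open>r\<close> by \<open>C\<close> pays for the mass of the factor taken out.\<close>

lemma kernel_L1_modulus:
  assumes "0 < \<epsilon>" "0 < r"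
  obtains \<delta> where "0 < \<delta>"
    "\<And>\<sigma> d. \<epsilon> \<le> \<sigma> \<Longrightarrow> \<sigma> \<le> T \<Longrightarrow> 0 \<le> d \<Longrightarrow> d \<le> \<delta> \<Longrightarrow> L1_norm (\<lambda>x. h (\<sigma> + d) x - h \<sigma> x) \<le> r"
proof -
  obtain C where C: "1 \<le> C" "\<And>t. 0 < t \<Longrightarrow> t \<le> T \<Longrightarrow> mass t \<le> C"
    using mass_bounded by blast
  have "\<forall>\<^sub>F t in at_right 0. L1_norm (\<lambda>\<xi>. hconv (h t) (h \<epsilon>) \<xi> - h \<epsilon> \<xi>) < r / C"
    using assms C by (intro order_tendstoD[OF hconv_at_zero_L1] kernel_integrable) auto
  then obtain b where b: "b > 0" "\<And>d. 0 < d \<Longrightarrow> d < b \<Longrightarrow> L1_norm (\<lambda>\<xi>. hconv (h d) (h \<epsilon>) \<xi> - h \<epsilon> \<xi>) < r / C"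
    unfolding eventually_at_right_field by auto
  have e: "L1_norm (\<lambda>x. h (\<epsilon> + d) x - h \<epsilon> x) \<le> r / C" if "0 \<le> d" "d \<le> b / 2" for d
  proof (cases "d = 0")
    case True
    then show ?thesis using assms C by (simp add: L1_norm_def)
  next
    case False
    then have d: "0 < d" "d < b" using that b by auto
    have [measurable]: "h (d + \<epsilon>) \<in> borel_measurable borel" "h d \<in> borel_measurable borel" "h \<epsilon> \<in> borel_measurable borel"
      using assms d by auto
    have "L1_norm (\<lambda>x. h (\<epsilon> + d) x - h \<epsilon> x) = L1_norm (\<lambda>\<xi>. hconv (h d) (h \<epsilon>) \<xi> - h \<epsilon> \<xi>)"
      unfolding L1_norm_def add.commute[of \<epsilon> d]
      using kernel_add[OF d(1) assms(1)] by (intro integral_cong_AE) (auto elim!: eventually_mono)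
    then show ?thesis using b(2)[OF d] by simp
  qed
  show ?thesis
  proof
    show "0 < b / 2" using b by simp
    fix \<sigma> d assume *: "\<epsilon> \<le> \<sigma>" "\<sigma> \<le> T" "0 \<le> d" "d \<le> b / 2"
    show "L1_norm (\<lambda>x. h (\<sigma> + d) x - h \<sigma> x) \<le> r"
    proof (cases "\<sigma> = \<epsilon>")
      case True
      have "r / C \<le> r" using assms C by (simp add: divide_le_eq)
      then show ?thesis using True e[OF *(3,4)] by simp
    next
      case False
      have "L1_norm (\<lambda>x. h (\<sigma> + d) x - h \<sigma> x) \<le> mass (\<sigma> - \<epsilon>) * L1_norm (\<lambda>x. h (\<epsilon> + d) x - h \<epsilon> x)"
        using False * assms by (intro kernel_L1_diff) auto
      also have "\<dots> \<le> C * (r / C)"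
        using False * assms C e[OF *(3,4)] by (intro mult_mono C(2)) auto
      finally show ?thesis using C by simp
    qed
  qed
qed

section \<open>Bounded data: behaviour as time tends to 0\<close>

lemma hconv_kernel_bound:
  assumes "0 < t" "g \<in> borel_measurable borel" "AE x in lborel. \<bar>g x\<bar> \<le> M"
  shows "\<bar>hconv (h t) g \<xi>\<bar> \<le> mass t * M"
  using hconv_bound[OF kernel_integrable[OF assms(1)] assms(2,3)] assms(1) by (simp add: L1_norm_kernel)

text \<open>A bounded \<open>g\<close> need not be integrable, so it is cut at \<open>B\<close>. The
  inner part falls under strong continuity on \<open>L^1\<close>. By positivity of the kernel, the
  influence of the outer part inside \<open>B\<close> is at most
  \<open>M * (mass t - hconv (h t) (indicator B))\<close>, which tends to 0 in \<open>L^1\<close> of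
  \<open>B\<close> because \<open>B\<close> has finite measure.\<close>

lemma L1_loc_at_zero:
  assumes [measurable]: "g \<in> borel_measurable borel" and g: "AE x in lborel. \<bar>g x\<bar> \<le> M"
    and [measurable]: "B \<in> sets borel" and B: "bounded B"
  shows "((\<lambda>t. L1_norm (\<lambda>x. indicator B x * (hconv (h t) g x - g x))) \<longlongrightarrow> 0) (at_right 0)"
proof -
  let ?i = "indicator B :: _ \<Rightarrow> real" and ?c = "\<lambda>x. indicator (- B) x * g x"
  have fin: "emeasure lborel B < \<infinity>" using B by (rule emeasure_bounded_finite)
  have i1: "integrable lborel ?i" using B by (intro integrable_indicator_bounded) auto
  have M: "0 \<le> M" using g by (rule ess_bound_nonneg)
  have i2: "integrable lborel (\<lambda>x. ?i x * g x)"
  proof (rule Bochner_Integration.integrable_bound)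
    show "integrable lborel (\<lambda>x. M * ?i x)" using i1 by (rule integrable_mult_right)
  qed (use g in \<open>auto elim!: eventually_mono simp: indicator_def\<close>)
  have b1: "AE x in lborel. \<bar>?i x\<bar> \<le> 1" by (auto simp: indicator_def)
  have b2: "AE x in lborel. \<bar>?i x * g x\<bar> \<le> M" using g by eventually_elim (use M in \<open>auto simp: indicator_def\<close>)
  have b3: "AE x in lborel. \<bar>?c x\<bar> \<le> M" using g by eventually_elim (use M in \<open>auto simp: indicator_def\<close>)
  let ?R = "\<lambda>t. L1_norm (\<lambda>x. hconv (h t) (\<lambda>x. ?i x * g x) x - ?i x * g x)
      + M * (L1_norm (\<lambda>x. hconv (h t) ?i x - ?i x) + \<bar>mass t - 1\<bar> * measure lborel B)"
  have R: "(?R \<longlongrightarrow> 0 + M * (0 + \<bar>1 - 1\<bar> * measure lborel B)) (at_right 0)"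
    by (intro tendsto_intros hconv_at_zero_L1 i1 i2 mass_at_zero)
  have le: "L1_norm (\<lambda>x. ?i x * (hconv (h t) g x - g x)) \<le> ?R t" if t: "0 < t" for t
  proof -
    note [measurable] = kernel_measurable[OF t]
    note k = kernel_integrable[OF t]
    have pw: "\<bar>?i x * (hconv (h t) g x - g x)\<bar> \<le> \<bar>hconv (h t) (\<lambda>x. ?i x * g x) x - ?i x * g x\<bar>
       + M * (\<bar>hconv (h t) ?i x - ?i x\<bar> + \<bar>mass t - 1\<bar> * ?i x)" for x
    proof (cases "x \<in> B")
      case True
      have "hconv (h t) g x = hconv (h t) (\<lambda>x. ?i x * g x) x + hconv (h t) ?c x"
        by (subst hconv_add_right[OF k _ b2 _ b3, symmetric]) (auto simp: hconv_def indicator_def intro!: Bochner_Integration.integral_cong)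
      \<comment> \<open>Here \<open>?c\<close> lies between plus and minus
        \<open>M * (1 - ?i)\<close>, and the convolution of the constant 1 is \<open>mass t\<close>
        at every point.\<close>
      moreover have "\<bar>hconv (h t) ?c x\<bar> \<le> M * (mass t - hconv (h t) ?i x)"
      proof -
        have u: "AE x in lborel. \<bar>M * (1 - ?i x)\<bar> \<le> M * 1" using M by (auto simp: indicator_def)
        have "hconv (h t) ?c x \<le> hconv (h t) (\<lambda>x. M * (1 - ?i x)) x"
          by (rule hconv_mono[OF k kernel_nonneg[OF t] _ b3 _ u])
             (use g M in \<open>auto elim!: eventually_mono simp: indicator_def\<close>)
        moreover have "hconv (h t) (\<lambda>x. (- 1) * ?c x) x \<le> hconv (h t) (\<lambda>x. M * (1 - ?i x)) x"
          by (rule hconv_mono[OF k kernel_nonneg[OF t] _ _ _ u, where M = M])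
             (use b3 g M in \<open>auto elim!: eventually_mono simp: indicator_def\<close>)
        moreover have "hconv (h t) (\<lambda>x. M * (1 - ?i x)) x = M * (mass t - hconv (h t) ?i x)"
        proof -
          have "hconv (h t) (\<lambda>x. 1 - ?i x) x = hconv (h t) (\<lambda>_. 1) x - hconv (h t) ?i x"
            by (rule hconv_diff_right[OF k _ _ _ b1, where M = 1]) auto
          moreover have "hconv (h t) (\<lambda>_. 1) x = mass t"
            unfolding hconv_def mass_def using haar_preserving_integral[OF haar_preserving_hmul(3), of "h t" x] by simp
          ultimately show ?thesis by (simp only: hconv_cmult_right)
        qed
        ultimately show ?thesis by (simp only: hconv_cmult_right)
      qed
      moreover have "mass t - hconv (h t) ?i x \<le> \<bar>hconv (h t) ?i x - 1\<bar> + \<bar>mass t - 1\<bar>" by linarith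
      then have "M * (mass t - hconv (h t) ?i x) \<le> M * (\<bar>hconv (h t) ?i x - 1\<bar> + \<bar>mass t - 1\<bar>)"
        using M by (rule mult_left_mono)
      ultimately show ?thesis using True by simp
    qed (use M in auto)
    have *: "integrable lborel (\<lambda>x. hconv (h t) (\<lambda>x. ?i x * g x) x - ?i x * g x)"
       "integrable lborel (\<lambda>x. hconv (h t) ?i x - ?i x)"
      using k i1 i2 by (auto intro!: hconv_L1_integrable)
    have "L1_norm (\<lambda>x. ?i x * (hconv (h t) g x - g x)) \<le> (LINT x|lborel. \<bar>hconv (h t) (\<lambda>x. ?i x * g x) x - ?i x * g x\<bar>
       + M * (\<bar>hconv (h t) ?i x - ?i x\<bar> + \<bar>mass t - 1\<bar> * ?i x))"
      unfolding L1_norm_def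
    proof (rule integral_mono[OF _ _ pw])
      show i: "integrable lborel (\<lambda>x. \<bar>hconv (h t) (\<lambda>x. ?i x * g x) x - ?i x * g x\<bar>
       + M * (\<bar>hconv (h t) ?i x - ?i x\<bar> + \<bar>mass t - 1\<bar> * ?i x))"
        using * i1 by auto
      show "integrable lborel (\<lambda>x. \<bar>?i x * (hconv (h t) g x - g x)\<bar>)"
      proof (rule Bochner_Integration.integrable_bound[OF i])
        show "AE x in lborel. norm \<bar>?i x * (hconv (h t) g x - g x)\<bar> \<le> norm (\<bar>hconv (h t) (\<lambda>x. ?i x * g x) x - ?i x * g x\<bar>
          + M * (\<bar>hconv (h t) ?i x - ?i x\<bar> + \<bar>mass t - 1\<bar> * ?i x))"
        proof (rule AE_I2)
          fix x show "norm \<bar>?i x * (hconv (h t) g x - g x)\<bar> \<le> norm (\<bar>hconv (h t) (\<lambda>x. ?i x * g x) x - ?i x * g x\<bar>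
            + M * (\<bar>hconv (h t) ?i x - ?i x\<bar> + \<bar>mass t - 1\<bar> * ?i x))"
            using pw[of x] by simp
        qed
      qed measurable
    qed
    also have "\<dots> = ?R t"
      unfolding L1_norm_def using * i1 fin by simp
    finally show ?thesis .
  qed
  have "(?R \<longlongrightarrow> 0) (at_right 0)" using R by simp
  then show ?thesis
    by (rule Lim_null_comparison[rotated]) (use le in \<open>auto simp: eventually_at_right_field intro!: exI[of _ 1]\<close>)
qed

text \<open>On \<open>B n\<close> the test function is bounded by \<open>n\<close> and the set is
  bounded, so local \<open>L^1\<close> convergence applies. Off \<open>B n\<close> the functions are
  uniformly bounded and the rest of \<open>\<phi>\<close> is small in \<open>L^1\<close>. First
  \<open>n\<close> is fixed, then \<open>t\<close> tends to 0.\<close>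

lemma weak_star_at_zero:
  assumes [measurable]: "g \<in> borel_measurable borel" and g: "AE x in lborel. \<bar>g x\<bar> \<le> M"
    and \<phi>: "integrable lborel \<phi>"
  shows "((\<lambda>t. LINT x|lborel. hconv (h t) g x * \<phi> x) \<longlongrightarrow> (LINT x|lborel. g x * \<phi> x)) (at_right 0)"
proof -
  have [measurable]: "\<phi> \<in> borel_measurable borel" using \<phi> by auto
  have M: "0 \<le> M" using g by (rule ess_bound_nonneg)
  obtain C where C: "1 \<le> C" "\<And>t. 0 < t \<Longrightarrow> t \<le> 1 \<Longrightarrow> mass t \<le> C"
    using mass_bounded by blast
  define B where "B n = {x \<in> ball 0 (real n). \<bar>\<phi> x\<bar> \<le> real n}" for n
  have [measurable]: "B n \<in> sets borel" for n unfolding B_def by measurable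
  have bB: "bounded (B n)" for n unfolding B_def by (rule bounded_subset[OF bounded_ball[of 0 "real n"]]) auto
  have lim: "(\<lambda>n. L1_norm (\<lambda>x. (1 - indicator (B n) x) * \<phi> x)) \<longlonglongrightarrow> L1_norm (\<lambda>_::'n heis. 0)"
    unfolding L1_norm_def
  proof (rule integral_dominated_convergence)
    show "integrable lborel (\<lambda>x. \<bar>\<phi> x\<bar>)" using \<phi> by auto
    show "AE x in lborel. (\<lambda>n. \<bar>(1 - indicator (B n) x) * \<phi> x\<bar>) \<longlonglongrightarrow> \<bar>0\<bar>"
    proof (rule AE_I2)
      fix x
      obtain N :: nat where "max (norm x) \<bar>\<phi> x\<bar> < N" using reals_Archimedean2 by blast
      then have "\<forall>\<^sub>F n in sequentially. \<bar>(1 - indicator (B n) x) * \<phi> x\<bar> = \<bar>0\<bar>"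
        unfolding eventually_sequentially by (intro exI[of _ N]) (auto simp: B_def indicator_def)
      then show "(\<lambda>n. \<bar>(1 - indicator (B n) x) * \<phi> x\<bar>) \<longlonglongrightarrow> \<bar>0\<bar>" by (rule tendsto_eventually)
    qed
  qed (auto simp: indicator_def)
  have split: "\<bar>(LINT x|lborel. hconv (h t) g x * \<phi> x) - (LINT x|lborel. g x * \<phi> x)\<bar>
      \<le> real n * L1_norm (\<lambda>x. indicator (B n) x * (hconv (h t) g x - g x))
        + (C + 1) * M * L1_norm (\<lambda>x. (1 - indicator (B n) x) * \<phi> x)" if t: "0 < t" "t \<le> 1" for t n
  proof -
    note [measurable] = kernel_measurable[OF t(1)]
    have hb: "\<bar>hconv (h t) g x\<bar> \<le> C * M" for x
      using hconv_kernel_bound[OF t(1) _ g, of x] mult_right_mono[OF C(2)[OF t] M] by simp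
    have i: "integrable lborel (\<lambda>x. hconv (h t) g x * \<phi> x)" "integrable lborel (\<lambda>x. g x * \<phi> x)"
    proof -
      show "integrable lborel (\<lambda>x. hconv (h t) g x * \<phi> x)"
      proof (rule Bochner_Integration.integrable_bound)
        show "integrable lborel (\<lambda>x. C * M * \<phi> x)" using \<phi> by (rule integrable_mult_right)
        show "AE x in lborel. norm (hconv (h t) g x * \<phi> x) \<le> norm (C * M * \<phi> x)"
        proof (rule AE_I2)
          fix x show "norm (hconv (h t) g x * \<phi> x) \<le> norm (C * M * \<phi> x)"
            using mult_right_mono[OF hb[of x], of "\<bar>\<phi> x\<bar>"] C M by (simp add: abs_mult)
        qed
      qed measurable
      show "integrable lborel (\<lambda>x. g x * \<phi> x)"
      proof (rule Bochner_Integration.integrable_bound)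
        show "integrable lborel (\<lambda>x. M * \<phi> x)" using \<phi> by (rule integrable_mult_right)
      qed (use g M in \<open>auto simp: abs_mult elim!: eventually_mono intro!: mult_right_mono\<close>)
    qed
    have hg: "AE x in lborel. \<bar>hconv (h t) g x - g x\<bar> \<le> (C + 1) * M"
      using g
    proof eventually_elim
      case (elim x) then show ?case using hb[of x] by (simp add: distrib_right)
    qed
    have ii: "integrable lborel (\<lambda>x. \<bar>indicator (B n) x * (hconv (h t) g x - g x)\<bar>)"
    proof (rule Bochner_Integration.integrable_bound[where f = "\<lambda>x. (C + 1) * M * indicator (B n) x"])
      show "integrable lborel (\<lambda>x. (C + 1) * M * indicator (B n) x)"
        by (intro integrable_mult_right integrable_indicator_bounded bB) simp
    qed (use hg in \<open>auto elim!: eventually_mono simp: indicator_def\<close>)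
    have iii: "integrable lborel (\<lambda>x. \<bar>(1 - indicator (B n) x) * \<phi> x\<bar>)"
      by (rule Bochner_Integration.integrable_bound[OF \<phi>]) (auto simp: indicator_def)
    have "\<bar>(LINT x|lborel. hconv (h t) g x * \<phi> x) - (LINT x|lborel. g x * \<phi> x)\<bar> \<le> L1_norm (\<lambda>x. hconv (h t) g x * \<phi> x - g x * \<phi> x)"
      by (rule integral_diff_le_L1_norm[OF i])
    also have "\<dots> \<le> (LINT x|lborel. real n * \<bar>indicator (B n) x * (hconv (h t) g x - g x)\<bar>
        + (C + 1) * M * \<bar>(1 - indicator (B n) x) * \<phi> x\<bar>)"
      unfolding L1_norm_def
    proof (rule integral_mono_AE)
      show "AE x in lborel. \<bar>hconv (h t) g x * \<phi> x - g x * \<phi> x\<bar> \<le> real n * \<bar>indicator (B n) x * (hconv (h t) g x - g x)\<bar>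
        + (C + 1) * M * \<bar>(1 - indicator (B n) x) * \<phi> x\<bar>"
        using hg
      proof eventually_elim
        case (elim x)
        have e: "\<bar>hconv (h t) g x * \<phi> x - g x * \<phi> x\<bar> = \<bar>hconv (h t) g x - g x\<bar> * \<bar>\<phi> x\<bar>"
          by (simp add: abs_mult[symmetric] left_diff_distrib)
        show ?case
        proof (cases "x \<in> B n")
          case True
          then show ?thesis using mult_left_mono[of "\<bar>\<phi> x\<bar>" n "\<bar>hconv (h t) g x - g x\<bar>"]
            unfolding e by (simp add: B_def mult.commute)
        next
          case False
          then show ?thesis using mult_right_mono[OF elim, of "\<bar>\<phi> x\<bar>"] unfolding e by simp
        qed
      qed
      show "integrable lborel (\<lambda>x. \<bar>hconv (h t) g x * \<phi> x - g x * \<phi> x\<bar>)" using i by auto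
      show "integrable lborel (\<lambda>x. real n * \<bar>indicator (B n) x * (hconv (h t) g x - g x)\<bar>
        + (C + 1) * M * \<bar>(1 - indicator (B n) x) * \<phi> x\<bar>)"
        using ii iii by (intro Bochner_Integration.integrable_add integrable_mult_right) auto
    qed
    also have "\<dots> = real n * L1_norm (\<lambda>x. indicator (B n) x * (hconv (h t) g x - g x))
        + (C + 1) * M * L1_norm (\<lambda>x. (1 - indicator (B n) x) * \<phi> x)"
      unfolding L1_norm_def using ii iii by (subst Bochner_Integration.integral_add) auto
    finally show ?thesis .
  qed
  show ?thesis
  proof (rule tendstoI)
    fix e :: real assume "e > 0"
    \<comment> \<open>Adding 1 keeps the denominator positive when \<open>M = 0\<close>. The same
      device recurs in later choices of small constants.\<close>
    have CM: "0 < (C + 1) * M + 1" using C M by (simp add: add_nonneg_pos)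
    have "\<forall>\<^sub>F n in sequentially. L1_norm (\<lambda>x. (1 - indicator (B n) x) * \<phi> x) < e / 2 / ((C + 1) * M + 1)"
      using lim \<open>e > 0\<close> CM by (intro order_tendstoD) (auto simp: L1_norm_def)
    then obtain n where n: "L1_norm (\<lambda>x. (1 - indicator (B n) x) * \<phi> x) < e / 2 / ((C + 1) * M + 1)"
      using eventually_happens'[of sequentially] by auto
    have n2: "(C + 1) * M * L1_norm (\<lambda>x. (1 - indicator (B n) x) * \<phi> x) \<le> e / 2"
    proof -
      have "(C + 1) * M * L1_norm (\<lambda>x. (1 - indicator (B n) x) * \<phi> x) \<le> ((C + 1) * M + 1) * (e / 2 / ((C + 1) * M + 1))"
        using n C M by (intro mult_mono) auto
      also have "\<dots> = e / 2" using less_imp_neq[OF CM] by (metis nonzero_mult_div_cancel_left times_divide_eq_right)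
      finally show ?thesis .
    qed
    have "((\<lambda>t. real n * L1_norm (\<lambda>x. indicator (B n) x * (hconv (h t) g x - g x))) \<longlongrightarrow> real n * 0) (at_right 0)"
      by (intro tendsto_intros L1_loc_at_zero[OF _ g] bB) auto
    then have "\<forall>\<^sub>F t in at_right 0. real n * L1_norm (\<lambda>x. indicator (B n) x * (hconv (h t) g x - g x)) < e / 2"
      using \<open>e > 0\<close> by (intro order_tendstoD) auto
    moreover have "\<forall>\<^sub>F t in at_right 0. 0 < t \<and> t \<le> (1::real)"
      unfolding eventually_at_right_field by (intro exI[of _ 1]) auto
    ultimately show "\<forall>\<^sub>F t in at_right 0. dist (LINT x|lborel. hconv (h t) g x * \<phi> x) (LINT x|lborel. g x * \<phi> x) < e"
    proof eventually_elim
      case (elim t)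
      show ?case using split[of t n] elim n2 by (simp add: dist_real_def)
    qed
  qed
qed

end

section \<open>Lebesgue norms and Minkowski's inequality\<close>

text \<open>The graph of the convex function \<open>x powr r\<close> lies above its tangent at
  \<open>a\<close>. Young's inequality with exponents summing to 1 gives this without
  derivatives.\<close>

lemma powr_tangent_le:
  fixes a x r :: real
  assumes "0 \<le> a" "0 \<le> x" "1 \<le> r"
  shows "r * a powr (r - 1) * x \<le> x powr r + (r - 1) * a powr r"
proof (cases "a = 0 \<or> x = 0")
  case False
  then have p: "a > 0" "x > 0" using assms by auto
  have "(x powr r) powr (1 / r) * (a powr r) powr (1 - 1 / r) \<le> (1 / r) * x powr r + (1 - 1 / r) * a powr r"
    using p assms by (intro Youngs_inequality_0) auto
  moreover have "r * (1 - 1 / r) = r - 1" using assms by (simp add: field_simps)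
  ultimately have *: "x * a powr (r - 1) \<le> (1 / r) * x powr r + (1 - 1 / r) * a powr r"
    using p assms by (simp add: powr_powr)
  have "r * (x * a powr (r - 1)) \<le> r * ((1 / r) * x powr r + (1 - 1 / r) * a powr r)"
    using * assms by (intro mult_left_mono) auto
  also have "\<dots> = x powr r + (r - 1) * a powr r"
    using assms by (simp add: field_simps)
  finally show ?thesis by (simp add: mult_ac)
qed (use assms in auto)

text \<open>Jensen's inequality for a weight \<open>\<psi>\<close> of arbitrary total mass, whence
  the factor with exponent \<open>r - 1\<close>: integrate the tangent inequality against
  \<open>\<psi>\<close>. With the right-hand side in \<open>ennreal\<close>, an infinite moment
  makes the claim trivial.\<close>

lemma weighted_jensen_powr:
  fixes W \<psi> :: "'a \<Rightarrow> real"
  assumes r: "1 \<le> r" and [measurable]: "W \<in> borel_measurable M" and \<psi>: "integrable M \<psi>"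
    and W\<psi>: "integrable M (\<lambda>y. W y * \<psi> y)"
    and nn: "\<And>y. 0 \<le> W y" "\<And>y. 0 \<le> \<psi> y"
  shows "ennreal ((\<integral>y. W y * \<psi> y \<partial>M) powr r)
    \<le> ennreal ((\<integral>y. \<psi> y \<partial>M) powr (r - 1)) * (\<integral>\<^sup>+y. ennreal (W y powr r * \<psi> y) \<partial>M)"
proof -
  have [measurable]: "\<psi> \<in> borel_measurable M" using \<psi> by auto
  define I where "I = (\<integral>y. W y * \<psi> y \<partial>M)"
  define P where "P = (\<integral>y. \<psi> y \<partial>M)"
  define J where "J = (\<integral>\<^sup>+y. ennreal (W y powr r * \<psi> y) \<partial>M)"
  have I0: "0 \<le> I" and P0: "0 \<le> P" unfolding I_def P_def using nn by auto
  have Pn: "P \<noteq> 0" if "I \<noteq> 0"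
  proof
    assume "P = 0"
    then have "AE y in M. \<psi> y = 0"
      unfolding P_def using integral_nonneg_eq_0_iff_AE[OF \<psi>] nn by auto
    then have "I = (\<integral>y. 0 \<partial>M)" unfolding I_def by (intro integral_cong_AE) auto
    with that show False by simp
  qed
  show ?thesis
    unfolding I_def[symmetric] P_def[symmetric] J_def[symmetric]
  proof (cases "I = 0 \<or> J = \<infinity>")
    case True
    then show "ennreal (I powr r) \<le> ennreal (P powr (r - 1)) * J"
      using r P0 Pn by (cases "I = 0") (auto simp: ennreal_mult_top)
  next
    case False
    then have Ip: "0 < I" and J: "J \<noteq> \<infinity>" using I0 by auto
    then have Pp: "0 < P" using P0 Pn by simp
    have iJ: "integrable M (\<lambda>y. W y powr r * \<psi> y)"
      using J nn unfolding J_def by (intro integrableI_nonneg) (auto simp: top.not_eq_extremum)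
    define j where "j = (\<integral>y. W y powr r * \<psi> y \<partial>M)"
    have Jj: "J = ennreal j" unfolding J_def j_def using nn by (intro nn_integral_eq_integral iJ) auto
    \<comment> \<open>The weighted mean of \<open>W\<close>; the tangent taken there gives the sharp
      inequality.\<close>
    define a where "a = I / P"
    have a: "0 < a" unfolding a_def using Ip Pp by simp
    have "(\<integral>y. r * a powr (r - 1) * (W y * \<psi> y) \<partial>M) \<le> (\<integral>y. W y powr r * \<psi> y + (r - 1) * a powr r * \<psi> y \<partial>M)"
    proof (rule integral_mono)
      fix y
      show "r * a powr (r - 1) * (W y * \<psi> y) \<le> W y powr r * \<psi> y + (r - 1) * a powr r * \<psi> y"
        using mult_right_mono[OF powr_tangent_le[of a "W y" r] nn(2)[of y]] a nn r by (simp add: algebra_simps)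
    qed (use W\<psi> iJ \<psi> in auto)
    then have "r * a powr (r - 1) * I \<le> j + (r - 1) * a powr r * P"
      using W\<psi> iJ \<psi> by (simp add: I_def P_def j_def)
    moreover have "a powr r * P = a powr (r - 1) * I"
      using Ip Pp by (simp add: a_def powr_diff)
    then have "(r - 1) * a powr r * P = (r - 1) * (a powr (r - 1) * I)"
      by (simp only: mult.assoc)
    ultimately have *: "a powr (r - 1) * I \<le> j"
      by (simp add: algebra_simps)
    have "I powr r = P powr (r - 1) * (a powr (r - 1) * I)"
      using Ip Pp by (simp add: a_def powr_divide powr_diff)
    also have "\<dots> \<le> P powr (r - 1) * j"
      using * by (intro mult_left_mono) auto
    finally have "ennreal (I powr r) \<le> ennreal (P powr (r - 1) * j)" by (rule ennreal_leI)
    then show "ennreal (I powr r) \<le> ennreal (P powr (r - 1)) * J"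
      unfolding Jj
      by (simp add: ennreal_mult')
  qed
qed

text \<open>Minkowski's integral inequality when all slices share the bound \<open>A\<close>: Jensen
  inside, then Tonelli. A common bound is no restriction in use, since slices of varying size are
  normalised and their size is moved into \<open>\<psi>\<close>.\<close>

lemma minkowski_weighted:
  fixes W :: "'b \<Rightarrow> 'a::euclidean_space \<Rightarrow> real" and \<psi> :: "'b \<Rightarrow> real"
  assumes M: "sigma_finite_measure M"
    and r: "1 \<le> r" and W[measurable]: "case_prod W \<in> borel_measurable (M \<Otimes>\<^sub>M lborel)" and \<psi>: "integrable M \<psi>"
    and W\<psi>: "\<And>x. integrable M (\<lambda>y. W y x * \<psi> y)"
    and nn: "\<And>y x. 0 \<le> W y x" "\<And>y. 0 \<le> \<psi> y"
    and le: "\<And>y. y \<in> space M \<Longrightarrow> (\<integral>\<^sup>+x. ennreal (W y x powr r) \<partial>lborel) \<le> ennreal (A powr r)" and A: "0 \<le> A"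
  shows "(\<integral>\<^sup>+x. ennreal ((\<integral>y. W y x * \<psi> y \<partial>M) powr r) \<partial>lborel) \<le> ennreal ((A * (\<integral>y. \<psi> y \<partial>M)) powr r)"
proof -
  have [measurable]: "\<psi> \<in> borel_measurable M" using \<psi> by auto
  interpret pair_sigma_finite M lborel
    using M by (simp add: pair_sigma_finite_def lborel.sigma_finite_measure_axioms)
  let ?P = "\<integral>y. \<psi> y \<partial>M"
  have P0: "0 \<le> ?P" using nn by auto
  have "(\<integral>\<^sup>+x. ennreal ((\<integral>y. W y x * \<psi> y \<partial>M) powr r) \<partial>lborel)
      \<le> (\<integral>\<^sup>+x. ennreal (?P powr (r - 1)) * (\<integral>\<^sup>+y. ennreal (W y x powr r * \<psi> y) \<partial>M) \<partial>lborel)"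
    using nn by (intro nn_integral_mono weighted_jensen_powr r \<psi> W\<psi>) auto
  also have "\<dots> = ennreal (?P powr (r - 1)) * (\<integral>\<^sup>+x. \<integral>\<^sup>+y. ennreal (W y x powr r * \<psi> y) \<partial>M \<partial>lborel)"
    by (intro nn_integral_cmult) measurable
  also have "(\<integral>\<^sup>+x. \<integral>\<^sup>+y. ennreal (W y x powr r * \<psi> y) \<partial>M \<partial>lborel) = (\<integral>\<^sup>+y. \<integral>\<^sup>+x. ennreal (W y x powr r * \<psi> y) \<partial>lborel \<partial>M)"
    using Fubini'[of "\<lambda>y x. ennreal (W y x powr r * \<psi> y)"] by simp
  also have "\<dots> = (\<integral>\<^sup>+y. ennreal (\<psi> y) * (\<integral>\<^sup>+x. ennreal (W y x powr r) \<partial>lborel) \<partial>M)"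
    using nn by (intro nn_integral_cong) (simp add: mult.commute ennreal_mult' nn_integral_cmult[symmetric])
  also have "\<dots> \<le> (\<integral>\<^sup>+y. ennreal (\<psi> y) * ennreal (A powr r) \<partial>M)"
    by (intro nn_integral_mono mult_left_mono le) auto
  also have "\<dots> = ennreal ?P * ennreal (A powr r)"
    using nn by (simp add: nn_integral_multc nn_integral_eq_integral[OF \<psi>])
  also have "ennreal (?P powr (r - 1)) * (ennreal ?P * ennreal (A powr r)) = ennreal ((A * ?P) powr r)"
  proof (cases "?P = 0")
    case False
    then show ?thesis using P0 A
      by (simp add: ennreal_mult'[symmetric] powr_mult powr_diff)
  qed (use r in simp)
  finally show ?thesis by (simp add: mult_left_mono)
qed

text \<open>A relation with a real bound avoids arithmetic with infinite norms, and comparing powers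
  avoids taking roots. \<open>Lq_bound_iff\<close> links it to \<open>Lq_norm\<close>.\<close>

definition Lq_bound :: "ennreal \<Rightarrow> ('a::euclidean_space \<Rightarrow> real) \<Rightarrow> real \<Rightarrow> bool" where
  "Lq_bound q g A \<longleftrightarrow> 0 \<le> A \<and> g \<in> borel_measurable borel \<and>
    (if q = \<infinity> then AE x in lborel. \<bar>g x\<bar> \<le> A
     else (\<integral>\<^sup>+x. ennreal (\<bar>g x\<bar> powr enn2real q) \<partial>lborel) \<le> ennreal (A powr enn2real q))"

lemma Lq_bound_nonneg: "Lq_bound q g A \<Longrightarrow> 0 \<le> A"
  and Lq_bound_measurable: "Lq_bound q g A \<Longrightarrow> g \<in> borel_measurable borel"
  by (auto simp: Lq_bound_def)

lemma Lq_bound_infinity: "g \<in> borel_measurable borel \<Longrightarrow> Lq_bound \<infinity> g A \<longleftrightarrow> (AE x in lborel. \<bar>g x\<bar> \<le> A)"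
  by (auto simp: Lq_bound_def intro: ess_bound_nonneg)

lemma enn2real_exponent: "1 \<le> q \<Longrightarrow> q \<noteq> \<infinity> \<Longrightarrow> 1 \<le> enn2real q"
  using enn2real_mono[of 1 q] by (simp add: less_top)

lemma Lq_bound_iff:
  assumes [measurable]: "g \<in> borel_measurable borel" and A: "0 \<le> A" and q: "1 \<le> q"
  shows "Lq_bound q g A \<longleftrightarrow> Lq_norm q g \<le> ennreal A"
proof (cases "q = \<infinity>")
  case True
  have "(AE x in lborel. ennreal \<bar>g x\<bar> \<le> ennreal A) \<longleftrightarrow> esssup lborel (\<lambda>x. ennreal \<bar>g x\<bar>) \<le> ennreal A"
  proof
    assume "esssup lborel (\<lambda>x. ennreal \<bar>g x\<bar>) \<le> ennreal A"
    with esssup_AE[of "\<lambda>x. ennreal \<bar>g x\<bar>" lborel] show "AE x in lborel. ennreal \<bar>g x\<bar> \<le> ennreal A"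
      by (auto elim!: eventually_mono intro: order_trans)
  qed (auto intro!: esssup_I)
  then show ?thesis using True A by (simp add: Lq_bound_def Lq_norm_def)
next
  case False
  let ?r = "enn2real q" and ?I = "\<integral>\<^sup>+x. ennreal (\<bar>g x\<bar> powr enn2real q) \<partial>lborel"
  have r: "1 \<le> ?r" using q False by (rule enn2real_exponent)
  show ?thesis
  proof (cases "?I = \<infinity>")
    case True
    then show ?thesis using False by (simp add: Lq_bound_def Lq_norm_def top_unique)
  next
    case fin: False
    then obtain i where i: "?I = ennreal i" "0 \<le> i" by (cases ?I) auto
    have "i \<le> A powr ?r \<longleftrightarrow> i powr (1 / ?r) \<le> A"
    proof
      assume "i \<le> A powr ?r"
      then have "i powr (1 / ?r) \<le> (A powr ?r) powr (1 / ?r)" using i r by (intro powr_mono2) auto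
      then show "i powr (1 / ?r) \<le> A" using r A by (simp add: powr_powr)
    next
      assume "i powr (1 / ?r) \<le> A"
      then have "(i powr (1 / ?r)) powr ?r \<le> A powr ?r" using r by (intro powr_mono2) auto
      then show "i \<le> A powr ?r" using r i by (simp add: powr_powr)
    qed
    then show ?thesis using False fin i A by (simp add: Lq_bound_def Lq_norm_def)
  qed
qed

lemma Lq_bound_imp_Lq:
  assumes "1 \<le> q" "Lq_bound q g A" shows "g \<in> Lq q"
proof -
  have "Lq_norm q g \<le> ennreal A" using Lq_bound_iff[of g A q] assms Lq_bound_nonneg Lq_bound_measurable by blast
  also have "\<dots> < \<infinity>" by simp
  finally show ?thesis using Lq_bound_measurable[OF assms(2)] by (simp add: Lq_def)
qed

lemma Lq_imp_Lq_bound: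
  assumes "1 \<le> q" "g \<in> Lq q" obtains A where "Lq_bound q g A"
proof -
  have "Lq_norm q g < \<infinity>" "g \<in> borel_measurable borel" using assms by (auto simp: Lq_def)
  moreover from this obtain A where "Lq_norm q g = ennreal A" "0 \<le> A" by (cases "Lq_norm q g") auto
  ultimately show ?thesis using Lq_bound_iff[of g A q] assms that by auto
qed

lemma Lq_bound_mono:
  assumes "Lq_bound q g A" "A \<le> B" shows "Lq_bound q g B"
proof -
  have "ennreal (A powr enn2real q) \<le> ennreal (B powr enn2real q)"
    using assms Lq_bound_nonneg[OF assms(1)] by (intro ennreal_leI powr_mono2) auto
  then show ?thesis using assms by (auto simp: Lq_bound_def elim: eventually_mono intro: order_trans)
qed

lemma Lq_bound_dominated:
  assumes "Lq_bound q g A" "f \<in> borel_measurable borel" "AE x in lborel. \<bar>f x\<bar> \<le> \<bar>g x\<bar>"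
  shows "Lq_bound q f A"
proof (cases "q = \<infinity>")
  case True
  then show ?thesis using assms by (auto simp: Lq_bound_def elim: eventually_elim2)
next
  case False
  have "(\<integral>\<^sup>+x. ennreal (\<bar>f x\<bar> powr enn2real q) \<partial>lborel) \<le> (\<integral>\<^sup>+x. ennreal (\<bar>g x\<bar> powr enn2real q) \<partial>lborel)"
    using assms(3) by (intro nn_integral_mono_AE) (auto elim!: eventually_mono intro!: ennreal_leI powr_mono2)
  then show ?thesis using assms False by (auto simp: Lq_bound_def intro: order_trans)
qed

lemma Lq_bound_zero: "Lq_bound q (\<lambda>_. 0) 0"
  by (simp add: Lq_bound_def)

lemma Lq_bound_scale:
  assumes "Lq_bound q g A" shows "Lq_bound q (\<lambda>x. c * g x) (\<bar>c\<bar> * A)"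
proof (cases "q = \<infinity>")
  case True
  then show ?thesis using assms by (auto simp: Lq_bound_def abs_mult elim!: eventually_mono intro!: mult_left_mono)
next
  case False
  have [measurable]: "g \<in> borel_measurable borel" using assms by (rule Lq_bound_measurable)
  let ?r = "enn2real q"
  have "(\<integral>\<^sup>+x. ennreal (\<bar>c * g x\<bar> powr ?r) \<partial>lborel) = ennreal (\<bar>c\<bar> powr ?r) * (\<integral>\<^sup>+x. ennreal (\<bar>g x\<bar> powr ?r) \<partial>lborel)"
    by (subst nn_integral_cmult[symmetric]) (auto simp: abs_mult powr_mult ennreal_mult')
  also have "\<dots> \<le> ennreal (\<bar>c\<bar> powr ?r) * ennreal (A powr ?r)"
    using assms False by (intro mult_left_mono) (auto simp: Lq_bound_def)
  also have "\<dots> = ennreal ((\<bar>c\<bar> * A) powr ?r)"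
    using assms by (simp add: powr_mult ennreal_mult' Lq_bound_def)
  finally show ?thesis using assms False by (simp add: Lq_bound_def)
qed

text \<open>The factor 2 replaces the sharp triangle inequality, which is never needed.\<close>

lemma Lq_bound_add:
  assumes q: "1 \<le> q" and f: "Lq_bound q f A" and g: "Lq_bound q g B"
  shows "Lq_bound q (\<lambda>x. f x + g x) (2 * (A + B))"
proof (cases "q = \<infinity>")
  case True
  have "AE x in lborel. \<bar>f x + g x\<bar> \<le> 2 * (A + B)"
    using f g True unfolding Lq_bound_def by (auto elim!: eventually_elim2)
  then show ?thesis using f g True by (auto simp: Lq_bound_def)
next
  case False
  have [measurable]: "f \<in> borel_measurable borel" "g \<in> borel_measurable borel"
    using f g by (auto intro: Lq_bound_measurable)
  have nn: "0 \<le> A" "0 \<le> B" using f g by (auto intro: Lq_bound_nonneg)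
  let ?r = "enn2real q"
  have r: "1 \<le> ?r" using q False by (rule enn2real_exponent)
  have pw: "\<bar>f x + g x\<bar> powr ?r \<le> 2 powr ?r * (\<bar>f x\<bar> powr ?r + \<bar>g x\<bar> powr ?r)" for x
  proof -
    have "\<bar>f x + g x\<bar> powr ?r \<le> (2 * max \<bar>f x\<bar> \<bar>g x\<bar>) powr ?r" by (intro powr_mono2) auto
    also have "\<dots> = 2 powr ?r * max \<bar>f x\<bar> \<bar>g x\<bar> powr ?r" by (simp add: powr_mult)
    also have "\<dots> \<le> 2 powr ?r * (\<bar>f x\<bar> powr ?r + \<bar>g x\<bar> powr ?r)"
      by (intro mult_left_mono) (auto simp: max_def)
    finally show ?thesis .
  qed
  have AB: "A powr ?r + B powr ?r \<le> (A + B) powr ?r"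
  proof -
    have e: "x powr ?r = x * x powr (?r - 1)" if "0 \<le> x" for x
      using that by (cases "x = 0") (auto simp: powr_diff)
    have "A * A powr (?r - 1) + B * B powr (?r - 1) \<le> A * (A + B) powr (?r - 1) + B * (A + B) powr (?r - 1)"
      using nn r by (intro add_mono mult_left_mono powr_mono2) auto
    then show ?thesis using nn by (simp add: e distrib_right)
  qed
  have "(\<integral>\<^sup>+x. ennreal (\<bar>f x + g x\<bar> powr ?r) \<partial>lborel)
      \<le> (\<integral>\<^sup>+x. ennreal (2 powr ?r) * (ennreal (\<bar>f x\<bar> powr ?r) + ennreal (\<bar>g x\<bar> powr ?r)) \<partial>lborel)"
    by (intro nn_integral_mono) (use pw in \<open>simp add: ennreal_mult'[symmetric] ennreal_plus[symmetric] del: ennreal_plus\<close>)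
  also have "\<dots> = ennreal (2 powr ?r) * ((\<integral>\<^sup>+x. ennreal (\<bar>f x\<bar> powr ?r) \<partial>lborel) + (\<integral>\<^sup>+x. ennreal (\<bar>g x\<bar> powr ?r) \<partial>lborel))"
    by (simp add: nn_integral_cmult nn_integral_add)
  also have "\<dots> \<le> ennreal (2 powr ?r) * (ennreal (A powr ?r) + ennreal (B powr ?r))"
    using f g False by (intro mult_left_mono add_mono) (auto simp: Lq_bound_def)
  also have "\<dots> = ennreal (2 powr ?r * (A powr ?r + B powr ?r))"
    by (simp add: ennreal_mult')
  also have "\<dots> \<le> ennreal ((2 * (A + B)) powr ?r)"
    unfolding powr_mult using AB by (intro ennreal_leI mult_left_mono) auto
  finally show ?thesis using nn False by (simp add: Lq_bound_def)
qed

lemma Lq_bound_diff: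
  assumes "1 \<le> q" and f: "Lq_bound q f A" and g: "Lq_bound q g B"
  shows "Lq_bound q (\<lambda>x. f x - g x) (2 * (A + B))"
  using Lq_bound_add[OF assms(1,2) Lq_bound_scale[OF g, of "-1"]] by simp

text \<open>Young's inequality for \<open>L^1\<close> against \<open>L^q\<close>: after
  \<open>hconv_alt\<close> the slices are right translates of \<open>g\<close>, all of the same
  norm, and the weight is \<open>\<bar>k\<bar>\<close>. The essential bound \<open>M\<close> makes
  the integral converge at every point.\<close>

lemma Lq_bound_hconv:
  fixes k g :: "'n::finite heis \<Rightarrow> real"
  assumes q: "1 \<le> q" and k: "integrable lborel k" and M: "AE x in lborel. \<bar>g x\<bar> \<le> M" and g: "Lq_bound q g A"
  shows "Lq_bound q (hconv k g) (L1_norm k * A)"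
proof (cases "q = \<infinity>")
  case True
  then show ?thesis using g k unfolding Lq_bound_def by (auto intro!: AE_I2 hconv_bound)
next
  case False
  have [measurable]: "g \<in> borel_measurable borel" "k \<in> borel_measurable borel"
    using g k by (auto intro: Lq_bound_measurable)
  let ?r = "enn2real q"
  have r: "1 \<le> ?r" using q False by (rule enn2real_exponent)
  have ia: "integrable lborel (\<lambda>x. \<bar>k x\<bar>)" using k by auto
  have "\<bar>hconv k g x\<bar> \<le> (\<integral>\<zeta>. \<bar>g (x \<circ>\<^sub>H hinv \<zeta>)\<bar> * \<bar>k \<zeta>\<bar> \<partial>lborel)" for x
    using integral_abs_bound[of lborel "\<lambda>\<zeta>. k \<zeta> * g (x \<circ>\<^sub>H hinv \<zeta>)"] by (simp add: hconv_alt abs_mult mult.commute)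
  then have "(\<integral>\<^sup>+x. ennreal (\<bar>hconv k g x\<bar> powr ?r) \<partial>lborel)
    \<le> (\<integral>\<^sup>+x. ennreal ((\<integral>\<zeta>. \<bar>g (x \<circ>\<^sub>H hinv \<zeta>)\<bar> * \<bar>k \<zeta>\<bar> \<partial>lborel) powr ?r) \<partial>lborel)"
    using r by (intro nn_integral_mono ennreal_leI powr_mono2) auto
  also have "\<dots> \<le> ennreal ((A * (\<integral>\<zeta>. \<bar>k \<zeta>\<bar> \<partial>lborel)) powr ?r)"
  proof (rule minkowski_weighted[OF lborel.sigma_finite_measure_axioms r _ ia])
    fix x
    show "integrable lborel (\<lambda>\<zeta>. \<bar>g (x \<circ>\<^sub>H hinv \<zeta>)\<bar> * \<bar>k \<zeta>\<bar>)"
      using hconv_integrable[OF ia, of "\<lambda>x. \<bar>g x\<bar>" M x] M hconv_alt_integrable[of "\<lambda>x. \<bar>k x\<bar>" "\<lambda>x. \<bar>g x\<bar>" x]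
      by (simp add: mult.commute)
  next
    fix \<zeta> :: "'n heis"
    have "(\<integral>\<^sup>+x. ennreal (\<bar>g (x \<circ>\<^sub>H hinv \<zeta>)\<bar> powr ?r) \<partial>lborel) = (\<integral>\<^sup>+x. ennreal (\<bar>g x\<bar> powr ?r) \<partial>lborel)"
      using haar_preserving_nn_integral[OF haar_preserving_hmul(1), of "\<lambda>x. ennreal (\<bar>g x\<bar> powr ?r)" "hinv \<zeta>"] by simp
    then show "(\<integral>\<^sup>+x. ennreal (\<bar>g (x \<circ>\<^sub>H hinv \<zeta>)\<bar> powr ?r) \<partial>lborel) \<le> ennreal (A powr ?r)"
      using g False by (simp add: Lq_bound_def)
  qed (use g in \<open>auto simp: Lq_bound_def\<close>)
  finally show ?thesis using g False by (simp add: Lq_bound_def L1_norm_def mult.commute)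
qed

text \<open>Minkowski with a bound that varies in time: dividing the slice at \<open>\<tau>\<close>
  by \<open>\<psi> \<tau>\<close> normalises it to norm at most 1. For
  \<open>q = \<infinity>\<close> the quantifiers over almost all times and almost all points are
  exchanged by Fubini instead.\<close>

lemma Lq_bound_time_integral:
  fixes G :: "real \<Rightarrow> 'a::euclidean_space \<Rightarrow> real"
  assumes q: "1 \<le> q"
    and G[measurable]: "(\<lambda>(\<tau>, x). indicator {0<..<t} \<tau> * G \<tau> x) \<in> borel_measurable (borel \<Otimes>\<^sub>M borel)"
    and K: "\<And>\<tau> x. 0 < \<tau> \<Longrightarrow> \<tau> < t \<Longrightarrow> \<bar>G \<tau> x\<bar> \<le> K"
    and \<psi>: "set_integrable lborel {0<..<t} \<psi>" "\<And>\<tau>. 0 < \<tau> \<Longrightarrow> \<tau> < t \<Longrightarrow> 0 < \<psi> \<tau>"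
    and Gq: "\<And>\<tau>. 0 < \<tau> \<Longrightarrow> \<tau> < t \<Longrightarrow> Lq_bound q (G \<tau>) (\<psi> \<tau>)"
  shows "Lq_bound q (\<lambda>x. LINT \<tau>:{0<..<t}|lborel. G \<tau> x) (LINT \<tau>:{0<..<t}|lborel. \<psi> \<tau>)"
proof -
  let ?I = "{0<..<t}" and ?P = "LINT \<tau>:{0<..<t}|lborel. \<psi> \<tau>"
  let ?G = "\<lambda>\<tau> x. indicator ?I \<tau> * G \<tau> x" and ?\<psi> = "\<lambda>\<tau>. indicator ?I \<tau> * \<psi> \<tau>"
  have i\<psi>: "integrable lborel ?\<psi>" using \<psi>(1) by (simp add: set_integrable_def)
  have P0: "0 \<le> ?P"
    unfolding set_lebesgue_integral_def using \<psi>(2) by (intro Bochner_Integration.integral_nonneg) (auto simp: indicator_def less_imp_le)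
  have [measurable]: "(\<lambda>x. LINT \<tau>:?I|lborel. G \<tau> x) \<in> borel_measurable borel"
    unfolding set_lebesgue_integral_def by (simp add: split_beta') measurable
  have Gx: "(\<lambda>\<tau>. ?G \<tau> x) \<in> borel_measurable lborel" for x
    using measurable_Pair1[OF G, of x] by simp
  have Gi: "integrable lborel (\<lambda>\<tau>. ?G \<tau> x)" for x
  proof (rule Bochner_Integration.integrable_bound)
    show "integrable lborel (\<lambda>\<tau>. K * indicator ?I \<tau>)"
      by (intro integrable_mult_right integrable_indicator_bounded) auto
    show "AE \<tau> in lborel. norm (?G \<tau> x) \<le> norm (K * indicator ?I \<tau>)"
      using K by (auto simp: indicator_def intro: order_trans[OF _ abs_ge_self])
  qed (rule Gx)
  show ?thesis
  proof (cases "q = \<infinity>")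
    case True
    have m: "Measurable.pred (lborel \<Otimes>\<^sub>M lborel) (\<lambda>(\<tau>, x). \<bar>?G \<tau> x\<bar> \<le> ?\<psi> \<tau>)"
      using i\<psi> by (simp add: split_beta') measurable
    have "AE \<tau> in lborel. AE x in lborel. \<bar>?G \<tau> x\<bar> \<le> ?\<psi> \<tau>"
    proof (rule AE_I2)
      fix \<tau> show "AE x in lborel. \<bar>?G \<tau> x\<bar> \<le> ?\<psi> \<tau>"
        using Gq[of \<tau>] True by (cases "\<tau> \<in> ?I") (auto simp: Lq_bound_def)
    qed
    then have "AE x in lborel. AE \<tau> in lborel. \<bar>?G \<tau> x\<bar> \<le> ?\<psi> \<tau>"
      using m by (subst (asm) lborel_pair.AE_commute) (auto simp: pred_def split_beta')
    then have "AE x in lborel. \<bar>LINT \<tau>:?I|lborel. G \<tau> x\<bar> \<le> ?P"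
    proof eventually_elim
      case (elim x)
      have "\<bar>LINT \<tau>:?I|lborel. G \<tau> x\<bar> \<le> (LINT \<tau>|lborel. \<bar>?G \<tau> x\<bar>)"
        unfolding set_lebesgue_integral_def using integral_abs_bound[of lborel "\<lambda>\<tau>. ?G \<tau> x"] by simp
      also have "\<dots> \<le> (LINT \<tau>|lborel. ?\<psi> \<tau>)"
        using elim Gi by (intro integral_mono_AE i\<psi>) auto
      finally show ?case by (simp add: set_lebesgue_integral_def)
    qed
    then show ?thesis using True P0 by (simp add: Lq_bound_def)
  next
    case False
    let ?r = "enn2real q"
    have r: "1 \<le> ?r" using q False by (rule enn2real_exponent)
    \<comment> \<open>Outside the interval the numerator is 0, and the denominator 1 merely avoids a
      division by an uncontrolled value.\<close>
    define W where "W \<tau> x = \<bar>?G \<tau> x\<bar> / (if \<tau> \<in> ?I then \<psi> \<tau> else 1)" for \<tau> x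
    have W\<psi>: "W \<tau> x * ?\<psi> \<tau> = \<bar>?G \<tau> x\<bar>" for \<tau> x
      using \<psi>(2)[of \<tau>] by (auto simp: W_def indicator_def)
    have Walt: "W \<tau> x = \<bar>?G \<tau> x\<bar> / (?\<psi> \<tau> + indicator (- ?I) \<tau>)" for \<tau> x
      by (auto simp: W_def indicator_def)
    have "\<bar>LINT \<tau>:?I|lborel. G \<tau> x\<bar> \<le> (LINT \<tau>|lborel. W \<tau> x * ?\<psi> \<tau>)" for x
      unfolding set_lebesgue_integral_def W\<psi> using integral_abs_bound[of lborel "\<lambda>\<tau>. ?G \<tau> x"] by simp
    then have "(\<integral>\<^sup>+x. ennreal (\<bar>LINT \<tau>:?I|lborel. G \<tau> x\<bar> powr ?r) \<partial>lborel)
      \<le> (\<integral>\<^sup>+x. ennreal ((LINT \<tau>|lborel. W \<tau> x * ?\<psi> \<tau>) powr ?r) \<partial>lborel)"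
      using r by (intro nn_integral_mono ennreal_leI powr_mono2) auto
    also have "\<dots> \<le> ennreal ((1 * (LINT \<tau>|lborel. ?\<psi> \<tau>)) powr ?r)"
    proof (rule minkowski_weighted[OF lborel.sigma_finite_measure_axioms r _ i\<psi>])
      show "case_prod W \<in> borel_measurable (lborel \<Otimes>\<^sub>M lborel)"
        using G i\<psi> unfolding Walt[abs_def] by (simp add: split_beta') measurable
      show "integrable lborel (\<lambda>\<tau>. W \<tau> x * ?\<psi> \<tau>)" for x unfolding W\<psi> using Gi by auto
      show "0 \<le> W \<tau> x" "0 \<le> ?\<psi> \<tau>" for \<tau> x using \<psi>(2)[of \<tau>] by (auto simp: W_def indicator_def)
      show "(\<integral>\<^sup>+x. ennreal (W \<tau> x powr ?r) \<partial>lborel) \<le> ennreal (1 powr ?r)" for \<tau>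
      proof (cases "\<tau> \<in> ?I")
        case True
        then have p: "0 < \<psi> \<tau>" and B: "Lq_bound q (G \<tau>) (\<psi> \<tau>)" using \<psi>(2) Gq by auto
        have [measurable]: "G \<tau> \<in> borel_measurable borel" using B by (rule Lq_bound_measurable)
        have "(\<integral>\<^sup>+x. ennreal (W \<tau> x powr ?r) \<partial>lborel) = (\<integral>\<^sup>+x. ennreal (\<bar>G \<tau> x\<bar> powr ?r) / ennreal (\<psi> \<tau> powr ?r) \<partial>lborel)"
          using True p by (intro nn_integral_cong) (simp add: W_def powr_divide divide_ennreal)
        also have "\<dots> = (\<integral>\<^sup>+x. ennreal (\<bar>G \<tau> x\<bar> powr ?r) \<partial>lborel) / ennreal (\<psi> \<tau> powr ?r)"
          by (intro nn_integral_divide) measurable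
        also have "\<dots> \<le> ennreal (\<psi> \<tau> powr ?r) / ennreal (\<psi> \<tau> powr ?r)"
          using B False by (intro divide_right_mono_ennreal) (auto simp: Lq_bound_def)
        also have "\<dots> = 1" using p by (simp add: divide_ennreal)
        finally show ?thesis by simp
      qed (use r in \<open>simp add: W_def\<close>)
    qed simp
    finally show ?thesis using False P0 by (simp add: Lq_bound_def set_lebesgue_integral_def)
  qed
qed

lemma Lq_bound_tail:
  fixes g :: "'a::euclidean_space \<Rightarrow> real"
  assumes q: "1 \<le> q" "q \<noteq> \<infinity>" and g: "Lq_bound q g A" and e: "0 < e"
  obtains n :: nat where "Lq_bound q (\<lambda>x. indicator (- ball 0 (real n)) x * g x) e"
proof -
  have [measurable]: "g \<in> borel_measurable borel" using g by (rule Lq_bound_measurable)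
  let ?r = "enn2real q"
  have r: "1 \<le> ?r" using q by (rule enn2real_exponent)
  have "(\<integral>\<^sup>+x. ennreal (\<bar>g x\<bar> powr ?r) \<partial>lborel) < \<infinity>"
    using g q by (auto simp: Lq_bound_def intro: le_less_trans)
  then have i: "integrable lborel (\<lambda>x. \<bar>g x\<bar> powr ?r)"
    by (intro integrableI_nonneg) auto
  let ?t = "\<lambda>n x. \<bar>indicator (- ball 0 (real n)) x * g x\<bar> powr ?r"
  have "(\<lambda>n. LINT x|lborel. ?t n x) \<longlonglongrightarrow> (LINT x|(lborel :: 'a measure). 0)"
  proof (rule integral_dominated_convergence[OF _ _ i])
    show "AE x in lborel. (\<lambda>n. ?t n x) \<longlonglongrightarrow> 0"
    proof (rule AE_I2)
      fix x :: 'a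
      obtain N :: nat where "norm x < N" using reals_Archimedean2 by blast
      then have "\<forall>\<^sub>F n in sequentially. ?t n x = 0"
        unfolding eventually_sequentially by (intro exI[of _ N]) (auto simp: indicator_def)
      then show "(\<lambda>n. ?t n x) \<longlonglongrightarrow> 0" by (rule tendsto_eventually)
    qed
  qed (auto simp: indicator_def)
  then have "\<forall>\<^sub>F n in sequentially. (LINT x|lborel. ?t n x) < e powr ?r"
    using e by (intro order_tendstoD) auto
  then obtain n where n: "(LINT x|lborel. ?t n x) < e powr ?r"
    using eventually_happens'[of sequentially] by auto
  have "integrable lborel (?t n)"
    by (rule Bochner_Integration.integrable_bound[OF i]) (auto simp: indicator_def)
  then have "(\<integral>\<^sup>+x. ennreal (?t n x) \<partial>lborel) = ennreal (LINT x|lborel. ?t n x)"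
    by (intro nn_integral_eq_integral) auto
  with n q e have "Lq_bound q (\<lambda>x. indicator (- ball 0 (real n)) x * g x) e"
    by (simp add: Lq_bound_def ennreal_leI)
  then show ?thesis by (rule that)
qed

text \<open>Interpolation between \<open>L^1\<close> and \<open>L^\<infinity>\<close>: pointwise,
  the power \<open>r\<close> of \<open>\<bar>d\<bar>\<close> is at most
  \<open>M powr (r - 1) * \<bar>d\<bar>\<close>.\<close>

lemma Lq_bound_interpolate:
  fixes d :: "'a::euclidean_space \<Rightarrow> real"
  assumes q: "1 \<le> q" "q \<noteq> \<infinity>" and d: "integrable lborel d" and M: "AE x in lborel. \<bar>d x\<bar> \<le> M"
    and A: "0 \<le> A" "M powr (enn2real q - 1) * L1_norm d \<le> A powr enn2real q"
  shows "Lq_bound q d A"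
proof -
  have [measurable]: "d \<in> borel_measurable borel" using d by auto
  let ?r = "enn2real q"
  have r: "1 \<le> ?r" using q by (rule enn2real_exponent)
  have "(\<integral>\<^sup>+x. ennreal (\<bar>d x\<bar> powr ?r) \<partial>lborel) \<le> (\<integral>\<^sup>+x. ennreal (M powr (?r - 1) * \<bar>d x\<bar>) \<partial>lborel)"
  proof (rule nn_integral_mono_AE)
    show "AE x in lborel. ennreal (\<bar>d x\<bar> powr ?r) \<le> ennreal (M powr (?r - 1) * \<bar>d x\<bar>)"
      using M
    proof eventually_elim
      case (elim x)
      have "\<bar>d x\<bar> powr ?r = \<bar>d x\<bar> powr (?r - 1) * \<bar>d x\<bar>"
        by (cases "d x = 0") (auto simp: powr_diff)
      also have "\<dots> \<le> M powr (?r - 1) * \<bar>d x\<bar>"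
        using elim r by (intro mult_right_mono powr_mono2) auto
      finally show ?case by (rule ennreal_leI)
    qed
  qed
  also have "\<dots> = ennreal (M powr (?r - 1) * L1_norm d)"
    using d by (subst nn_integral_eq_integral) (auto simp: L1_norm_def)
  finally show ?thesis using A q by (auto simp: Lq_bound_def intro: order_trans ennreal_leI)
qed

section \<open>The semigroup on \<open>L^q\<close>\<close>

context heis_semigroup
begin

lemma Lq_bound_hconv_kernel:
  assumes "1 \<le> q" "0 < t" "AE x in lborel. \<bar>g x\<bar> \<le> M" "Lq_bound q g A" "mass t \<le> C"
  shows "Lq_bound q (hconv (h t) g) (C * A)"
proof (rule Lq_bound_mono)
  show "Lq_bound q (hconv (h t) g) (L1_norm (h t) * A)"
    using assms by (intro Lq_bound_hconv kernel_integrable)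
  show "L1_norm (h t) * A \<le> C * A"
    using assms Lq_bound_nonneg[OF assms(4)] by (intro mult_right_mono) (simp_all add: L1_norm_kernel)
qed

text \<open>Strong continuity is given in \<open>L^1\<close> only. The part of \<open>g\<close>
  inside a large ball is integrable and bounded, so its \<open>L^1\<close> convergence is upgraded
  by interpolation. The part outside is small in \<open>L^q\<close> and stays small under
  convolution.\<close>

lemma Lq_at_zero:
  assumes q: "1 \<le> q" "q \<noteq> \<infinity>" and M: "AE x in lborel. \<bar>g x\<bar> \<le> M" and g: "Lq_bound q g A" and e: "0 < e"
  shows "\<forall>\<^sub>F t in at_right 0. Lq_bound q (\<lambda>x. hconv (h t) g x - g x) e"
proof -
  have [measurable]: "g \<in> borel_measurable borel" using g by (rule Lq_bound_measurable)
  have M0: "0 \<le> M" using M by (rule ess_bound_nonneg)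
  let ?r = "enn2real q"
  have r: "1 \<le> ?r" using q by (rule enn2real_exponent)
  obtain C where C: "1 \<le> C" "\<And>t. 0 < t \<Longrightarrow> t \<le> 1 \<Longrightarrow> mass t \<le> C"
    using mass_bounded by blast
  \<comment> \<open>Each use of the weak triangle inequality doubles a sum, and
    \<open>2 * (e / 4 + 2 * ((C + 1) * e')) = e\<close>.\<close>
  define e' where "e' = e / 8 / (C + 1)"
  have e': "0 < e'" using e C by (simp add: e'_def)
  obtain n :: nat where n: "Lq_bound q (\<lambda>x. indicator (- ball 0 (real n)) x * g x) e'"
    using Lq_bound_tail[OF q g e'] .
  let ?B = "ball 0 (real n) :: 'n heis set"
  let ?g1 = "\<lambda>x. indicator ?B x * g x" and ?g2 = "\<lambda>x. indicator (- ?B) x * g x"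
  have b: "AE x in lborel. \<bar>?g1 x\<bar> \<le> M" "AE x in lborel. \<bar>?g2 x\<bar> \<le> M"
    using M by (eventually_elim, use M0 in \<open>auto simp: indicator_def\<close>)+
  have i1: "integrable lborel ?g1"
  proof (rule Bochner_Integration.integrable_bound)
    show "integrable lborel (\<lambda>x. M * indicator ?B x)"
      by (intro integrable_mult_right integrable_indicator_bounded) auto
  qed (use M in \<open>auto elim!: eventually_mono simp: indicator_def\<close>)
  have "((\<lambda>t. ((C + 1) * M) powr (?r - 1) * L1_norm (\<lambda>\<xi>. hconv (h t) ?g1 \<xi> - ?g1 \<xi>)) \<longlongrightarrow> ((C + 1) * M) powr (?r - 1) * 0) (at_right 0)"
    by (intro tendsto_intros hconv_at_zero_L1 i1)
  then have "\<forall>\<^sub>F t in at_right 0. ((C + 1) * M) powr (?r - 1) * L1_norm (\<lambda>\<xi>. hconv (h t) ?g1 \<xi> - ?g1 \<xi>) < (e / 4) powr ?r"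
    using e by (intro order_tendstoD) auto
  moreover have "\<forall>\<^sub>F t in at_right 0. 0 < t \<and> t \<le> (1::real)"
    unfolding eventually_at_right_field by (intro exI[of _ 1]) auto
  ultimately show ?thesis
  proof eventually_elim
    case (elim t)
    then have t: "0 < t" "t \<le> 1" by auto
    note k = kernel_integrable[OF t(1)]
    note [measurable] = kernel_measurable[OF t(1)]
    have gm: "?g1 \<in> borel_measurable borel" "?g2 \<in> borel_measurable borel"
      using Lq_bound_measurable[OF g] by (auto intro!: borel_measurable_times borel_measurable_indicator)
    then have hb: "\<bar>hconv (h t) ?g1 x\<bar> \<le> C * M" for x
      using hconv_kernel_bound[OF t(1) _ b(1), of x] mult_right_mono[OF C(2)[OF t] M0] by simp
    have "Lq_bound q (\<lambda>x. hconv (h t) ?g1 x - ?g1 x) (e / 4)"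
    proof (rule Lq_bound_interpolate[OF q])
      show "integrable lborel (\<lambda>x. hconv (h t) ?g1 x - ?g1 x)"
        using k i1 by (intro Bochner_Integration.integrable_diff hconv_L1_integrable)
      show "AE x in lborel. \<bar>hconv (h t) ?g1 x - ?g1 x\<bar> \<le> (C + 1) * M"
        using b(1)
      proof eventually_elim
        case (elim x) then show ?case using hb[of x] by (simp add: distrib_right)
      qed
    qed (use elim e in auto)
    moreover have "Lq_bound q (\<lambda>x. hconv (h t) ?g2 x - ?g2 x) (2 * (C * e' + e'))"
      using q t n b C by (intro Lq_bound_diff Lq_bound_hconv_kernel) auto
    ultimately have "Lq_bound q (\<lambda>x. (hconv (h t) ?g1 x - ?g1 x) + (hconv (h t) ?g2 x - ?g2 x)) (2 * (e / 4 + 2 * (C * e' + e')))"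
      by (rule Lq_bound_add[OF q(1)])
    moreover have "2 * (e / 4 + 2 * (C * e' + e')) = e"
    proof -
      have "C * e' + e' = (C + 1) * e'" by (simp add: distrib_right)
      also have "\<dots> = e / 8" using C nonzero_mult_div_cancel_left[of "C + 1" "e / 8"] by (simp only: e'_def times_divide_eq_right)
      finally show ?thesis by simp
    qed
    moreover have "(hconv (h t) ?g1 x - ?g1 x) + (hconv (h t) ?g2 x - ?g2 x) = hconv (h t) g x - g x" for x
    proof -
      have g12: "?g1 y + ?g2 y = g y" for y by (auto simp: indicator_def)
      have "hconv (h t) (\<lambda>y. ?g1 y + ?g2 y) x = hconv (h t) ?g1 x + hconv (h t) ?g2 x"
        by (rule hconv_add_right[OF k gm(1) b(1) gm(2) b(2)])
      then show ?thesis unfolding g12 using g12[of x] by linarith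
    qed
    ultimately show ?case by simp
  qed
qed

end

section \<open>The Duhamel integral\<close>

text \<open>Replacing \<open>\<tau>\<close> by the last grid point before it gives a countable
  patchwork of measurable functions. Refining the grid converges pointwise by left
  continuity.\<close>

lemma left_continuous_joint_measurable:
  fixes \<phi> :: "real \<Rightarrow> 'a \<Rightarrow> real"
  assumes meas: "\<And>\<tau>. 0 < \<tau> \<Longrightarrow> \<tau> < t \<Longrightarrow> \<phi> \<tau> \<in> borel_measurable M"
    and left: "\<And>\<tau> x. 0 < \<tau> \<Longrightarrow> \<tau> < t \<Longrightarrow> x \<in> space M \<Longrightarrow> ((\<lambda>\<sigma>. \<phi> \<sigma> x) \<longlongrightarrow> \<phi> \<tau> x) (at_left \<tau>)"
  shows "(\<lambda>(\<tau>, x). indicator {0<..<t} \<tau> * \<phi> \<tau> x) \<in> borel_measurable (borel \<Otimes>\<^sub>M M)"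
proof -
  \<comment> \<open>Grid points may fall below 0, where nothing is known about
    \<open>\<phi>\<close>; extension by zero makes every slice measurable.\<close>
  define \<phi>0 where "\<phi>0 \<tau> x = indicator {0<..<t} \<tau> * \<phi> \<tau> x" for \<tau> x
  have \<phi>0: "\<phi>0 \<tau> \<in> borel_measurable M" for \<tau>
  proof (cases "\<tau> \<in> {0<..<t}")
    case True
    then have "\<phi>0 \<tau> = \<phi> \<tau>" by (auto simp: \<phi>0_def)
    with True meas show ?thesis by simp
  next
    case False
    then have "\<phi>0 \<tau> = (\<lambda>_. 0)" by (auto simp: \<phi>0_def)
    then show ?thesis by simp
  qed
  \<comment> \<open>The ceiling minus 1, not the floor: the grid point must be strictly less than
    \<open>\<tau>\<close> even if \<open>\<tau>\<close> is itself on the grid.\<close>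
  define s where "s n \<tau> = real_of_int (\<lceil>real (Suc n) * \<tau>\<rceil> - 1) / real (Suc n)" for n \<tau>
  have s: "s n \<tau> < \<tau>" "\<tau> - 1 / real (Suc n) \<le> s n \<tau>" for n \<tau>
  proof -
    define m where "m = real (Suc n)"
    have m: "0 < m" by (simp add: m_def)
    have "real_of_int (\<lceil>m * \<tau>\<rceil> - 1) < m * \<tau>" "m * \<tau> - 1 \<le> real_of_int (\<lceil>m * \<tau>\<rceil> - 1)" by linarith+
    then show "s n \<tau> < \<tau>" "\<tau> - 1 / real (Suc n) \<le> s n \<tau>"
      unfolding s_def m_def[symmetric] using m by (simp_all add: field_simps)
  qed
  have slim: "filterlim (\<lambda>n. s n \<tau>) (at_left \<tau>) sequentially" for \<tau>
  proof -
    have "(\<lambda>n. \<tau> - 1 / real (Suc n)) \<longlonglongrightarrow> \<tau> - 0"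
      by (intro tendsto_diff tendsto_const LIMSEQ_Suc[OF lim_1_over_n])
    then have l: "(\<lambda>n. \<tau> - 1 / real (Suc n)) \<longlonglongrightarrow> \<tau>" by (simp only: diff_zero)
    have "(\<lambda>n. s n \<tau>) \<longlonglongrightarrow> \<tau>"
    proof (rule tendsto_sandwich[OF _ _ l tendsto_const])
      show "\<forall>\<^sub>F n in sequentially. \<tau> - 1 / real (Suc n) \<le> s n \<tau>"
        by (rule always_eventually) (intro allI s(2))
      show "\<forall>\<^sub>F n in sequentially. s n \<tau> \<le> \<tau>"
        by (rule always_eventually) (intro allI less_imp_le s(1))
    qed
    moreover have "\<forall>\<^sub>F n in sequentially. s n \<tau> \<in> {..<\<tau>} \<and> s n \<tau> \<noteq> \<tau>"
      by (rule always_eventually) (simp add: s(1) less_imp_neq)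
    ultimately show ?thesis by (simp add: filterlim_at)
  qed
  let ?f = "\<lambda>n z. indicator {0<..<t} (fst z) * \<phi>0 (s n (fst z)) (snd z)"
  show ?thesis
  proof (rule borel_measurable_LIMSEQ_real)
    fix n
    have c: "(\<lambda>z. \<lceil>real (Suc n) * fst z\<rceil>) \<in> borel \<Otimes>\<^sub>M M \<rightarrow>\<^sub>M count_space UNIV"
      by (intro measurable_compose[OF _ measurable_real_ceiling] borel_measurable_times measurable_const measurable_fst) auto
    have "(\<lambda>z. \<phi>0 (real_of_int (i - 1) / real (Suc n)) (snd z)) \<in> borel_measurable (borel \<Otimes>\<^sub>M M)" for i
      by (rule measurable_compose[OF measurable_snd \<phi>0])
    from measurable_compose_countable[OF this c]
    have "(\<lambda>z. \<phi>0 (s n (fst z)) (snd z)) \<in> borel_measurable (borel \<Otimes>\<^sub>M M)" unfolding s_def .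
    then show "?f n \<in> borel_measurable (borel \<Otimes>\<^sub>M M)"
      by (intro borel_measurable_times measurable_compose[OF measurable_fst borel_measurable_indicator]) auto
  next
    fix z :: "real \<times> 'a" assume z: "z \<in> space (borel \<Otimes>\<^sub>M M)"
    show "(\<lambda>n. ?f n z) \<longlonglongrightarrow> (case z of (\<tau>, x) \<Rightarrow> indicator {0<..<t} \<tau> * \<phi> \<tau> x)"
    proof (cases "fst z \<in> {0<..<t}")
      case True
      have "((\<lambda>\<sigma>. \<phi> \<sigma> (snd z)) \<longlongrightarrow> \<phi> (fst z) (snd z)) (at_left (fst z))"
        using True z by (intro left) (auto simp: space_pair_measure)
      from filterlim_compose[OF this slim]
      have "(\<lambda>n. \<phi> (s n (fst z)) (snd z)) \<longlonglongrightarrow> \<phi> (fst z) (snd z)" .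
      moreover have "\<forall>\<^sub>F n in sequentially. \<phi> (s n (fst z)) (snd z) = ?f n z"
      proof -
        have "\<forall>\<^sub>F n in sequentially. 0 < s n (fst z)"
        proof (rule order_tendstoD(1))
          show "(\<lambda>n. s n (fst z)) \<longlonglongrightarrow> fst z" using slim[of "fst z"] by (simp add: filterlim_at)
        qed (use True in simp)
        then show ?thesis
        proof eventually_elim
          case (elim n)
          moreover have "s n (fst z) < t" using s(1)[of n "fst z"] True by simp
          ultimately show ?case using True by (simp add: \<phi>0_def)
        qed
      qed
      ultimately have "(\<lambda>n. ?f n z) \<longlonglongrightarrow> \<phi> (fst z) (snd z)" by (rule Lim_transform_eventually)
      then show ?thesis using True by (simp add: case_prod_beta')
    qed (auto simp: case_prod_beta')
  qed
qed

lemma divide_mult_cancel_pos: "0 < y \<Longrightarrow> x / y * y = (x::real)"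
  by simp

text \<open>The class of source terms for the Duhamel integral. Only interior times enter: the
  endpoints are null for the integral, and at 0 norm continuity may fail.\<close>

definition admissible :: "real \<Rightarrow> real \<Rightarrow> (real \<Rightarrow> 'a::euclidean_space \<Rightarrow> real) \<Rightarrow> bool" where
  "admissible T K F \<longleftrightarrow> (\<forall>\<tau>\<in>{0<..<T}. F \<tau> \<in> borel_measurable borel \<and> (AE x in lborel. \<bar>F \<tau> x\<bar> \<le> K) \<and>
    (\<forall>e>0. \<forall>\<^sub>F \<sigma> in at_left \<tau>. AE x in lborel. \<bar>F \<sigma> x - F \<tau> x\<bar> \<le> e))"

lemma admissibleD:
  assumes "admissible T K F" "0 < \<tau>" "\<tau> < T"
  shows "F \<tau> \<in> borel_measurable borel" "AE x in lborel. \<bar>F \<tau> x\<bar> \<le> K"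
    "0 < e \<Longrightarrow> \<forall>\<^sub>F \<sigma> in at_left \<tau>. AE x in lborel. \<bar>F \<sigma> x - F \<tau> x\<bar> \<le> e"
  using assms by (auto simp: admissible_def)

lemma admissible_subset: "admissible T K F \<Longrightarrow> T' \<le> T \<Longrightarrow> admissible T' K F"
  by (auto simp: admissible_def)

lemma eventually_at_left_Ioo: "0 < \<tau> \<Longrightarrow> \<forall>\<^sub>F \<sigma> in at_left \<tau>. 0 < \<sigma> \<and> \<sigma> < (\<tau>::real)"
  unfolding eventually_at_left_field by (intro exI[of _ 0]) auto

lemma admissible_diff:
  assumes F: "admissible T K F" and G: "admissible T K' G"
  shows "admissible T (K + K') (\<lambda>\<tau> x. F \<tau> x - G \<tau> x)"
  unfolding admissible_def
proof (intro ballI conjI allI impI)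
  fix \<tau> assume \<tau>: "\<tau> \<in> {0<..<T}"
  then show "(\<lambda>x. F \<tau> x - G \<tau> x) \<in> borel_measurable borel"
    using F G by (intro borel_measurable_diff) (auto simp: admissible_def)
  have "AE x in lborel. \<bar>F \<tau> x\<bar> \<le> K" "AE x in lborel. \<bar>G \<tau> x\<bar> \<le> K'" using F G \<tau> by (auto simp: admissible_def)
  then show "AE x in lborel. \<bar>F \<tau> x - G \<tau> x\<bar> \<le> K + K'" by eventually_elim linarith
  fix e :: real assume "e > 0"
  then have "\<forall>\<^sub>F \<sigma> in at_left \<tau>. AE x in lborel. \<bar>F \<sigma> x - F \<tau> x\<bar> \<le> e / 2"
     "\<forall>\<^sub>F \<sigma> in at_left \<tau>. AE x in lborel. \<bar>G \<sigma> x - G \<tau> x\<bar> \<le> e / 2"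
    using admissibleD(3)[OF F, of \<tau> "e / 2"] admissibleD(3)[OF G, of \<tau> "e / 2"] \<tau> by auto
  then show "\<forall>\<^sub>F \<sigma> in at_left \<tau>. AE x in lborel. \<bar>F \<sigma> x - G \<sigma> x - (F \<tau> x - G \<tau> x)\<bar> \<le> e"
  proof eventually_elim
    case (elim \<sigma>)
    then show ?case by eventually_elim linarith
  qed
qed

context heis_semigroup
begin

definition duhamel :: "(real \<Rightarrow> 'n heis \<Rightarrow> real) \<Rightarrow> real \<Rightarrow> 'n heis \<Rightarrow> real" where
  "duhamel F t \<xi> = (LINT \<tau>:{0<..<t}|lborel. hconv (h (t - \<tau>)) (F \<tau>) \<xi>)"

text \<open>Two errors are added: the \<open>L^1\<close> increment of the kernel times
  \<open>K\<close>, and the mass of the kernel times the essential distance of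
  \<open>F \<sigma>\<close> from \<open>F \<tau>\<close>.\<close>

lemma duhamel_integrand_left_continuous:
  assumes F: "admissible T K F" and \<tau>: "0 < \<tau>" "\<tau> < t" "\<tau> < T"
  shows "((\<lambda>\<sigma>. hconv (h (t - \<sigma>)) (F \<sigma>) \<xi>) \<longlongrightarrow> hconv (h (t - \<tau>)) (F \<tau>) \<xi>) (at_left \<tau>)"
proof (rule tendstoI)
  fix e :: real assume e: "e > 0"
  have F\<tau>: "F \<tau> \<in> borel_measurable borel" "AE x in lborel. \<bar>F \<tau> x\<bar> \<le> K"
    using F \<tau> by (auto simp: admissible_def)
  have K: "0 \<le> K" using F\<tau>(2) by (rule ess_bound_nonneg)
  define m where "m = mass (t - \<tau>)"
  have m: "0 \<le> m" unfolding m_def using \<tau> by (intro mass_nonneg) auto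
  define e1 e2 where "e1 = e / 3 / (K + 1)" and "e2 = e / 3 / (m + 1)"
  have e12: "0 < e1" "0 < e2" "e1 * K < e / 2" "m * e2 < e / 2"
  proof -
    show "0 < e1" "0 < e2" using e K m by (auto simp: e1_def e2_def)
    have "e1 * K \<le> e1 * (K + 1)" using \<open>0 < e1\<close> by simp
    also have "\<dots> = e / 3" unfolding e1_def using K by (intro divide_mult_cancel_pos) simp
    finally show "e1 * K < e / 2" using e by simp
    have "m * e2 \<le> e2 * (m + 1)" using \<open>0 < e2\<close> by (simp add: mult.commute)
    also have "\<dots> = e / 3" unfolding e2_def using m by (intro divide_mult_cancel_pos) simp
    finally show "m * e2 < e / 2" using e by simp
  qed
  \<comment> \<open>Moving \<open>\<tau>\<close> to the left only lengthens the kernel time, so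
    increments at the single base time \<open>t - \<tau>\<close> suffice and the range of base times
    is degenerate.\<close>
  obtain \<delta> where \<delta>: "0 < \<delta>" "\<And>\<sigma> d. t - \<tau> \<le> \<sigma> \<Longrightarrow> \<sigma> \<le> t - \<tau> \<Longrightarrow> 0 \<le> d \<Longrightarrow> d \<le> \<delta> \<Longrightarrow> L1_norm (\<lambda>x. h (\<sigma> + d) x - h \<sigma> x) \<le> e1"
    using kernel_L1_modulus[of "t - \<tau>" e1 "t - \<tau>"] \<tau> e12 by auto
  have "\<forall>\<^sub>F \<sigma> in at_left \<tau>. \<tau> - \<delta> < \<sigma>"
    unfolding eventually_at_left_field using \<delta> by (intro exI[of _ "\<tau> - \<delta>"]) auto
  moreover have "\<forall>\<^sub>F \<sigma> in at_left \<tau>. AE x in lborel. \<bar>F \<sigma> x - F \<tau> x\<bar> \<le> e2"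
    using F \<tau> e12 by (auto simp: admissible_def)
  moreover have "\<forall>\<^sub>F \<sigma> in at_left \<tau>. 0 < \<sigma> \<and> \<sigma> < \<tau>" using \<tau> by (intro eventually_at_left_Ioo)
  ultimately show "\<forall>\<^sub>F \<sigma> in at_left \<tau>. dist (hconv (h (t - \<sigma>)) (F \<sigma>) \<xi>) (hconv (h (t - \<tau>)) (F \<tau>) \<xi>) < e"
  proof eventually_elim
    case (elim \<sigma>)
    have F\<sigma>: "F \<sigma> \<in> borel_measurable borel" "AE x in lborel. \<bar>F \<sigma> x\<bar> \<le> K"
      using F \<tau> elim by (auto simp: admissible_def)
    have k: "integrable lborel (h (t - \<sigma>))" "integrable lborel (h (t - \<tau>))"
      using \<tau> elim by (auto intro!: kernel_integrable)
    have L: "L1_norm (\<lambda>x. h (t - \<sigma>) x - h (t - \<tau>) x) \<le> e1"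
      using \<delta>(2)[of "t - \<tau>" "\<tau> - \<sigma>"] elim by simp
    have 1: "\<bar>hconv (\<lambda>x. h (t - \<sigma>) x - h (t - \<tau>) x) (F \<sigma>) \<xi>\<bar> \<le> e1 * K"
      using hconv_bound[OF _ F\<sigma>, of "\<lambda>x. h (t - \<sigma>) x - h (t - \<tau>) x" \<xi>] mult_right_mono[OF L K] k by auto
    have 2: "\<bar>hconv (h (t - \<tau>)) (\<lambda>x. F \<sigma> x - F \<tau> x) \<xi>\<bar> \<le> m * e2"
      unfolding m_def using \<tau> elim F\<sigma> F\<tau> by (intro hconv_kernel_bound) auto
    have "hconv (h (t - \<sigma>)) (F \<sigma>) \<xi> - hconv (h (t - \<tau>)) (F \<tau>) \<xi>
       = hconv (\<lambda>x. h (t - \<sigma>) x - h (t - \<tau>) x) (F \<sigma>) \<xi> + hconv (h (t - \<tau>)) (\<lambda>x. F \<sigma> x - F \<tau> x) \<xi>"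
      using hconv_diff_left[OF k F\<sigma>] hconv_diff_right[OF k(2) F\<sigma> F\<tau>] by simp
    then show ?case using 1 2 e12 by (simp add: dist_real_def)
  qed
qed

lemma duhamel_integrand_measurable:
  assumes F: "admissible T K F" and t: "t \<le> T"
  shows "(\<lambda>(\<tau>, \<xi>). indicator {0<..<t} \<tau> * hconv (h (t - \<tau>)) (F \<tau>) \<xi>) \<in> borel_measurable (borel \<Otimes>\<^sub>M borel)"
  using F t by (intro left_continuous_joint_measurable duhamel_integrand_left_continuous[OF F] measurable_hconv kernel_measurable)
    (auto simp: admissible_def)

lemma duhamel_integrand_measurable1:
  assumes F: "admissible T K F" and t: "t \<le> T"
  shows "(\<lambda>\<tau>. indicator {0<..<t} \<tau> * hconv (h (t - \<tau>)) (F \<tau>) \<xi>) \<in> borel_measurable borel"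
  using measurable_Pair1[OF duhamel_integrand_measurable[OF assms], of \<xi>] by simp

lemma duhamel_integrand_bound:
  assumes F: "admissible T K F" and "t \<le> T" and C: "\<And>t. 0 < t \<Longrightarrow> t \<le> T \<Longrightarrow> mass t \<le> C"
    and \<tau>: "0 < \<tau>" "\<tau> < t" and b: "AE x in lborel. \<bar>F \<tau> x\<bar> \<le> b"
  shows "\<bar>hconv (h (t - \<tau>)) (F \<tau>) \<xi>\<bar> \<le> C * b"
proof -
  have "\<bar>hconv (h (t - \<tau>)) (F \<tau>) \<xi>\<bar> \<le> mass (t - \<tau>) * b"
    using assms by (intro hconv_kernel_bound) (auto simp: admissible_def)
  also have "\<dots> \<le> C * b"
    using assms ess_bound_nonneg[OF b] by (intro mult_right_mono C) auto
  finally show ?thesis .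
qed

lemma duhamel_integrable:
  assumes F: "admissible T K F" and t: "t \<le> T"
  shows "integrable lborel (\<lambda>\<tau>. indicator {0<..<t} \<tau> * hconv (h (t - \<tau>)) (F \<tau>) \<xi>)"
proof -
  obtain C where C: "\<And>t. 0 < t \<Longrightarrow> t \<le> T \<Longrightarrow> mass t \<le> C" using mass_bounded by blast
  show ?thesis
  proof (rule Bochner_Integration.integrable_bound)
    show "integrable lborel (\<lambda>\<tau>. C * K * indicator {0<..<t} \<tau>)"
      by (intro integrable_mult_right integrable_indicator_bounded) auto
    show "AE \<tau> in lborel. norm (indicator {0<..<t} \<tau> * hconv (h (t - \<tau>)) (F \<tau>) \<xi>) \<le> norm (C * K * indicator {0<..<t} \<tau>)"
    proof (rule AE_I2)
      fix \<tau>
      show "norm (indicator {0<..<t} \<tau> * hconv (h (t - \<tau>)) (F \<tau>) \<xi>) \<le> norm (C * K * indicator {0<..<t} \<tau>)"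
      proof (cases "\<tau> \<in> {0<..<t}")
        case True
        then have "\<bar>hconv (h (t - \<tau>)) (F \<tau>) \<xi>\<bar> \<le> C * K"
          using F t by (intro duhamel_integrand_bound[OF F t C]) (auto simp: admissible_def)
        then show ?thesis using True by simp
      qed simp
    qed
  qed (use duhamel_integrand_measurable1[OF assms] in simp)
qed

lemma duhamel_measurable:
  assumes F: "admissible T K F" and t: "t \<le> T"
  shows "duhamel F t \<in> borel_measurable borel"
proof -
  note [measurable] = duhamel_integrand_measurable[OF assms]
  show ?thesis
    unfolding duhamel_def set_lebesgue_integral_def by (simp add: split_beta') measurable
qed

text \<open>The bound \<open>b\<close> may depend on time. Feeding in multiples of powers of
  \<open>\<tau>\<close> produces the factorial decay on which uniqueness rests.\<close>

lemma duhamel_bound: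
  assumes F: "admissible T K F" and t: "t \<le> T" and C: "\<And>t. 0 < t \<Longrightarrow> t \<le> T \<Longrightarrow> mass t \<le> C"
    and b: "\<And>\<tau>. 0 < \<tau> \<Longrightarrow> \<tau> < t \<Longrightarrow> AE x in lborel. \<bar>F \<tau> x\<bar> \<le> b \<tau>" and bi: "set_integrable lborel {0<..<t} b"
  shows "\<bar>duhamel F t \<xi>\<bar> \<le> C * (LINT \<tau>:{0<..<t}|lborel. b \<tau>)"
proof -
  have "\<bar>duhamel F t \<xi>\<bar> \<le> (LINT \<tau>|lborel. \<bar>indicator {0<..<t} \<tau> * hconv (h (t - \<tau>)) (F \<tau>) \<xi>\<bar>)"
    unfolding duhamel_def set_lebesgue_integral_def using integral_abs_bound[of lborel "\<lambda>\<tau>. indicator {0<..<t} \<tau> * hconv (h (t - \<tau>)) (F \<tau>) \<xi>"] by simp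
  also have "\<dots> \<le> (LINT \<tau>|lborel. C * (indicator {0<..<t} \<tau> * b \<tau>))"
  proof (rule integral_mono)
    show "integrable lborel (\<lambda>\<tau>. \<bar>indicator {0<..<t} \<tau> * hconv (h (t - \<tau>)) (F \<tau>) \<xi>\<bar>)"
      using duhamel_integrable[OF F t] by (rule integrable_abs)
    show "integrable lborel (\<lambda>\<tau>. C * (indicator {0<..<t} \<tau> * b \<tau>))"
      using bi by (intro integrable_mult_right) (simp add: set_integrable_def)
    show "\<bar>indicator {0<..<t} \<tau> * hconv (h (t - \<tau>)) (F \<tau>) \<xi>\<bar> \<le> C * (indicator {0<..<t} \<tau> * b \<tau>)" for \<tau>
    proof (cases "\<tau> \<in> {0<..<t}")
      case True
      then have "\<bar>hconv (h (t - \<tau>)) (F \<tau>) \<xi>\<bar> \<le> C * b \<tau>"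
        by (intro duhamel_integrand_bound[OF F t C] b) auto
      then show ?thesis using True by simp
    qed simp
  qed
  also have "\<dots> = C * (LINT \<tau>:{0<..<t}|lborel. b \<tau>)"
    by (simp add: set_lebesgue_integral_def)
  finally show ?thesis .
qed

lemma set_integrable_const_Ioo: "set_integrable lborel {0<..<t::real} (\<lambda>_. c::real)"
  unfolding set_integrable_def real_scaleR_def by (intro integrable_mult_left integrable_indicator_bounded borel_open open_greaterThanLessThan bounded_Ioo)

lemma set_integral_const_Ioo: "0 \<le> t \<Longrightarrow> (LINT \<tau>:{0<..<t}|lborel. (c::real)) = c * t"
  by (simp add: set_lebesgue_integral_def)

lemma duhamel_bound_const:
  assumes F: "admissible T K F" and t: "0 \<le> t" "t \<le> T" and C: "\<And>t. 0 < t \<Longrightarrow> t \<le> T \<Longrightarrow> mass t \<le> C"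
    and b: "\<And>\<tau>. 0 < \<tau> \<Longrightarrow> \<tau> < t \<Longrightarrow> AE x in lborel. \<bar>F \<tau> x\<bar> \<le> b"
  shows "\<bar>duhamel F t \<xi>\<bar> \<le> C * (b * t)"
proof -
  have "set_integrable lborel {0<..<t} (\<lambda>_. b)"
    by (rule set_integrable_const_Ioo)
  from duhamel_bound[OF F t(2) C b this, of \<xi>] show ?thesis
    using t by (simp add: set_integral_const_Ioo)
qed

lemma duhamel_diff:
  assumes F: "admissible T K F" and G: "admissible T K' G" and t: "t \<le> T"
  shows "duhamel (\<lambda>\<tau> x. F \<tau> x - G \<tau> x) t \<xi> = duhamel F t \<xi> - duhamel G t \<xi>"
proof -
  have "hconv (h (t - \<tau>)) (\<lambda>x. F \<tau> x - G \<tau> x) \<xi> = hconv (h (t - \<tau>)) (F \<tau>) \<xi> - hconv (h (t - \<tau>)) (G \<tau>) \<xi>"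
    if "\<tau> \<in> {0<..<t}" for \<tau>
    using F G that t by (intro hconv_diff_right[where M = K and M' = K'] kernel_integrable) (auto simp: admissible_def)
  then have "duhamel (\<lambda>\<tau> x. F \<tau> x - G \<tau> x) t \<xi> = (LINT \<tau>:{0<..<t}|lborel. hconv (h (t - \<tau>)) (F \<tau>) \<xi> - hconv (h (t - \<tau>)) (G \<tau>) \<xi>)"
    unfolding duhamel_def by (intro set_lebesgue_integral_cong) auto
  also have "\<dots> = duhamel F t \<xi> - duhamel G t \<xi>"
    unfolding duhamel_def using duhamel_integrable[OF F t, of \<xi>] duhamel_integrable[OF G t, of \<xi>]
    by (intro set_integral_diff) (auto simp: set_integrable_def)
  finally show ?thesis .
qed

lemma duhamel_cong_AE:
  assumes "\<And>\<tau>. 0 < \<tau> \<Longrightarrow> \<tau> < t \<Longrightarrow> F \<tau> \<in> borel_measurable borel \<and> G \<tau> \<in> borel_measurable borel \<and> (AE x in lborel. F \<tau> x = G \<tau> x)"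
  shows "duhamel F t \<xi> = duhamel G t \<xi>"
  unfolding duhamel_def using assms by (intro set_lebesgue_integral_cong) (auto intro!: hconv_cong_AE)

text \<open>The history of a solution seen after a further time \<open>r\<close>: by Fubini and the
  semigroup law every kernel time grows by \<open>r\<close>. Restarting a solution relies on
  this.\<close>

lemma hconv_duhamel:
  assumes F: "admissible T K F" and t: "0 < t" "t \<le> T" and r: "0 < r"
  shows "hconv (h r) (duhamel F t) \<xi> = (LINT \<tau>:{0<..<t}|lborel. hconv (h (r + t - \<tau>)) (F \<tau>) \<xi>)"
proof -
  obtain C where C: "1 \<le> C" "\<And>t. 0 < t \<Longrightarrow> t \<le> T \<Longrightarrow> mass t \<le> C" using mass_bounded by blast
  let ?\<phi> = "\<lambda>\<tau> \<eta>. indicator {0<..<t} \<tau> * hconv (h (t - \<tau>)) (F \<tau>) \<eta>"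
  let ?k = "\<lambda>\<eta>. h r (hinv \<eta> \<circ>\<^sub>H \<xi>)"
  have k: "integrable lborel ?k" using hconv_translate_integrable[OF kernel_integrable[OF r]] .
  note [measurable] = kernel_measurable[OF r]
  have [measurable]: "(\<lambda>z. ?\<phi> (fst z) (snd z)) \<in> borel_measurable (borel \<Otimes>\<^sub>M borel)"
    using duhamel_integrand_measurable[OF F t(2)] by (simp add: split_beta')
  have b: "\<bar>?\<phi> \<tau> \<eta>\<bar> \<le> C * K * indicator {0<..<t} \<tau>" for \<tau> \<eta>
  proof (cases "\<tau> \<in> {0<..<t}")
    case True
    then have "\<bar>hconv (h (t - \<tau>)) (F \<tau>) \<eta>\<bar> \<le> C * K"
      using F t by (intro duhamel_integrand_bound[OF F t(2) C(2)]) (auto simp: admissible_def)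
    then show ?thesis using True by simp
  qed simp
  have "integrable (lborel \<Otimes>\<^sub>M lborel) (\<lambda>(\<tau>, \<eta>). ?k \<eta> * ?\<phi> \<tau> \<eta>)"
  proof (rule Bochner_Integration.integrable_bound)
    show "integrable (lborel \<Otimes>\<^sub>M lborel) (\<lambda>(\<tau>, \<eta>). (C * K * indicator {0<..<t} \<tau>) * ?k \<eta>)"
      using k integrable_indicator_bounded[of "{0<..<t}"] by (intro lborel_pair.Fubini_integrable) (auto simp: abs_mult)
    show "AE z in lborel \<Otimes>\<^sub>M lborel. norm (case z of (\<tau>, \<eta>) \<Rightarrow> ?k \<eta> * ?\<phi> \<tau> \<eta>) \<le> norm (case z of (\<tau>, \<eta>) \<Rightarrow> (C * K * indicator {0<..<t} \<tau>) * ?k \<eta>)"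
    proof (rule AE_I2)
      fix z :: "real \<times> 'n heis"
      show "norm (case z of (\<tau>, \<eta>) \<Rightarrow> ?k \<eta> * ?\<phi> \<tau> \<eta>) \<le> norm (case z of (\<tau>, \<eta>) \<Rightarrow> (C * K * indicator {0<..<t} \<tau>) * ?k \<eta>)"
        using mult_left_mono[OF order_trans[OF b[of "fst z" "snd z"] abs_ge_self], of "\<bar>?k (snd z)\<bar>"]
        by (simp add: case_prod_beta' abs_mult mult_ac)
    qed
  qed (simp add: split_beta')
  note F2 = lborel_pair.Fubini_integral[OF this]
  have "hconv (h r) (duhamel F t) \<xi> = (LINT \<eta>|lborel. LINT \<tau>|lborel. ?k \<eta> * ?\<phi> \<tau> \<eta>)"
    unfolding hconv_def[of "h r"] duhamel_def set_lebesgue_integral_def by simp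
  also have "\<dots> = (LINT \<tau>|lborel. LINT \<eta>|lborel. ?k \<eta> * ?\<phi> \<tau> \<eta>)" by (rule F2)
  also have "\<dots> = (LINT \<tau>|lborel. indicator {0<..<t} \<tau> * hconv (h r) (hconv (h (t - \<tau>)) (F \<tau>)) \<xi>)"
    by (simp add: hconv_def[of "h r"] mult.left_commute)
  also have "\<dots> = (LINT \<tau>|lborel. indicator {0<..<t} \<tau> * hconv (h (r + t - \<tau>)) (F \<tau>) \<xi>)"
  proof (rule Bochner_Integration.integral_cong)
    fix \<tau>
    show "indicator {0<..<t} \<tau> * hconv (h r) (hconv (h (t - \<tau>)) (F \<tau>)) \<xi> = indicator {0<..<t} \<tau> * hconv (h (r + t - \<tau>)) (F \<tau>) \<xi>"
    proof (cases "\<tau> \<in> {0<..<t}")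
      case True
      then have "hconv (h (r + (t - \<tau>))) (F \<tau>) \<xi> = hconv (h r) (hconv (h (t - \<tau>)) (F \<tau>)) \<xi>"
        using F t r by (intro hconv_kernel_add[where M = K]) (auto simp: admissible_def)
      then show ?thesis by (simp add: add_diff_eq)
    qed simp
  qed simp
  finally show ?thesis by (simp add: set_lebesgue_integral_def)
qed

text \<open>The difference is a single time integral if the integrand for \<open>a\<close> is
  extended by zero. Before \<open>a - \<epsilon>\<close> the kernel times stay above
  \<open>\<epsilon>\<close> and the \<open>L^1\<close> modulus applies; from there to
  \<open>b\<close> a crude bound is enough because the window is short. The resulting
  \<open>\<delta>\<close> is uniform in \<open>a\<close> and \<open>b\<close>.\<close>

lemma duhamel_Lq_modulus:
  assumes q: "1 \<le> q" and F: "admissible T K F" and A: "\<And>\<tau>. 0 < \<tau> \<Longrightarrow> \<tau> < T \<Longrightarrow> Lq_bound q (F \<tau>) A" and e: "0 < e"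
  obtains \<delta> where "0 < \<delta>"
    "\<And>a b. 0 \<le> a \<Longrightarrow> a \<le> b \<Longrightarrow> b \<le> T \<Longrightarrow> b - a \<le> \<delta> \<Longrightarrow> Lq_bound q (\<lambda>x. duhamel F b x - duhamel F a x) e"
proof (cases "0 < T")
  case False
  have "Lq_bound q (\<lambda>x. duhamel F b x - duhamel F a x) e" if "0 \<le> a" "a \<le> b" "b \<le> T" for a b
  proof -
    have "a = 0" "b = 0" using that False by auto
    moreover have "Lq_bound q (\<lambda>x::'n heis. 0) e"
      by (rule Lq_bound_mono[OF Lq_bound_zero]) (use e in simp)
    ultimately show ?thesis by simp
  qed
  then show ?thesis by (intro that[of 1]) auto
next
  case T: True
  obtain C where C: "1 \<le> C" "\<And>t. 0 < t \<Longrightarrow> t \<le> T \<Longrightarrow> mass t \<le> C" using mass_bounded by blast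
  define A' where "A' = \<bar>A\<bar> + 1"
  have A': "0 < A'" "\<And>\<tau>. 0 < \<tau> \<Longrightarrow> \<tau> < T \<Longrightarrow> Lq_bound q (F \<tau>) A'"
    unfolding A'_def using A by (auto intro: Lq_bound_mono[OF A])
  \<comment> \<open>The far part contributes at most \<open>r * A' * T = e / 2\<close>, and the
    window, of length at most \<open>2 * \<epsilon>\<close>, at most
    \<open>4 * C * A' * (2 * \<epsilon>) = e / 2\<close>.\<close>
  define r where "r = e / (2 * A' * T)"
  define \<epsilon> where "\<epsilon> = e / (16 * C * A')"
  have r: "0 < r" and \<epsilon>: "0 < \<epsilon>" using e A' C T by (auto simp: r_def \<epsilon>_def)
  have r2: "r * A' * T = e / 2" and \<epsilon>2: "4 * C * A' * \<epsilon> = e / 4"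
    using A' C T by (simp_all add: r_def \<epsilon>_def)
  obtain \<delta>0 where \<delta>0: "0 < \<delta>0" "\<And>\<sigma> d. \<epsilon> \<le> \<sigma> \<Longrightarrow> \<sigma> \<le> T \<Longrightarrow> 0 \<le> d \<Longrightarrow> d \<le> \<delta>0 \<Longrightarrow> L1_norm (\<lambda>x. h (\<sigma> + d) x - h \<sigma> x) \<le> r"
    using kernel_L1_modulus[OF \<epsilon> r] by blast
  show ?thesis
  proof (rule that)
    show "0 < min \<delta>0 \<epsilon>" using \<delta>0 \<epsilon> by simp
    fix a b :: real assume ab: "0 \<le> a" "a \<le> b" "b \<le> T" "b - a \<le> min \<delta>0 \<epsilon>"
    let ?G = "\<lambda>\<tau> x. hconv (h (b - \<tau>)) (F \<tau>) x - indicator {0<..<a} \<tau> * hconv (h (a - \<tau>)) (F \<tau>) x"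
    \<comment> \<open>The factor 4 is the doubled sum of the two bounds \<open>C * A'\<close>. The
      constant term is positive throughout, as the normalisation by the weight requires.\<close>
    let ?\<psi> = "\<lambda>\<tau>. r * A' + 4 * C * A' * indicator {a - \<epsilon>..b} \<tau>"
    have ind: "indicator {0<..<b} \<tau> * (indicator {0<..<a} \<tau> * y) = indicator {0<..<a} \<tau> * (y::real)" for \<tau> y
      using ab by (auto simp: indicator_def)
    have eq: "duhamel F b x - duhamel F a x = (LINT \<tau>:{0<..<b}|lborel. ?G \<tau> x)" for x
      unfolding duhamel_def set_lebesgue_integral_def
      using duhamel_integrable[OF F, of b x] duhamel_integrable[OF F, of a x] ab
      by (subst Bochner_Integration.integral_diff[symmetric]) (simp_all add: right_diff_distrib ind)
    have \<psi>i: "set_integrable lborel {0<..<b} ?\<psi>"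
    proof (intro set_integral_add set_integrable_const_Ioo)
      have "integrable lborel (\<lambda>\<tau>. 4 * C * A' * indicator {a - \<epsilon>..b} \<tau>)"
        by (intro integrable_mult_right integrable_indicator_bounded) auto
      then show "set_integrable lborel {0<..<b} (\<lambda>\<tau>. 4 * C * A' * indicator {a - \<epsilon>..b} \<tau>)"
        unfolding set_integrable_def by (intro integrable_mult_indicator) auto
    qed
    have 1: "Lq_bound q (\<lambda>x. LINT \<tau>:{0<..<b}|lborel. ?G \<tau> x) (LINT \<tau>:{0<..<b}|lborel. ?\<psi> \<tau>)"
    proof (rule Lq_bound_time_integral[OF q])
      show "(\<lambda>(\<tau>, x). indicator {0<..<b} \<tau> * ?G \<tau> x) \<in> borel_measurable (borel \<Otimes>\<^sub>M borel)"
        using duhamel_integrand_measurable[OF F, of a] duhamel_integrand_measurable[OF F, of b] ab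
        unfolding right_diff_distrib ind by (simp add: split_beta')
      show "set_integrable lborel {0<..<b} ?\<psi>" by (rule \<psi>i)
      fix \<tau> assume \<tau>: "0 < \<tau>" "\<tau> < b"
      have F\<tau>: "F \<tau> \<in> borel_measurable borel" "AE x in lborel. \<bar>F \<tau> x\<bar> \<le> K" "Lq_bound q (F \<tau>) A'"
        using F \<tau> ab A' by (auto simp: admissible_def)
      show "0 < ?\<psi> \<tau>" using r A' C by (intro add_pos_nonneg) auto
      have bb: "Lq_bound q (hconv (h (b - \<tau>)) (F \<tau>)) (C * A')"
        using \<tau> ab F\<tau> q by (intro Lq_bound_hconv_kernel[where M = K] C(2)) auto
      show "Lq_bound q (?G \<tau>) (?\<psi> \<tau>)"
      proof (cases "\<tau> < a")
        case False
        then have "?G \<tau> = hconv (h (b - \<tau>)) (F \<tau>)" by auto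
        moreover have "C * A' \<le> ?\<psi> \<tau>"
          using False \<tau> \<epsilon> r A' C by (simp add: indicator_def)
        ultimately show ?thesis using bb Lq_bound_mono by metis
      next
        case True
        then have k: "integrable lborel (h (b - \<tau>))" "integrable lborel (h (a - \<tau>))"
          using ab by (auto intro!: kernel_integrable)
        have G: "?G \<tau> = hconv (\<lambda>x. h (b - \<tau>) x - h (a - \<tau>) x) (F \<tau>)"
          using True \<tau> hconv_diff_left[OF k F\<tau>(1,2)] by auto
        show ?thesis
        proof (cases "\<tau> < a - \<epsilon>")
          case True
          have "Lq_bound q (?G \<tau>) (L1_norm (\<lambda>x. h (b - \<tau>) x - h (a - \<tau>) x) * A')"
            unfolding G using k by (intro Lq_bound_hconv[OF q _ F\<tau>(2,3)]) auto
          moreover have "L1_norm (\<lambda>x. h (b - \<tau>) x - h (a - \<tau>) x) \<le> r"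
            using \<delta>0(2)[of "a - \<tau>" "b - a"] True \<tau> ab by simp
          then have "L1_norm (\<lambda>x. h (b - \<tau>) x - h (a - \<tau>) x) * A' \<le> ?\<psi> \<tau>"
            using A' C mult_right_mono[of "L1_norm (\<lambda>x. h (b - \<tau>) x - h (a - \<tau>) x)" r A']
            by (intro order_trans[OF _ add_increasing2]) auto
          ultimately show ?thesis by (rule Lq_bound_mono)
        next
          case False
          have "Lq_bound q (\<lambda>x. hconv (h (b - \<tau>)) (F \<tau>) x - hconv (h (a - \<tau>)) (F \<tau>) x) (2 * (C * A' + C * A'))"
            using \<tau> ab True F\<tau> q by (intro Lq_bound_diff bb Lq_bound_hconv_kernel[where M = K] C(2)) auto
          moreover have "2 * (C * A' + C * A') \<le> ?\<psi> \<tau>"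
            using False True \<tau> \<epsilon> r A' C ab by (simp add: indicator_def)
          ultimately show ?thesis using True \<tau> by (simp add: Lq_bound_mono)
        qed
      qed
    next
      fix \<tau> x assume \<tau>: "0 < \<tau>" "\<tau> < b"
      have F\<tau>: "AE x in lborel. \<bar>F \<tau> x\<bar> \<le> K"
        using F \<tau> ab by (auto simp: admissible_def)
      have K: "0 \<le> K" using F\<tau> by (rule ess_bound_nonneg)
      have "\<bar>hconv (h (b - \<tau>)) (F \<tau>) x\<bar> \<le> C * K"
        using \<tau> ab by (intro duhamel_integrand_bound[OF F _ C(2) _ _ F\<tau>]) auto
      moreover have "\<bar>indicator {0<..<a} \<tau> * hconv (h (a - \<tau>)) (F \<tau>) x\<bar> \<le> C * K"
      proof (cases "\<tau> < a")
        case True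
        then show ?thesis using \<tau> ab duhamel_integrand_bound[OF F _ C(2) _ _ F\<tau>, of a x] by simp
      qed (use C K in simp)
      ultimately show "\<bar>?G \<tau> x\<bar> \<le> C * K + C * K" by linarith
    qed
    have "(LINT \<tau>:{0<..<b}|lborel. ?\<psi> \<tau>) \<le> (LINT \<tau>|lborel. r * A' * indicator {0<..<b} \<tau> + 4 * C * A' * indicator {a - \<epsilon>..b} \<tau>)"
      unfolding set_lebesgue_integral_def
    proof (rule integral_mono)
      show "indicator {0<..<b} \<tau> *\<^sub>R ?\<psi> \<tau> \<le> r * A' * indicator {0<..<b} \<tau> + 4 * C * A' * indicator {a - \<epsilon>..b} \<tau>" for \<tau>
        using A' C by (auto simp: indicator_def)
      show "integrable lborel (\<lambda>\<tau>. indicator {0<..<b} \<tau> *\<^sub>R ?\<psi> \<tau>)" using \<psi>i by (simp add: set_integrable_def)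
      show "integrable lborel (\<lambda>\<tau>. r * A' * indicator {0<..<b} \<tau> + 4 * C * A' * indicator {a - \<epsilon>..b} \<tau>)"
        by (intro Bochner_Integration.integrable_add integrable_mult_right integrable_indicator_bounded) auto
    qed
    also have "\<dots> = r * A' * b + 4 * C * A' * (b - a + \<epsilon>)"
      using ab \<epsilon> by simp
    also have "\<dots> \<le> r * A' * T + 4 * C * A' * (\<epsilon> + \<epsilon>)"
      using ab r A' C by (intro add_mono mult_left_mono) auto
    also have "\<dots> = e" using r2 \<epsilon>2 by (simp add: distrib_left)
    finally show "Lq_bound q (\<lambda>x. duhamel F b x - duhamel F a x) e"
      unfolding eq by (rule Lq_bound_mono[OF 1])
  qed
qed

end

section \<open>The function spaces\<close>

lemma Lq_1_iff: "g \<in> Lq 1 \<longleftrightarrow> integrable lborel (g :: 'a::euclidean_space \<Rightarrow> real)"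
  by (auto simp: Lq_def Lq_norm_def integrable_iff_bounded Let_def less_top)

lemma one_le_infinity_ennreal [simp]: "(1::ennreal) \<le> \<infinity>"
  by (simp add: infinity_ennreal_def)

lemma Lq_infinity_iff:
  "g \<in> Lq \<infinity> \<longleftrightarrow> g \<in> borel_measurable borel \<and> (\<exists>M. AE x in lborel. \<bar>g x\<bar> \<le> M)"
proof
  assume g: "g \<in> Lq \<infinity>"
  obtain A where "Lq_bound \<infinity> g A" by (rule Lq_imp_Lq_bound[OF one_le_infinity_ennreal g])
  then show "g \<in> borel_measurable borel \<and> (\<exists>M. AE x in lborel. \<bar>g x\<bar> \<le> M)"
    by (auto simp: Lq_bound_def)
next
  assume "g \<in> borel_measurable borel \<and> (\<exists>M. AE x in lborel. \<bar>g x\<bar> \<le> M)"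
  then obtain M where "Lq_bound \<infinity> g M" using Lq_bound_infinity by blast
  then show "g \<in> Lq \<infinity>" by (rule Lq_bound_imp_Lq[OF one_le_infinity_ennreal])
qed

lemma Lq_norm_1_eq_L1_norm:
  "integrable lborel d \<Longrightarrow> Lq_norm 1 d = ennreal (L1_norm d)"
  using nn_integral_eq_integral[of lborel "\<lambda>x. \<bar>d x\<bar>"]
  by (simp add: Lq_norm_def L1_norm_def Let_def)

lemma eventually_in_within: "\<forall>\<^sub>F \<tau> in at t within I. \<tau> \<in> I"
  by (simp add: eventually_at_filter)

text \<open>Convergence in \<open>ennreal\<close> is exchanged for real bounds. The filter sees only
  times in \<open>I\<close>, where measurability is known.\<close>

lemma norm_continuous_iff:
  assumes q: "1 \<le> q" and u: "\<And>\<tau>. \<tau> \<in> I \<Longrightarrow> u \<tau> \<in> borel_measurable borel" and t: "t \<in> I"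
  shows "norm_continuous q I u t \<longleftrightarrow> (\<forall>e>0. \<forall>\<^sub>F \<tau> in at t within I. Lq_bound q (\<lambda>x. u \<tau> x - u t x) e)"
proof -
  have iff: "Lq_bound q (\<lambda>x. u \<tau> x - u t x) e \<longleftrightarrow> Lq_norm q (\<lambda>x. u \<tau> x - u t x) \<le> ennreal e" if "0 < e" "\<tau> \<in> I" for e \<tau>
    using that u t by (intro Lq_bound_iff q borel_measurable_diff) auto
  show ?thesis
  proof
    assume "norm_continuous q I u t"
    then have l: "((\<lambda>\<tau>. Lq_norm q (\<lambda>x. u \<tau> x - u t x)) \<longlongrightarrow> 0) (at t within I)" by (simp add: norm_continuous_def)
    show "\<forall>e>0. \<forall>\<^sub>F \<tau> in at t within I. Lq_bound q (\<lambda>x. u \<tau> x - u t x) e"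
    proof (intro allI impI)
      fix e :: real assume e: "0 < e"
      then have "\<forall>\<^sub>F \<tau> in at t within I. Lq_norm q (\<lambda>x. u \<tau> x - u t x) < ennreal e"
        by (intro order_tendstoD[OF l]) simp
      then show "\<forall>\<^sub>F \<tau> in at t within I. Lq_bound q (\<lambda>x. u \<tau> x - u t x) e"
        using eventually_in_within[of I t] by eventually_elim (use e in \<open>simp add: iff\<close>)
    qed
  next
    assume R: "\<forall>e>0. \<forall>\<^sub>F \<tau> in at t within I. Lq_bound q (\<lambda>x. u \<tau> x - u t x) e"
    show "norm_continuous q I u t" unfolding norm_continuous_def
    proof (rule order_tendstoI)
      fix a :: ennreal assume "0 < a"
      then obtain e' where "0 < e'" "e' < a" using dense by blast
      then obtain e where e: "e' = ennreal e" "0 < e" by (cases e') auto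
      have "\<forall>\<^sub>F \<tau> in at t within I. Lq_bound q (\<lambda>x. u \<tau> x - u t x) e" using R e by blast
      then show "\<forall>\<^sub>F \<tau> in at t within I. Lq_norm q (\<lambda>x. u \<tau> x - u t x) < a"
        using eventually_in_within[of I t]
        by eventually_elim (use e \<open>e' < a\<close> in \<open>auto simp: iff intro: le_less_trans\<close>)
    qed simp
  qed
qed

section \<open>Weak-* continuity and boundedness on compact time intervals\<close>

lemma C_Lq_measurable: "u \<in> C_Lq q I \<Longrightarrow> t \<in> I \<Longrightarrow> u t \<in> borel_measurable borel"
  by (auto simp: C_Lq_def Lq_def)

lemma C_Linf_ess_bounded:
  assumes "u \<in> C_Lq \<infinity> I" "t \<in> I" shows "\<exists>M. AE x in lborel. \<bar>u t x\<bar> \<le> M"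
proof -
  have "u t \<in> Lq \<infinity>" using assms unfolding C_Lq_def by blast
  then show ?thesis unfolding Lq_infinity_iff by blast
qed

text \<open>It suffices to test boundedness against functions concentrated where \<open>v\<close> nearly attains
  its essential supremum.\<close>

lemma ess_bound_test_function:
  fixes v :: "'a::euclidean_space \<Rightarrow> real"
  assumes [measurable]: "v \<in> borel_measurable borel" and M: "AE x in lborel. \<bar>v x\<bar> \<le> M"
    and K: "0 < K" "\<not> (AE x in lborel. \<bar>v x\<bar> \<le> K)"
  obtains L e where "K \<le> L" "AE x in lborel. \<bar>v x\<bar> \<le> L" "integrable lborel e" "L1_norm e \<le> 1"
    "3 / 4 * L \<le> (LINT x|lborel. v x * e x)"
proof -
  define S where "S = {a. AE x in lborel. \<bar>v x\<bar> \<le> a}"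
  have SK: "K \<le> a" if "a \<in> S" for a
  proof (rule ccontr)
    assume "\<not> K \<le> a"
    then have "AE x in lborel. \<bar>v x\<bar> \<le> K" using that unfolding S_def by (auto elim!: eventually_mono)
    with K show False by simp
  qed
  have Sne: "S \<noteq> {}" using M by (auto simp: S_def)
  have bdd: "bdd_below S" using SK by (auto simp: bdd_below_def)
  have KI: "K \<le> Inf S" using Sne SK by (rule cInf_greatest)
  \<comment> \<open>Any factor strictly between 1 and 4/3 serves: \<open>3 / 4 * L\<close> must drop
    below the infimum, so that it is no longer an essential bound.\<close>
  then have "Inf S < 8 / 7 * Inf S" using K by simp
  then obtain L where L: "L \<in> S" "L < 8 / 7 * Inf S" using cInf_less_iff[OF Sne bdd] by blast
  have L0: "K \<le> L" using SK L by simp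
  have "3 / 4 * L \<notin> S"
  proof
    assume "3 / 4 * L \<in> S"
    then have "Inf S \<le> 3 / 4 * L" by (rule cInf_lower[OF _ bdd])
    then show False using L KI K by simp
  qed
  then have nae: "\<not> (AE x in lborel. \<bar>v x\<bar> \<le> 3 / 4 * L)" by (simp add: S_def)
  \<comment> \<open>The set where \<open>\<bar>v\<bar>\<close> is nearly maximal may have infinite
    measure; a bounded piece of it gives a normalisable test function.\<close>
  define P where "P m = {x \<in> ball 0 (real m). 3 / 4 * L < \<bar>v x\<bar>}" for m
  have [measurable]: "P m \<in> sets borel" for m unfolding P_def by measurable
  have bP: "bounded (P m)" for m unfolding P_def by (rule bounded_subset[OF bounded_ball[of 0 "real m"]]) auto
  have "\<exists>m. emeasure lborel (P m) \<noteq> 0"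
  proof (rule ccontr)
    assume "\<not> ?thesis"
    then have "AE x in lborel. \<forall>m. x \<notin> P m"
      unfolding AE_all_countable by (auto intro!: AE_not_in simp: null_sets_def)
    then have "AE x in lborel. \<bar>v x\<bar> \<le> 3 / 4 * L"
    proof eventually_elim
      case (elim x)
      obtain m :: nat where "norm x < m" using reals_Archimedean2 by blast
      with elim[rule_format, of m] show ?case by (simp add: P_def)
    qed
    with nae show False by simp
  qed
  then obtain m where m: "emeasure lborel (P m) \<noteq> 0" by blast
  define V where "V = measure lborel (P m)"
  have fin: "emeasure lborel (P m) < \<infinity>" using bP by (rule emeasure_bounded_finite)
  have V: "0 < V" unfolding V_def using m fin
    by (simp add: measure_def enn2real_positive_iff pos2 zero_less_iff_neq_zero)
  define e where "e x = sgn (v x) * indicator (P m) x / V" for x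
  have iP: "integrable lborel (indicator (P m) :: 'a \<Rightarrow> real)" by (intro integrable_indicator_bounded bP) simp
  have ie: "integrable lborel e"
  proof (rule Bochner_Integration.integrable_bound)
    show "integrable lborel (\<lambda>x. indicator (P m) x / V :: real)" using iP by (rule integrable_divide_zero)
    show "e \<in> borel_measurable lborel" unfolding e_def sgn_if by measurable
  qed (use V in \<open>auto simp: e_def abs_mult abs_sgn_eq indicator_def\<close>)
  have "L1_norm e \<le> (LINT x|lborel. indicator (P m) x / V)"
    unfolding L1_norm_def
    by (intro integral_mono integrable_abs ie integrable_divide_zero iP) (use V in \<open>auto simp: e_def abs_mult abs_sgn_eq indicator_def\<close>)
  also have "\<dots> = 1" using V by (simp add: V_def)
  finally have e1: "L1_norm e \<le> 1" .
  have ive: "integrable lborel (\<lambda>x. v x * e x)"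
  proof (rule Bochner_Integration.integrable_bound)
    show "integrable lborel (\<lambda>x. L * e x)" using ie by (rule integrable_mult_right)
    have "AE x in lborel. \<bar>v x\<bar> \<le> L" using L by (simp add: S_def)
    then show "AE x in lborel. norm (v x * e x) \<le> norm (L * e x)"
      by eventually_elim (auto simp: abs_mult intro!: mult_right_mono)
  qed (use ie in measurable)
  have "3 / 4 * L = (LINT x|lborel. 3 / 4 * L * (indicator (P m) x / V))"
    using V by (simp add: V_def)
  also have "\<dots> \<le> (LINT x|lborel. v x * e x)"
  proof (rule integral_mono[OF _ ive])
    show "integrable lborel (\<lambda>x. 3 / 4 * L * (indicator (P m) x / V))"
      using iP by (intro integrable_mult_right integrable_divide_zero)
    show "3 / 4 * L * (indicator (P m) x / V) \<le> v x * e x" for x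
    proof (cases "x \<in> P m")
      case True
      then have "3 / 4 * L \<le> v x * sgn (v x)" by (simp add: P_def abs_sgn)
      then have "3 / 4 * L / V \<le> v x * sgn (v x) / V" using V by (intro divide_right_mono) auto
      then show ?thesis using True by (simp add: e_def)
    qed (simp add: e_def)
  qed
  finally show ?thesis using L L0 ie e1 by (intro that[of L e]) (auto simp: S_def)
qed

text \<open>The uniform boundedness principle for the functionals
  \<open>g \<mapsto> LINT x|lborel. v n x * g x\<close> on \<open>L^1\<close>. If it failed, a
  series of nearly norming test functions would converge to some \<open>G\<close> on which the
  functionals are unbounded.\<close>

lemma uniform_boundedness_Linf:
  fixes v :: "nat \<Rightarrow> 'a::euclidean_space \<Rightarrow> real"
  assumes v[measurable]: "\<And>n. v n \<in> borel_measurable borel" and vb: "\<And>n. \<exists>M. AE x in lborel. \<bar>v n x\<bar> \<le> M"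
    and B: "\<And>g. integrable lborel g \<Longrightarrow> Bseq (\<lambda>n. LINT x|lborel. v n x * g x)"
  shows "\<exists>K. \<forall>n. AE x in lborel. \<bar>v n x\<bar> \<le> K"
proof (rule ccontr)
  assume neg: "\<not> ?thesis"
  \<comment> \<open>A triple consists of an index, an essential bound of size at least
    \<open>4 ^ k\<close> for the function with that index, and a test function of norm at most 1
    that nearly attains the bound.\<close>
  define Q where "Q k z \<longleftrightarrow> 4 ^ k \<le> fst (snd z) \<and> (AE x in lborel. \<bar>v (fst z) x\<bar> \<le> fst (snd z)) \<and>
      integrable lborel (snd (snd z)) \<and> L1_norm (snd (snd z)) \<le> 1 \<and>
      3 / 4 * fst (snd z) \<le> (LINT x|lborel. v (fst z) x * snd (snd z) x)"
    for k :: nat and z :: "nat \<times> real \<times> ('a \<Rightarrow> real)"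
  have "\<exists>z. Q k z" for k
  proof -
    obtain n where n: "\<not> (AE x in lborel. \<bar>v n x\<bar> \<le> 4 ^ k)" using neg by blast
    obtain M where M: "AE x in lborel. \<bar>v n x\<bar> \<le> M" using vb by blast
    obtain L e where "4 ^ k \<le> L" "AE x in lborel. \<bar>v n x\<bar> \<le> L" "integrable lborel e" "L1_norm e \<le> 1"
      "3 / 4 * L \<le> (LINT x|lborel. v n x * e x)"
      by (rule ess_bound_test_function[OF v M _ n]) auto
    then have "Q k (n, L, e)" by (simp add: Q_def)
    then show ?thesis by blast
  qed
  then obtain z where z: "\<And>k. Q k (z k)" by metis
  define n L e where "n k = fst (z k)" and "L k = fst (snd (z k))" and "e k = snd (snd (z k))" for k
  have L: "\<And>k. 4 ^ k \<le> L k" "\<And>k. AE x in lborel. \<bar>v (n k) x\<bar> \<le> L k"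
    and e: "\<And>k. integrable lborel (e k)" "\<And>k. L1_norm (e k) \<le> 1"
    and ve: "\<And>k. 3 / 4 * L k \<le> (LINT x|lborel. v (n k) x * e k x)"
    using z unfolding Q_def n_def L_def e_def by blast+
  \<comment> \<open>The ratio 1/3 balances two demands: all increments after step \<open>k\<close>
    sum to at most \<open>c k / 2\<close>, less than the guaranteed \<open>3 / 4 * c k\<close>, and
    \<open>c k * 4 ^ k\<close> still grows.\<close>
  define c :: "nat \<Rightarrow> real" where "c k = (1 / 3) ^ k" for k
  have c: "0 < c k" for k by (simp add: c_def)
  define T where "T k g = (LINT x|lborel. v (n k) x * g x)" for k g
  have Ti: "integrable lborel (\<lambda>x. v (n k) x * g x)" if g: "integrable lborel g" for k g
  proof (rule Bochner_Integration.integrable_bound)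
    show "integrable lborel (\<lambda>x. L k * g x)" using g by (rule integrable_mult_right)
    show "AE x in lborel. norm (v (n k) x * g x) \<le> norm (L k * g x)"
      using L(2)[of k] by eventually_elim (auto simp: abs_mult intro!: mult_right_mono)
  qed (use g in measurable)
  have Tb: "\<bar>T k g\<bar> \<le> L k * L1_norm g" if g: "integrable lborel g" for k g
  proof -
    have "\<bar>T k g\<bar> \<le> (LINT x|lborel. \<bar>v (n k) x * g x\<bar>)" unfolding T_def by (rule integral_abs_bound)
    also have "\<dots> \<le> (LINT x|lborel. L k * \<bar>g x\<bar>)"
    proof (rule integral_mono_AE)
      show "AE x in lborel. \<bar>v (n k) x * g x\<bar> \<le> L k * \<bar>g x\<bar>"
        using L(2)[of k] by eventually_elim (auto simp: abs_mult intro!: mult_right_mono)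
    qed (use g Ti[OF g] in auto)
    finally show ?thesis by (simp add: L1_norm_def)
  qed
  text \<open>Choosing the sign of each increment keeps \<open>T k\<close> large on the partial sum (Sokal's proof of
    the uniform boundedness principle).\<close>
  define g where "g = rec_nat (\<lambda>_. 0) (\<lambda>k gk. if c k * (3 / 4 * L k) \<le> \<bar>T k (\<lambda>x. gk x + c k * e k x)\<bar>
    then (\<lambda>x. gk x + c k * e k x) else (\<lambda>x. gk x - c k * e k x))"
  have g0: "g 0 = (\<lambda>_. 0)" by (simp add: g_def)
  have gS: "g (Suc k) = (if c k * (3 / 4 * L k) \<le> \<bar>T k (\<lambda>x. g k x + c k * e k x)\<bar>
    then (\<lambda>x. g k x + c k * e k x) else (\<lambda>x. g k x - c k * e k x))" for k by (simp add: g_def)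
  have gi: "integrable lborel (g k)" for k
    by (induction k) (use e in \<open>auto simp: g0 gS\<close>)
  have Tg: "c k * (3 / 4 * L k) \<le> \<bar>T k (g (Suc k))\<bar>" for k
  proof (cases "c k * (3 / 4 * L k) \<le> \<bar>T k (\<lambda>x. g k x + c k * e k x)\<bar>")
    case True
    then show ?thesis by (simp add: gS)
  next
    case False
    have ce: "integrable lborel (\<lambda>x. c k * e k x)" using e by (intro integrable_mult_right)
    have T2: "T k (\<lambda>x. g k x + c k * e k x) = T k (g k) + c k * T k (e k)"
       "T k (\<lambda>x. g k x - c k * e k x) = T k (g k) - c k * T k (e k)"
      unfolding T_def using Ti[OF gi[of k], of k] Ti[OF ce, of k]
      by (simp_all add: distrib_left right_diff_distrib mult.left_commute)
    have "c k * (3 / 4 * L k) \<le> c k * T k (e k)" using ve[of k] c[of k] unfolding T_def by (intro mult_left_mono) auto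
    moreover have "T k (g (Suc k)) = T k (g k) - c k * T k (e k)"
      unfolding gS using False by (simp only: if_False T2)
    ultimately show ?thesis using False unfolding T2 by linarith
  qed
  define D where "D k x = g (Suc k) x - g k x" for k x
  have Di: "integrable lborel (D k)" for k unfolding D_def using gi by auto
  have [measurable]: "D k \<in> borel_measurable borel" for k using Di[of k] by auto
  have Dabs: "\<bar>D k x\<bar> = c k * \<bar>e k x\<bar>" for k x using c[of k] by (auto simp: D_def gS abs_mult)
  have DL: "(LINT x|lborel. \<bar>D k x\<bar>) \<le> c k" for k
    using mult_left_mono[OF e(2)[of k], of "c k"] c[of k] unfolding Dabs by (simp add: L1_norm_def)
  have csum: "summable c" unfolding c_def by (rule summable_geometric) simp
  have sumL: "summable (\<lambda>k. LINT x|lborel. norm (D k x))"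
    by (rule summable_comparison_test[OF _ csum]) (use DL in \<open>auto intro!: exI[of _ 0] simp: c_def\<close>)
  have AEs: "AE x in lborel. summable (\<lambda>k. norm (D k x))"
  proof -
    have "(\<integral>\<^sup>+x. (\<Sum>k. ennreal \<bar>D k x\<bar>) \<partial>lborel) = (\<Sum>k. ennreal (LINT x|lborel. \<bar>D k x\<bar>))"
      using Di by (subst nn_integral_suminf) (auto intro!: suminf_cong nn_integral_eq_integral)
    also have "\<dots> = ennreal (\<Sum>k. LINT x|lborel. \<bar>D k x\<bar>)"
      using sumL by (intro suminf_ennreal2) auto
    also have "\<dots> \<noteq> \<infinity>" by simp
    finally have "AE x in lborel. (\<Sum>k. ennreal \<bar>D k x\<bar>) \<noteq> \<infinity>"
      by (intro nn_integral_PInf_AE) auto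
    then show ?thesis
      by eventually_elim (auto intro!: summable_suminf_not_top)
  qed
  define G where "G x = (\<Sum>k. D k x)" for x
  have Gi: "integrable lborel G" unfolding G_def using Di AEs sumL by (intro integrable_suminf) auto
  \<comment> \<open>Telescoping identifies the remainder with the tail of the series, and the
    geometric tail starting at \<open>Suc k\<close> is half of \<open>c k\<close>.\<close>
  have rest: "L1_norm (\<lambda>x. G x - g (Suc k) x) \<le> 1 / 2 * c k" for k
  proof -
    let ?m = "Suc k"
    have s1: "summable (\<lambda>j. LINT x|lborel. norm (D (j + ?m) x))" using sumL by (subst summable_iff_shift)
    have s2: "AE x in lborel. summable (\<lambda>j. norm (D (j + ?m) x))"
      using AEs by eventually_elim (subst summable_iff_shift)
    have tel: "(\<Sum>j<m. D j x) = g m x" for m x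
      unfolding D_def by (subst sum_lessThan_telescope) (simp add: g0)
    have "L1_norm (\<lambda>x. G x - g ?m x) \<le> (LINT x|lborel. (\<Sum>j. norm (D (j + ?m) x)))"
      unfolding L1_norm_def
    proof (rule integral_mono_AE)
      show "integrable lborel (\<lambda>x. \<bar>G x - g ?m x\<bar>)" using Gi gi by auto
      show "integrable lborel (\<lambda>x. \<Sum>j. norm (D (j + ?m) x))"
        using Di s1 s2 by (intro integrable_suminf) auto
      show "AE x in lborel. \<bar>G x - g ?m x\<bar> \<le> (\<Sum>j. norm (D (j + ?m) x))"
        using AEs s2
      proof eventually_elim
        case (elim x)
        have "G x - g ?m x = (\<Sum>j. D (j + ?m) x)"
          using suminf_minus_initial_segment[OF summable_norm_cancel[OF elim(1)], of ?m] by (simp add: G_def tel)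
        then show ?case using summable_norm[OF elim(2)] by simp
      qed
    qed
    also have "\<dots> = (\<Sum>j. LINT x|lborel. norm (D (j + ?m) x))"
      using Di s1 s2 by (intro integral_suminf) auto
    also have "\<dots> \<le> (\<Sum>j. c (j + ?m))"
    proof (rule suminf_le[OF _ s1])
      show "summable (\<lambda>j. c (j + ?m))" using csum by (subst summable_iff_shift)
    qed (use DL in simp)
    also have "\<dots> = (\<Sum>j. (1 / 3 * c k) * (1 / 3) ^ j)"
      by (intro suminf_cong) (simp add: c_def power_add)
    also have "\<dots> = 1 / 2 * c k" by (subst suminf_mult) (auto simp: suminf_geometric)
    finally show ?thesis .
  qed
  \<comment> \<open>What survives the remainder is \<open>3 / 4 - 1 / 2 = 1 / 4\<close> of
    \<open>c k * L k\<close>, hence at least a quarter of \<open>(4 / 3) ^ k\<close>.\<close>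
  have large: "1 / 4 * (4 / 3) ^ k \<le> \<bar>T k G\<bar>" for k
  proof -
    have i: "integrable lborel (\<lambda>x. G x - g (Suc k) x)" using Gi gi by auto
    have L0: "0 \<le> L k" using L(1)[of k] by (rule order_trans[rotated]) simp
    have "T k (\<lambda>x. G x - g (Suc k) x) = T k G - T k (g (Suc k))"
      unfolding T_def using Ti[OF Gi, of k] Ti[OF gi[of "Suc k"], of k] by (simp add: right_diff_distrib)
    moreover have "\<bar>T k (\<lambda>x. G x - g (Suc k) x)\<bar> \<le> L k * (1 / 2 * c k)"
      using Tb[OF i, of k] mult_left_mono[OF rest[of k] L0] by linarith
    ultimately have "c k * (3 / 4 * L k) - L k * (1 / 2 * c k) \<le> \<bar>T k G\<bar>" using Tg[of k] by linarith
    then have "1 / 4 * (c k * L k) \<le> \<bar>T k G\<bar>" by (simp add: algebra_simps)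
    moreover have "c k * 4 ^ k \<le> c k * L k" using L(1) c[of k] by (intro mult_left_mono) auto
    moreover have "c k * 4 ^ k = (4 / 3) ^ k" by (simp add: c_def power_mult_distrib[symmetric])
    ultimately show ?thesis by simp
  qed
  obtain b where b: "\<And>m. \<bar>LINT x|lborel. v m x * G x\<bar> \<le> b"
    using B[OF Gi] by (auto simp: Bseq_def)
  obtain k where "4 * b < (4 / 3 :: real) ^ k" using real_arch_pow[of "4 / 3" "4 * b"] by auto
  then show False using large[of k] b[of "n k"] unfolding T_def by simp
qed

text \<open>Weak-* continuity is the notion available at every time: at 0 it is the definition,
  elsewhere it follows from norm continuity by Hoelder's inequality.\<close>

lemma norm_continuous_imp_weak:
  fixes g :: "'a::euclidean_space \<Rightarrow> real"
  assumes u: "u \<in> C_Lq \<infinity> I" and t: "t \<in> I" and g: "integrable lborel g"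
  shows "((\<lambda>\<tau>. LINT x|lborel. u \<tau> x * g x) \<longlongrightarrow> (LINT x|lborel. u t x * g x)) (at t within I)"
proof (cases "t = 0")
  case True
  then show ?thesis using u t g by (auto simp: C_Lq_def weak_star_continuous_def Lq_1_iff)
next
  case False
  have um: "u \<tau> \<in> borel_measurable borel" if "\<tau> \<in> I" for \<tau> using u that by (rule C_Lq_measurable)
  have nc: "\<forall>e>0. \<forall>\<^sub>F \<tau> in at t within I. Lq_bound \<infinity> (\<lambda>x. u \<tau> x - u t x) e"
    using u t False norm_continuous_iff[OF _ um t, of \<infinity>] by (auto simp: C_Lq_def)
  have int: "integrable lborel (\<lambda>x. u \<tau> x * g x)" if "\<tau> \<in> I" for \<tau>
  proof -
    from C_Linf_ess_bounded[OF u that] obtain M where M: "AE x in lborel. \<bar>u \<tau> x\<bar> \<le> M" by blast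
    show ?thesis
    proof (rule Bochner_Integration.integrable_bound)
      show "integrable lborel (\<lambda>x. M * g x)" using g by (rule integrable_mult_right)
      show "AE x in lborel. norm (u \<tau> x * g x) \<le> norm (M * g x)"
        using M by eventually_elim (auto simp: abs_mult intro!: mult_right_mono)
    qed (use g um[OF that] in auto)
  qed
  show ?thesis
  proof (rule tendstoI)
    fix e :: real assume e: "0 < e"
    define E where "E = e / (L1_norm g + 1)"
    have e': "0 < E" unfolding E_def using e by (intro divide_pos_pos add_nonneg_pos) auto
    have lt: "E * L1_norm g < e"
    proof -
      have "E * L1_norm g < E * (L1_norm g + 1)" using e' by (intro mult_strict_left_mono) auto
      also have "\<dots> = e" unfolding E_def by (rule divide_mult_cancel_pos) (simp add: add_nonneg_pos)
      finally show ?thesis .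
    qed
    have "\<forall>\<^sub>F \<tau> in at t within I. Lq_bound \<infinity> (\<lambda>x. u \<tau> x - u t x) E" using nc e' by blast
    then show "\<forall>\<^sub>F \<tau> in at t within I. dist (LINT x|lborel. u \<tau> x * g x) (LINT x|lborel. u t x * g x) < e"
      using eventually_in_within[of I t]
    proof eventually_elim
      case (elim \<tau>)
      then have ae: "AE x in lborel. \<bar>u \<tau> x - u t x\<bar> \<le> E" by (simp add: Lq_bound_def)
      have "\<bar>(LINT x|lborel. u \<tau> x * g x) - (LINT x|lborel. u t x * g x)\<bar> \<le> L1_norm (\<lambda>x. u \<tau> x * g x - u t x * g x)"
        using int[OF elim(2)] int[OF t] integral_abs_bound[of lborel "\<lambda>x. u \<tau> x * g x - u t x * g x"] by (simp add: L1_norm_def)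
      also have "\<dots> \<le> (LINT x|lborel. E * \<bar>g x\<bar>)"
        unfolding L1_norm_def
      proof (rule integral_mono_AE)
        show "AE x in lborel. \<bar>u \<tau> x * g x - u t x * g x\<bar> \<le> E * \<bar>g x\<bar>"
        proof (rule eventually_mono[OF ae])
          fix x assume le: "\<bar>u \<tau> x - u t x\<bar> \<le> E"
          have "\<bar>u \<tau> x * g x - u t x * g x\<bar> = \<bar>u \<tau> x - u t x\<bar> * \<bar>g x\<bar>"
            by (simp only: abs_mult[symmetric] left_diff_distrib)
          also have "\<dots> \<le> E * \<bar>g x\<bar>" using le by (rule mult_right_mono) simp
          finally show "\<bar>u \<tau> x * g x - u t x * g x\<bar> \<le> E * \<bar>g x\<bar>" .
        qed
        show "integrable lborel (\<lambda>x. \<bar>u \<tau> x * g x - u t x * g x\<bar>)" using int[OF elim(2)] int[OF t] by auto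
        show "integrable lborel (\<lambda>x. E * \<bar>g x\<bar>)" using g by (intro integrable_mult_right integrable_abs)
      qed
      also have "\<dots> = E * L1_norm g" by (simp add: L1_norm_def)
      finally show ?case using lt by (simp add: dist_real_def)
    qed
  qed
qed

text \<open>If times \<open>s n\<close> had essential norm above \<open>n\<close>, a subsequence of
  them would converge in the compact interval. Along it all pairings with \<open>L^1\<close>
  converge, so the norms are bounded by the uniform boundedness principle. This excludes in
  particular a loss of boundedness near time 0.\<close>

lemma C_Linf_bounded:
  fixes u :: "real \<Rightarrow> 'a::euclidean_space \<Rightarrow> real"
  assumes u: "u \<in> C_Lq \<infinity> {0..T}"
  obtains K where "\<And>t. t \<in> {0..T} \<Longrightarrow> AE x in lborel. \<bar>u t x\<bar> \<le> K"
proof (rule ccontr)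
  assume neg: "\<not> thesis"
  have "\<exists>t\<in>{0..T}. \<not> (AE x in lborel. \<bar>u t x\<bar> \<le> real n)" for n :: nat using neg that by blast
  then obtain s where s: "\<And>n. s n \<in> {0..T}" "\<And>n::nat. \<not> (AE x in lborel. \<bar>u (s n) x\<bar> \<le> real n)" by metis
  obtain l r where l: "l \<in> {0..T}" and r: "strict_mono r" "(s \<circ> r) \<longlonglongrightarrow> l"
    using compact_Icc[of 0 T] s(1) unfolding compact_def by metis
  have "\<exists>K. \<forall>n. AE x in lborel. \<bar>(u \<circ> s \<circ> r) n x\<bar> \<le> K"
  proof (rule uniform_boundedness_Linf)
    show "(u \<circ> s \<circ> r) n \<in> borel_measurable borel" for n using C_Lq_measurable[OF u s(1)] by simp
    show "\<exists>M. AE x in lborel. \<bar>(u \<circ> s \<circ> r) n x\<bar> \<le> M" for n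
      using C_Linf_ess_bounded[OF u s(1)[of "r n"]] by simp
    fix g :: "'a \<Rightarrow> real" assume "integrable lborel g"
    then have "continuous (at l within {0..T}) (\<lambda>\<tau>. LINT x|lborel. u \<tau> x * g x)"
      unfolding continuous_within by (intro norm_continuous_imp_weak[OF u l])
    then have "((\<lambda>\<tau>. LINT x|lborel. u \<tau> x * g x) \<circ> (s \<circ> r)) \<longlonglongrightarrow> (LINT x|lborel. u l x * g x)"
      using r s(1) unfolding continuous_within_sequentially by auto
    then show "Bseq (\<lambda>n. LINT x|lborel. (u \<circ> s \<circ> r) n x * g x)"
      by (intro convergent_imp_Bseq convergentI) (simp add: comp_def)
  qed
  then obtain K where K: "\<And>n. AE x in lborel. \<bar>u (s (r n)) x\<bar> \<le> K" by auto
  obtain n :: nat where "K < n" using reals_Archimedean2 by blast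
  \<comment> \<open>The functions of the subsequence exceed their original index \<open>r n\<close>,
    which is at least \<open>n\<close> and so beyond \<open>K\<close>.\<close>
  then have "K \<le> real (r n)" using seq_suble[OF r(1), of n] by linarith
  then have "AE x in lborel. \<bar>u (s (r n)) x\<bar> \<le> real (r n)" using K[of n] by (auto elim!: eventually_mono)
  with s(2) show False by blast
qed

text \<open>Testing with the sign of \<open>a - b\<close>, cut off by a ball, turns equal pairings
  into a vanishing integral of \<open>\<bar>a - b\<bar>\<close> over that ball.\<close>

lemma AE_eq_if_integrals_eq:
  fixes a b :: "'a::euclidean_space \<Rightarrow> real"
  assumes [measurable]: "a \<in> borel_measurable borel" "b \<in> borel_measurable borel"
    and M: "AE x in lborel. \<bar>a x\<bar> \<le> M" "AE x in lborel. \<bar>b x\<bar> \<le> M"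
    and eq: "\<And>g. integrable lborel g \<Longrightarrow> (LINT x|lborel. a x * g x) = (LINT x|lborel. b x * g x)"
  shows "AE x in lborel. a x = b x"
proof -
  have "AE x in lborel. \<forall>n::nat. \<bar>a x - b x\<bar> * indicator (ball 0 (real n)) x = 0"
    unfolding AE_all_countable
  proof
    fix n :: nat
    let ?g = "\<lambda>x. sgn (a x - b x) * indicator (ball 0 (real n)) x"
    have ib: "integrable lborel (indicator (ball 0 (real n)) :: 'a \<Rightarrow> real)" by (intro integrable_indicator_bounded) auto
    have "(\<lambda>y::real. sgn y) \<in> borel_measurable borel" unfolding sgn_if by measurable
    then have "(\<lambda>x. sgn (a x - b x)) \<in> borel_measurable borel"
      by (rule measurable_compose[rotated]) (intro borel_measurable_diff assms(1,2))
    then have gm: "?g \<in> borel_measurable borel"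
      by (intro borel_measurable_times borel_measurable_indicator) auto
    have gle: "\<bar>?g x\<bar> \<le> indicator (ball 0 (real n)) x" for x
      by (simp add: abs_mult abs_sgn_eq indicator_def)
    have g: "integrable lborel ?g"
    proof (rule Bochner_Integration.integrable_bound[OF ib])
      show "?g \<in> borel_measurable lborel" using gm by simp
      show "AE x in lborel. norm (?g x) \<le> norm (indicator (ball 0 (real n)) x :: real)"
        unfolding real_norm_def by (intro AE_I2 order_trans[OF gle abs_ge_self])
    qed
    have i: "integrable lborel (\<lambda>x. w x * ?g x)" if w: "AE x in lborel. \<bar>w x\<bar> \<le> M" and wm: "w \<in> borel_measurable borel" for w
    proof (rule Bochner_Integration.integrable_bound)
      show "integrable lborel (\<lambda>x. M * ?g x)" using g by (rule integrable_mult_right)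
      show "AE x in lborel. norm (w x * ?g x) \<le> norm (M * ?g x)"
        using w
      proof eventually_elim
        case (elim x)
        then show ?case unfolding real_norm_def abs_mult by (intro mult_right_mono) auto
      qed
      show "(\<lambda>x. w x * ?g x) \<in> borel_measurable lborel" using borel_measurable_times[OF wm gm] by simp
    qed
    have e: "a x * ?g x - b x * ?g x = \<bar>a x - b x\<bar> * indicator (ball 0 (real n)) x" for x
    proof -
      have "a x * ?g x - b x * ?g x = ((a x - b x) * sgn (a x - b x)) * indicator (ball 0 (real n)) x"
        by (simp only: left_diff_distrib mult.assoc)
      also have "(a x - b x) * sgn (a x - b x) = \<bar>a x - b x\<bar>" by (rule abs_sgn[symmetric])
      finally show ?thesis .
    qed
    have ia: "integrable lborel (\<lambda>x. a x * ?g x)" "integrable lborel (\<lambda>x. b x * ?g x)"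
      using M assms(1,2) by (auto intro: i)
    have ii: "integrable lborel (\<lambda>x. \<bar>a x - b x\<bar> * indicator (ball 0 (real n)) x)"
      using Bochner_Integration.integrable_diff[OF ia] unfolding e .
    have "(LINT x|lborel. \<bar>a x - b x\<bar> * indicator (ball 0 (real n)) x) = 0"
      using Bochner_Integration.integral_diff[OF ia] unfolding e eq[OF g] by simp
    then show "AE x in lborel. \<bar>a x - b x\<bar> * indicator (ball 0 (real n)) x = 0"
      using integral_nonneg_eq_0_iff_AE[OF ii] by simp
  qed
  then show ?thesis
  proof eventually_elim
    case (elim x)
    obtain n :: nat where "norm x < n" using reals_Archimedean2 by blast
    then have "x \<in> ball 0 (real n)" by simp
    then have "\<bar>a x - b x\<bar> = 0" using spec[OF elim, of n] by simp
    then show ?case by simp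
  qed
qed

lemma Lq_bound_cong_AE:
  assumes "Lq_bound q g A" "f \<in> borel_measurable borel" "AE x in lborel. f x = g x"
  shows "Lq_bound q f A"
  using assms(3) by (intro Lq_bound_dominated[OF assms(1,2)]) (auto elim!: eventually_mono)

lemma Lq_bound_minus_commute:
  assumes "Lq_bound q (\<lambda>x. f x - g x) A" shows "Lq_bound q (\<lambda>x. g x - f x) A"
  using Lq_bound_scale[OF assms, of "-1"] by simp

lemma L1_norm_minus_commute: "L1_norm (\<lambda>x. f x - g x) = L1_norm (\<lambda>x. g x - f x)"
  by (simp add: L1_norm_def abs_minus_commute)

lemma eventually_at_within_abs:
  assumes "0 < \<delta>" shows "\<forall>\<^sub>F \<tau> in at t within I. \<bar>\<tau> - (t::real)\<bar> \<le> \<delta>"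
  unfolding eventually_at using assms by (intro exI[of _ \<delta>]) (auto simp: dist_real_def)

section \<open>Continuity in time of the semigroup and of the Duhamel term\<close>

context heis_semigroup
begin

lemma duhamel_zero [simp]: "duhamel F 0 x = 0"
  by (simp add: duhamel_def set_lebesgue_integral_def)

lemma duhamel_Lq_bound:
  assumes q: "1 \<le> q" and F: "admissible T K F" and t: "t \<le> T"
    and C: "1 \<le> C" "\<And>t. 0 < t \<Longrightarrow> t \<le> T \<Longrightarrow> mass t \<le> C"
    and b: "\<And>\<tau>. 0 < \<tau> \<Longrightarrow> \<tau> < t \<Longrightarrow> Lq_bound q (F \<tau>) (b \<tau>)" "\<And>\<tau>. 0 < \<tau> \<Longrightarrow> \<tau> < t \<Longrightarrow> 0 < b \<tau>"
    and bi: "set_integrable lborel {0<..<t} b"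
  shows "Lq_bound q (duhamel F t) (C * (LINT \<tau>:{0<..<t}|lborel. b \<tau>))"
proof -
  have "Lq_bound q (\<lambda>x. LINT \<tau>:{0<..<t}|lborel. hconv (h (t - \<tau>)) (F \<tau>) x) (LINT \<tau>:{0<..<t}|lborel. C * b \<tau>)"
  proof (rule Lq_bound_time_integral[OF q])
    show "(\<lambda>(\<tau>, x). indicator {0<..<t} \<tau> * hconv (h (t - \<tau>)) (F \<tau>) x) \<in> borel_measurable (borel \<Otimes>\<^sub>M borel)"
      by (rule duhamel_integrand_measurable[OF F t])
    show "set_integrable lborel {0<..<t} (\<lambda>\<tau>. C * b \<tau>)" using bi by (rule set_integrable_mult_right)
    fix \<tau> assume \<tau>: "0 < \<tau>" "\<tau> < t"
    note F\<tau> = admissibleD(1,2)[OF F \<tau>(1) less_le_trans[OF \<tau>(2) t]]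
    show "0 < C * b \<tau>" using C b(2)[OF \<tau>] by simp
    show "Lq_bound q (hconv (h (t - \<tau>)) (F \<tau>)) (C * b \<tau>)"
      using \<tau> t by (intro Lq_bound_hconv_kernel[OF q _ F\<tau>(2) b(1)] C(2)) auto
    show "\<bar>hconv (h (t - \<tau>)) (F \<tau>) x\<bar> \<le> C * K" for x
      by (rule duhamel_integrand_bound[OF F t C(2) \<tau> F\<tau>(2)])
  qed
  then show ?thesis unfolding duhamel_def[abs_def] by simp
qed

lemma duhamel_Lq_continuous:
  assumes q: "1 \<le> q" and F: "admissible T K F" and A: "\<And>\<tau>. 0 < \<tau> \<Longrightarrow> \<tau> < T \<Longrightarrow> Lq_bound q (F \<tau>) A"
    and e: "0 < e" and t: "t \<in> {0..T}"
  shows "\<forall>\<^sub>F \<tau> in at t within {0..T}. Lq_bound q (\<lambda>x. duhamel F \<tau> x - duhamel F t x) e"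
proof -
  obtain \<delta> where \<delta>: "0 < \<delta>"
    "\<And>a b. 0 \<le> a \<Longrightarrow> a \<le> b \<Longrightarrow> b \<le> T \<Longrightarrow> b - a \<le> \<delta> \<Longrightarrow> Lq_bound q (\<lambda>x. duhamel F b x - duhamel F a x) e"
    using duhamel_Lq_modulus[OF q F A e] by blast
  show ?thesis
    using eventually_at_within_abs[OF \<delta>(1), of t "{0..T}"] eventually_in_within[of "{0..T}" t]
  proof eventually_elim
    case (elim \<tau>)
    show ?case
    proof (cases "t \<le> \<tau>")
      case True
      then show ?thesis using elim t by (intro \<delta>(2)) auto
    next
      case False
      then show ?thesis using elim t by (intro Lq_bound_minus_commute[OF \<delta>(2)]) auto
    qed
  qed
qed

text \<open>At positive times the kernel varies continuously in \<open>L^1\<close>, so Young's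
  inequality gives norm continuity for every \<open>q\<close>, the case
  \<open>q = \<infinity>\<close> included.\<close>

lemma semigroup_Lq_continuous:
  assumes q: "1 \<le> q" and g: "Lq_bound q g A" and M: "AE x in lborel. \<bar>g x\<bar> \<le> M"
    and t: "0 < t" and e: "0 < e"
  shows "\<forall>\<^sub>F \<tau> in at t within I. Lq_bound q (\<lambda>x. hconv (h \<tau>) g x - hconv (h t) g x) e"
proof -
  have gm: "g \<in> borel_measurable borel" using g by (rule Lq_bound_measurable)
  have A: "0 \<le> A" using g by (rule Lq_bound_nonneg)
  define r where "r = e / (A + 1)"
  have r: "0 < r" using A e by (simp add: r_def)
  have rA: "r * A \<le> e"
  proof -
    have "r * A \<le> r * (A + 1)" using r by simp
    also have "\<dots> = e" unfolding r_def using A by (intro divide_mult_cancel_pos) simp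
    finally show ?thesis .
  qed
  \<comment> \<open>The smaller of \<open>t\<close> and \<open>\<tau>\<close> serves as base time;
    the lower limit \<open>t / 2\<close> covers \<open>\<tau>\<close> on either side of
    \<open>t\<close>.\<close>
  obtain \<delta> where \<delta>: "0 < \<delta>"
    "\<And>\<sigma> d. t / 2 \<le> \<sigma> \<Longrightarrow> \<sigma> \<le> t \<Longrightarrow> 0 \<le> d \<Longrightarrow> d \<le> \<delta> \<Longrightarrow> L1_norm (\<lambda>x. h (\<sigma> + d) x - h \<sigma> x) \<le> r"
    using kernel_L1_modulus[of "t / 2" r t] t r by auto
  have "0 < min \<delta> (t / 2)" using \<delta> t by simp
  from eventually_at_within_abs[OF this, of t I] show ?thesis
  proof eventually_elim
    case (elim \<tau>)
    then have \<tau>: "0 < \<tau>" "t / 2 \<le> \<tau>" "\<bar>\<tau> - t\<bar> \<le> \<delta>" using t by linarith+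
    have L: "L1_norm (\<lambda>x. h \<tau> x - h t x) \<le> r"
    proof (cases "t \<le> \<tau>")
      case True
      then show ?thesis using \<delta>(2)[of t "\<tau> - t"] \<tau> t by simp
    next
      case False
      then have "L1_norm (\<lambda>x. h t x - h \<tau> x) \<le> r" using \<delta>(2)[of \<tau> "t - \<tau>"] \<tau> t by simp
      then show ?thesis by (subst L1_norm_minus_commute)
    qed
    have k: "integrable lborel (h \<tau>)" "integrable lborel (h t)" using \<tau> t by (auto intro: kernel_integrable)
    have "Lq_bound q (hconv (\<lambda>x. h \<tau> x - h t x) g) (L1_norm (\<lambda>x. h \<tau> x - h t x) * A)"
      using k by (intro Lq_bound_hconv[OF q _ M g] Bochner_Integration.integrable_diff)
    then have "Lq_bound q (hconv (\<lambda>x. h \<tau> x - h t x) g) e"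
      by (rule Lq_bound_mono) (use mult_right_mono[OF L A] rA in linarith)
    moreover have "hconv (\<lambda>x. h \<tau> x - h t x) g = (\<lambda>x. hconv (h \<tau>) g x - hconv (h t) g x)"
      by (rule ext) (rule hconv_diff_left[OF k gm M])
    ultimately show ?case by simp
  qed
qed

section \<open>Curves given by the Duhamel formula with an arbitrary admissible source\<close>

context
  fixes T K M :: real and F w :: "real \<Rightarrow> 'n heis \<Rightarrow> real" and u0 :: "'n heis \<Rightarrow> real"
  assumes T: "0 < T" and F: "admissible T K F"
    and wm: "\<And>t. t \<in> {0..T} \<Longrightarrow> w t \<in> borel_measurable borel"
    and u0m: "u0 \<in> borel_measurable borel" and u0b: "AE x in lborel. \<bar>u0 x\<bar> \<le> M"
    and w0: "AE x in lborel. w 0 x = u0 x"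
    and wt: "\<And>t. 0 < t \<Longrightarrow> t \<le> T \<Longrightarrow> AE x in lborel. w t x = hconv (h t) u0 x + duhamel F t x"
begin

text \<open>Here and below \<open>F\<close> is not tied to \<open>w\<close>, so the results serve
  both solutions and Picard iterates, whose source comes from the previous iterate.\<close>

lemma duhamel_form_Lq_bound:
  assumes q: "1 \<le> q" and u0: "Lq_bound q u0 A0" and A: "\<And>\<tau>. 0 < \<tau> \<Longrightarrow> \<tau> < T \<Longrightarrow> Lq_bound q (F \<tau>) A"
    and t: "t \<in> {0..T}"
  shows "\<exists>B. Lq_bound q (w t) B"
proof (cases "t = 0")
  case True
  then show ?thesis using Lq_bound_cong_AE[OF u0 wm[OF t]] w0 by auto
next
  case False
  then have t: "0 < t" "t \<le> T" using t by auto
  obtain C where C: "1 \<le> C" "\<And>t. 0 < t \<Longrightarrow> t \<le> T \<Longrightarrow> mass t \<le> C" using mass_bounded by blast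
  have 1: "Lq_bound q (hconv (h t) u0) (C * A0)"
    by (rule Lq_bound_hconv_kernel[OF q t(1) u0b u0 C(2)[OF t]])
  have "Lq_bound q (duhamel F t) (C * (LINT \<tau>:{0<..<t}|lborel. \<bar>A\<bar> + 1))"
  proof (rule duhamel_Lq_bound[OF q F t(2) C])
    fix \<tau> assume "0 < \<tau>" "\<tau> < t"
    then show "Lq_bound q (F \<tau>) (\<bar>A\<bar> + 1)" using A[of \<tau>] t by (auto intro: Lq_bound_mono)
  qed (auto intro: set_integrable_const_Ioo)
  then show ?thesis
    using Lq_bound_cong_AE[OF Lq_bound_add[OF q 1] wm wt[OF t]] t by (intro exI) auto
qed

lemma duhamel_form_norm_continuous:
  assumes q: "1 \<le> q" and u0: "Lq_bound q u0 A0" and A: "\<And>\<tau>. 0 < \<tau> \<Longrightarrow> \<tau> < T \<Longrightarrow> Lq_bound q (F \<tau>) A"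
    and t: "0 < t" "t \<le> T"
  shows "norm_continuous q {0..T} w t"
proof -
  have "norm_continuous q {0..T} w t \<longleftrightarrow> (\<forall>e>0. \<forall>\<^sub>F \<tau> in at t within {0..T}. Lq_bound q (\<lambda>x. w \<tau> x - w t x) e)"
    using t by (intro norm_continuous_iff q wm) auto
  moreover have "\<forall>\<^sub>F \<tau> in at t within {0..T}. Lq_bound q (\<lambda>x. w \<tau> x - w t x) e" if e: "0 < e" for e
  proof -
    have e4: "0 < e / 4" using e by simp
    have "\<forall>\<^sub>F \<tau> in at t within {0..T}. Lq_bound q (\<lambda>x. duhamel F \<tau> x - duhamel F t x) (e / 4)"
      using t by (intro duhamel_Lq_continuous[OF q F A e4]) auto
    moreover have "0 < t / 2" using t by simp
    note eventually_at_within_abs[OF this, of t "{0..T}"] eventually_in_within[of "{0..T}" t]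
      semigroup_Lq_continuous[OF q u0 u0b t(1) e4, of "{0..T}"]
    ultimately show ?thesis
    proof eventually_elim
      case (elim \<tau>)
      have "\<bar>\<tau> - t\<bar> \<le> t / 2" "\<tau> \<in> {0..T}" using elim by blast+
      then have \<tau>: "0 < \<tau>" "\<tau> \<le> T" using t by (simp_all, linarith)
      have "Lq_bound q (\<lambda>x. (hconv (h \<tau>) u0 x - hconv (h t) u0 x) + (duhamel F \<tau> x - duhamel F t x)) (2 * (e / 4 + e / 4))"
        using elim by (intro Lq_bound_add[OF q])
      then have "Lq_bound q (\<lambda>x. w \<tau> x - w t x) (2 * (e / 4 + e / 4))"
      proof (rule Lq_bound_cong_AE)
        show "(\<lambda>x. w \<tau> x - w t x) \<in> borel_measurable borel"
          using wm[of \<tau>] wm[of t] \<tau> t by (intro borel_measurable_diff) auto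
        show "AE x in lborel. w \<tau> x - w t x = (hconv (h \<tau>) u0 x - hconv (h t) u0 x) + (duhamel F \<tau> x - duhamel F t x)"
          using wt[OF \<tau>] wt[OF t] by eventually_elim simp
      qed
      then show ?case by simp
    qed
  qed
  ultimately show ?thesis by blast
qed

text \<open>The Duhamel term is norm continuous at 0 in any case, so everything depends on the
  semigroup acting on the datum. Its continuity \<open>S\<close> comes from
  \<open>Lq_at_zero\<close> for finite \<open>q\<close> and is a property of \<open>u0\<close> for
  \<open>q = \<infinity>\<close>.\<close>

lemma duhamel_form_norm_continuous_zero:
  assumes q: "1 \<le> q" and A: "\<And>\<tau>. 0 < \<tau> \<Longrightarrow> \<tau> < T \<Longrightarrow> Lq_bound q (F \<tau>) A"
    and S: "\<And>e. 0 < e \<Longrightarrow> \<forall>\<^sub>F t in at_right 0. Lq_bound q (\<lambda>x. hconv (h t) u0 x - u0 x) e"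
  shows "norm_continuous q {0..T} w 0"
proof -
  have "norm_continuous q {0..T} w 0 \<longleftrightarrow> (\<forall>e>0. \<forall>\<^sub>F \<tau> in at 0 within {0..T}. Lq_bound q (\<lambda>x. w \<tau> x - w 0 x) e)"
    using T by (intro norm_continuous_iff q wm) auto
  moreover have "\<forall>\<^sub>F \<tau> in at 0 within {0..T}. Lq_bound q (\<lambda>x. w \<tau> x - w 0 x) e" if e: "0 < e" for e
  proof -
    have e4: "0 < e / 4" using e by simp
    have "\<forall>\<^sub>F \<tau> in at 0 within {0..T}. Lq_bound q (\<lambda>x. duhamel F \<tau> x - duhamel F 0 x) (e / 4)"
      using T by (intro duhamel_Lq_continuous[OF q F A e4]) auto
    moreover have "\<forall>\<^sub>F \<tau> in at 0 within {0..T}. \<tau> \<in> {0<..T}"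
      unfolding eventually_at_filter by auto
    moreover have "\<forall>\<^sub>F \<tau> in at 0 within {0..T}. Lq_bound q (\<lambda>x. hconv (h \<tau>) u0 x - u0 x) (e / 4)"
      using S[OF e4] unfolding at_within_Icc_at_right[OF T] .
    ultimately show ?thesis
    proof eventually_elim
      case (elim \<tau>)
      then have \<tau>: "0 < \<tau>" "\<tau> \<le> T" by auto
      have "Lq_bound q (\<lambda>x. (hconv (h \<tau>) u0 x - u0 x) + (duhamel F \<tau> x - duhamel F 0 x)) (2 * (e / 4 + e / 4))"
        using elim by (intro Lq_bound_add[OF q])
      then have "Lq_bound q (\<lambda>x. w \<tau> x - w 0 x) (2 * (e / 4 + e / 4))"
      proof (rule Lq_bound_cong_AE)
        show "(\<lambda>x. w \<tau> x - w 0 x) \<in> borel_measurable borel"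
          using wm[of \<tau>] wm[of 0] \<tau> T by (intro borel_measurable_diff) auto
        show "AE x in lborel. w \<tau> x - w 0 x = (hconv (h \<tau>) u0 x - u0 x) + (duhamel F \<tau> x - duhamel F 0 x)"
          using wt[OF \<tau>] w0 by eventually_elim simp
      qed
      then show ?case by simp
    qed
  qed
  ultimately show ?thesis by blast
qed

text \<open>The semigroup part converges weak-*, and the Duhamel term at time \<open>\<tau>\<close>
  is at most a multiple of \<open>\<tau>\<close> uniformly in space.\<close>

lemma duhamel_form_weak_zero:
  assumes g: "integrable lborel g"
  shows "((\<lambda>\<tau>. LINT x|lborel. w \<tau> x * g x) \<longlongrightarrow> (LINT x|lborel. u0 x * g x)) (at 0 within {0..T})"
proof -
  obtain C where C: "1 \<le> C" "\<And>t. 0 < t \<Longrightarrow> t \<le> T \<Longrightarrow> mass t \<le> C" using mass_bounded by blast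
  have gm: "g \<in> borel_measurable borel" using g by auto
  have l1: "((\<lambda>\<tau>. LINT x|lborel. hconv (h \<tau>) u0 x * g x) \<longlongrightarrow> (LINT x|lborel. u0 x * g x)) (at 0 within {0..T})"
    unfolding at_within_Icc_at_right[OF T] by (rule weak_star_at_zero[OF u0m u0b g])
  have "((\<lambda>\<tau>. (LINT x|lborel. w \<tau> x * g x) - (LINT x|lborel. hconv (h \<tau>) u0 x * g x)) \<longlongrightarrow> 0) (at 0 within {0..T})"
  proof (rule Lim_null_comparison)
    have "((\<lambda>\<tau>. C * (K * \<tau>) * L1_norm g) \<longlongrightarrow> C * (K * 0) * L1_norm g) (at 0 within {0..T})"
      by (intro tendsto_intros)
    then show "((\<lambda>\<tau>. C * (K * \<tau>) * L1_norm g) \<longlongrightarrow> 0) (at 0 within {0..T})" by simp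
    have "\<forall>\<^sub>F \<tau> in at 0 within {0..T}. \<tau> \<in> {0<..T}"
      unfolding eventually_at_filter by auto
    then show "\<forall>\<^sub>F \<tau> in at 0 within {0..T}. norm ((LINT x|lborel. w \<tau> x * g x) - (LINT x|lborel. hconv (h \<tau>) u0 x * g x)) \<le> C * (K * \<tau>) * L1_norm g"
    proof eventually_elim
      case (elim \<tau>)
      then have \<tau>: "0 < \<tau>" "\<tau> \<le> T" by auto
      have wmt: "w \<tau> \<in> borel_measurable borel" using \<tau> by (intro wm) auto
      have Hm: "hconv (h \<tau>) u0 \<in> borel_measurable borel"
        using \<tau> u0m by (intro measurable_hconv kernel_measurable)
      have Db: "\<bar>duhamel F \<tau> x\<bar> \<le> C * (K * \<tau>)" for x
        using \<tau> by (intro duhamel_bound_const[OF F _ _ C(2)] admissibleD(2)[OF F]) auto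
      have Sb: "\<bar>hconv (h \<tau>) u0 x\<bar> \<le> mass \<tau> * M" for x
        by (rule hconv_kernel_bound[OF \<tau>(1) u0m u0b])
      have iS: "integrable lborel (\<lambda>x. hconv (h \<tau>) u0 x * g x)"
      proof (rule Bochner_Integration.integrable_bound)
        show "integrable lborel (\<lambda>x. (mass \<tau> * M) * g x)" using g by (rule integrable_mult_right)
        show "AE x in lborel. norm (hconv (h \<tau>) u0 x * g x) \<le> norm ((mass \<tau> * M) * g x)"
          unfolding real_norm_def abs_mult[of _ "g x" for x]
          by (intro AE_I2 mult_right_mono order_trans[OF Sb abs_ge_self]) simp
      qed (use Hm gm in measurable)
      have iD: "integrable lborel (\<lambda>x. duhamel F \<tau> x * g x)"
      proof (rule Bochner_Integration.integrable_bound)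
        show "integrable lborel (\<lambda>x. (C * (K * \<tau>)) * g x)" using g by (rule integrable_mult_right)
        show "AE x in lborel. norm (duhamel F \<tau> x * g x) \<le> norm ((C * (K * \<tau>)) * g x)"
          unfolding real_norm_def abs_mult[of _ "g x" for x]
          by (intro AE_I2 mult_right_mono order_trans[OF Db abs_ge_self]) simp
      qed (use duhamel_measurable[OF F \<tau>(2)] gm in measurable)
      have "(LINT x|lborel. w \<tau> x * g x) = (LINT x|lborel. hconv (h \<tau>) u0 x * g x + duhamel F \<tau> x * g x)"
      proof (rule integral_cong_AE)
        show "AE x in lborel. w \<tau> x * g x = hconv (h \<tau>) u0 x * g x + duhamel F \<tau> x * g x"
          using wt[OF \<tau>] by eventually_elim (simp add: distrib_right)
      qed (use wmt gm Hm duhamel_measurable[OF F \<tau>(2)] in measurable)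
      also have "\<dots> = (LINT x|lborel. hconv (h \<tau>) u0 x * g x) + (LINT x|lborel. duhamel F \<tau> x * g x)"
        by (rule Bochner_Integration.integral_add[OF iS iD])
      finally have "norm ((LINT x|lborel. w \<tau> x * g x) - (LINT x|lborel. hconv (h \<tau>) u0 x * g x)) = \<bar>LINT x|lborel. duhamel F \<tau> x * g x\<bar>"
        by simp
      also have "\<dots> \<le> (LINT x|lborel. \<bar>duhamel F \<tau> x * g x\<bar>)" by (rule integral_abs_bound)
      also have "\<dots> \<le> (LINT x|lborel. (C * (K * \<tau>)) * \<bar>g x\<bar>)"
      proof (rule integral_mono)
        show "integrable lborel (\<lambda>x. \<bar>duhamel F \<tau> x * g x\<bar>)" using iD by (rule integrable_abs)
        show "integrable lborel (\<lambda>x. (C * (K * \<tau>)) * \<bar>g x\<bar>)" using g by (intro integrable_mult_right integrable_abs)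
        show "\<bar>duhamel F \<tau> x * g x\<bar> \<le> (C * (K * \<tau>)) * \<bar>g x\<bar>" for x
          unfolding abs_mult by (intro mult_right_mono Db) simp
      qed
      also have "\<dots> = C * (K * \<tau>) * L1_norm g" by (simp add: L1_norm_def)
      finally show ?case .
    qed
  qed
  from tendsto_add[OF this l1] show ?thesis by simp
qed

lemma duhamel_form_C_Lq:
  assumes q: "1 \<le> q" "q \<noteq> \<infinity>" and u0: "Lq_bound q u0 A0" and A: "\<And>\<tau>. 0 < \<tau> \<Longrightarrow> \<tau> < T \<Longrightarrow> Lq_bound q (F \<tau>) A"
  shows "w \<in> C_Lq q {0..T}"
proof -
  have "w t \<in> Lq q \<and> norm_continuous q {0..T} w t" if t: "t \<in> {0..T}" for t
  proof
    show "w t \<in> Lq q" using duhamel_form_Lq_bound[OF q(1) u0 A t] Lq_bound_imp_Lq[OF q(1)] by blast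
    show "norm_continuous q {0..T} w t"
    proof (cases "t = 0")
      case True
      then show ?thesis
        using duhamel_form_norm_continuous_zero[OF q(1) A] Lq_at_zero[OF q u0b u0] by simp
    next
      case False
      then show ?thesis using t by (intro duhamel_form_norm_continuous[OF q(1) u0 A]) auto
    qed
  qed
  then show ?thesis using q by (auto simp: C_Lq_def)
qed

lemma duhamel_form_C_Linf: "w \<in> C_Lq \<infinity> {0..T}"
proof -
  have u0i: "Lq_bound \<infinity> u0 M" using u0m u0b Lq_bound_infinity by blast
  have Fi: "Lq_bound \<infinity> (F \<tau>) K" if "0 < \<tau>" "\<tau> < T" for \<tau>
    using admissibleD(1,2)[OF F that] Lq_bound_infinity by blast
  have "w t \<in> Lq \<infinity> \<and> (if t = 0 then weak_star_continuous {0..T} w t else norm_continuous \<infinity> {0..T} w t)"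
    if t: "t \<in> {0..T}" for t
  proof
    show "w t \<in> Lq \<infinity>"
      using duhamel_form_Lq_bound[OF one_le_infinity_ennreal u0i Fi t] Lq_bound_imp_Lq[OF one_le_infinity_ennreal] by blast
    show "if t = 0 then weak_star_continuous {0..T} w t else norm_continuous \<infinity> {0..T} w t"
    proof (cases "t = 0")
      case True
      have "((\<lambda>\<tau>. LINT x|lborel. w \<tau> x * g x) \<longlongrightarrow> (LINT x|lborel. w 0 x * g x)) (at 0 within {0..T})"
        if g: "integrable lborel g" for g
      proof -
        have "(LINT x|lborel. w 0 x * g x) = (LINT x|lborel. u0 x * g x)"
        proof (rule integral_cong_AE)
          show "AE x in lborel. w 0 x * g x = u0 x * g x" using w0 by eventually_elim simp
          show "(\<lambda>x. w 0 x * g x) \<in> borel_measurable lborel" "(\<lambda>x. u0 x * g x) \<in> borel_measurable lborel"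
            using wm[of 0] T u0m g by auto
        qed
        then show ?thesis using duhamel_form_weak_zero[OF g] by simp
      qed
      then show ?thesis using True by (simp add: weak_star_continuous_def Lq_1_iff)
    next
      case False
      then have "norm_continuous \<infinity> {0..T} w t"
        using t by (intro duhamel_form_norm_continuous[OF one_le_infinity_ennreal u0i Fi]) auto
      then show ?thesis unfolding if_not_P[OF False] .
    qed
  qed
  then show ?thesis unfolding C_Lq_def by (simp only: mem_Collect_eq simp_thms) blast
qed

end

end

section \<open>Mild solutions: uniqueness\<close>

text \<open>The tangent inequality at the larger of the two absolute values gives a one-sided bound;
  exchanging the roles gives the other side.\<close>

lemma powr_lipschitz:
  fixes a b K p :: real
  assumes p: "1 < p" and a: "\<bar>a\<bar> \<le> K" and b: "\<bar>b\<bar> \<le> K"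
  shows "\<bar>\<bar>a\<bar> powr p - \<bar>b\<bar> powr p\<bar> \<le> p * K powr (p - 1) * \<bar>a - b\<bar>"
proof -
  have *: "\<bar>y\<bar> powr p - \<bar>x\<bar> powr p \<le> p * K powr (p - 1) * \<bar>a - b\<bar>"
    if y: "\<bar>y\<bar> \<le> K" and xy: "\<bar>\<bar>y\<bar> - \<bar>x\<bar>\<bar> \<le> \<bar>a - b\<bar>" for x y
  proof (cases "\<bar>x\<bar> \<le> \<bar>y\<bar>")
    case True
    have "p * \<bar>y\<bar> powr (p - 1) * \<bar>x\<bar> \<le> \<bar>x\<bar> powr p + (p - 1) * \<bar>y\<bar> powr p"
      using p by (intro powr_tangent_le) auto
    moreover have "\<bar>y\<bar> powr p = \<bar>y\<bar> powr (p - 1) * \<bar>y\<bar>"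
      by (cases "y = 0") (auto simp: powr_diff)
    ultimately have "\<bar>y\<bar> powr p - \<bar>x\<bar> powr p \<le> p * \<bar>y\<bar> powr (p - 1) * (\<bar>y\<bar> - \<bar>x\<bar>)"
      by (simp add: algebra_simps)
    also have "\<dots> \<le> p * K powr (p - 1) * \<bar>a - b\<bar>"
      using p y xy True by (intro mult_mono powr_mono2 mult_nonneg_nonneg) auto
    finally show ?thesis .
  next
    case False
    then have "\<bar>y\<bar> powr p \<le> \<bar>x\<bar> powr p" using p by (intro powr_mono2) auto
    moreover have "0 \<le> p * K powr (p - 1) * \<bar>a - b\<bar>" using p by simp
    ultimately show ?thesis by linarith
  qed
  show ?thesis using *[of a b] *[of b a] a b by (simp add: abs_le_iff) linarith
qed

lemma set_integral_power_Ioo: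
  assumes "0 \<le> (t::real)"
  shows "set_integrable lborel {0<..<t} (\<lambda>x. x ^ n)"
    and "(LINT x:{0<..<t}|lborel. x ^ n) = t ^ Suc n / real (Suc n)"
proof -
  show "set_integrable lborel {0<..<t} (\<lambda>x. x ^ n)"
    unfolding set_integrable_def
  proof (rule Bochner_Integration.integrable_bound)
    show "integrable lborel (\<lambda>x. t ^ n * indicator {0<..<t} x)"
      by (intro integrable_mult_right integrable_indicator_bounded) auto
    show "AE x in lborel. norm (indicator {0<..<t} x *\<^sub>R x ^ n) \<le> norm (t ^ n * indicator {0<..<t} x)"
    proof (rule AE_I2)
      fix x show "norm (indicator {0<..<t} x *\<^sub>R x ^ n) \<le> norm (t ^ n * indicator {0<..<t} x)"
        using power_mono[of x t n] by (cases "x \<in> {0<..<t}") auto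
    qed
  qed simp
  have "(LINT x:{0<..<t}|lborel. x ^ n) = (LINT x|lborel. x ^ n * indicator {0..t} x)"
    unfolding set_lebesgue_integral_def
  proof (rule integral_cong_AE)
    show "AE x in lborel. indicator {0<..<t} x *\<^sub>R x ^ n = x ^ n * indicator {0..t} x"
      using AE_lborel_singleton[of 0] AE_lborel_singleton[of t] by eventually_elim (auto simp: indicator_def)
  qed auto
  also have "\<dots> = t ^ Suc n / real (Suc n)" using assms by (subst integral_power) auto
  finally show "(LINT x:{0<..<t}|lborel. x ^ n) = t ^ Suc n / real (Suc n)" .
qed

text \<open>Geometric increments are summable, and the error after \<open>n\<close> steps is the
  tail of the telescoping series. This provides Picard limits point by point.\<close>

lemma geometric_Cauchy_limit:
  fixes y :: "nat \<Rightarrow> real"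
  assumes "\<And>n. \<bar>y (Suc n) - y n\<bar> \<le> R * (1 / 2) ^ n"
  shows "\<exists>l. \<forall>n. \<bar>l - y n\<bar> \<le> 2 * R * (1 / 2) ^ n"
proof -
  let ?d = "\<lambda>n. y (Suc n) - y n"
  have g: "summable (\<lambda>n. R * (1 / 2) ^ n)" by (intro summable_mult summable_geometric) simp
  have s: "summable ?d" by (rule summable_comparison_test[OF _ g]) (use assms in auto)
  have sn: "summable (\<lambda>n. norm (?d n))" by (rule summable_comparison_test[OF _ g]) (use assms in auto)
  have "\<bar>(y 0 + suminf ?d) - y m\<bar> \<le> 2 * R * (1 / 2) ^ m" for m
  proof -
    have "(y 0 + suminf ?d) - y m = (\<Sum>n. ?d (n + m))"
      using suminf_minus_initial_segment[OF s, of m] by (simp add: sum_lessThan_telescope)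
    also have "\<bar>\<dots>\<bar> \<le> (\<Sum>n. norm (?d (n + m)))"
      using summable_norm[of "\<lambda>n. ?d (n + m)"] sn summable_iff_shift[of "\<lambda>n. norm (?d n)" m] by simp
    also have "\<dots> \<le> (\<Sum>n. R * (1 / 2) ^ m * (1 / 2) ^ n)"
    proof (rule suminf_le)
      show "summable (\<lambda>n. norm (?d (n + m)))" using sn by (subst summable_iff_shift[of "\<lambda>n. norm (?d n)"])
      show "summable (\<lambda>n. R * (1 / 2) ^ m * (1 / 2) ^ n)" by (intro summable_mult summable_geometric) simp
      show "norm (?d (n + m)) \<le> R * (1 / 2) ^ m * (1 / 2) ^ n" for n
        using assms[of "n + m"] by (simp add: power_add mult_ac)
    qed
    also have "\<dots> = 2 * R * (1 / 2) ^ m" by (subst suminf_mult) (auto simp: suminf_geometric)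
    finally show ?thesis .
  qed
  then show ?thesis by blast
qed

lemma admissible_zero: "0 \<le> K \<Longrightarrow> admissible T K (\<lambda>_ _. 0)"
  by (simp add: admissible_def)

lemma C_Lq_norm_continuous:
  "u \<in> C_Lq q I \<Longrightarrow> t \<in> I \<Longrightarrow> \<not> (q = \<infinity> \<and> t = 0) \<Longrightarrow> norm_continuous q I u t"
  by (auto simp: C_Lq_def)

lemma C_Linf_left_continuous:
  assumes u: "u \<in> C_Lq \<infinity> {0..T}" and \<tau>: "0 < \<tau>" "\<tau> \<le> T" and e: "0 < e"
  shows "\<forall>\<^sub>F \<sigma> in at_left \<tau>. AE x in lborel. \<bar>u \<sigma> x - u \<tau> x\<bar> \<le> e"
proof -
  have "norm_continuous \<infinity> {0..T} u \<tau>" using \<tau> by (intro C_Lq_norm_continuous[OF u]) auto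
  moreover have "norm_continuous \<infinity> {0..T} u \<tau> \<longleftrightarrow>
      (\<forall>e>0. \<forall>\<^sub>F \<sigma> in at \<tau> within {0..T}. Lq_bound \<infinity> (\<lambda>x. u \<sigma> x - u \<tau> x) e)"
    using \<tau> by (intro norm_continuous_iff one_le_infinity_ennreal C_Lq_measurable[OF u]) auto
  ultimately have "\<forall>\<^sub>F \<sigma> in at \<tau> within {0..T}. Lq_bound \<infinity> (\<lambda>x. u \<sigma> x - u \<tau> x) e"
    using e by blast
  then obtain d where d: "0 < d" "\<And>\<sigma>. \<sigma> \<in> {0..T} \<Longrightarrow> \<sigma> \<noteq> \<tau> \<Longrightarrow> dist \<sigma> \<tau> < d \<Longrightarrow> Lq_bound \<infinity> (\<lambda>x. u \<sigma> x - u \<tau> x) e"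
    unfolding eventually_at by blast
  show ?thesis
    unfolding eventually_at_left_field
  proof (intro exI[of _ "max 0 (\<tau> - d)"] conjI allI impI)
    show "max 0 (\<tau> - d) < \<tau>" using \<tau> d by simp
    fix \<sigma> assume "max 0 (\<tau> - d) < \<sigma>" "\<sigma> < \<tau>"
    then have "Lq_bound \<infinity> (\<lambda>x. u \<sigma> x - u \<tau> x) e" using \<tau> by (intro d(2)) (auto simp: dist_real_def)
    then show "AE x in lborel. \<bar>u \<sigma> x - u \<tau> x\<bar> \<le> e" by (simp add: Lq_bound_def)
  qed
qed

lemma C_Linf_admissible:
  assumes u: "u \<in> C_Lq \<infinity> {0..T}" and K: "\<And>t. 0 < t \<Longrightarrow> t < T \<Longrightarrow> AE x in lborel. \<bar>u t x\<bar> \<le> K"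
  shows "admissible T K u"
  unfolding admissible_def
  using C_Lq_measurable[OF u] K C_Linf_left_continuous[OF u] by auto

text \<open>Left continuity passes to uniform limits by splitting \<open>e\<close> into three. The
  bound \<open>K\<close> is kept exactly, by letting the error run through
  \<open>1 / real (Suc n)\<close> outside a single null set.\<close>

lemma admissible_uniform_limit:
  assumes wm: "\<And>\<tau>. 0 < \<tau> \<Longrightarrow> \<tau> < T \<Longrightarrow> w \<tau> \<in> borel_measurable borel"
    and lim: "\<And>e. 0 < e \<Longrightarrow> \<exists>V. admissible T K V \<and> (\<forall>\<tau>. 0 < \<tau> \<longrightarrow> \<tau> < T \<longrightarrow> (AE x in lborel. \<bar>w \<tau> x - V \<tau> x\<bar> \<le> e))"
  shows "admissible T K w"
  unfolding admissible_def
proof (intro ballI conjI allI impI)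
  fix \<tau> assume "\<tau> \<in> {0<..<T}"
  then have \<tau>: "0 < \<tau>" "\<tau> < T" by auto
  show "w \<tau> \<in> borel_measurable borel" using wm \<tau> by blast
  have b: "AE x in lborel. \<bar>w \<tau> x\<bar> \<le> K + e" if e: "0 < e" for e
  proof -
    obtain V where V: "admissible T K V" "\<And>\<tau>. 0 < \<tau> \<Longrightarrow> \<tau> < T \<Longrightarrow> AE x in lborel. \<bar>w \<tau> x - V \<tau> x\<bar> \<le> e"
      using lim[OF e] by blast
    show ?thesis using V(2)[OF \<tau>] admissibleD(2)[OF V(1) \<tau>] by eventually_elim linarith
  qed
  have "AE x in lborel. \<forall>n::nat. \<bar>w \<tau> x\<bar> \<le> K + 1 / real (Suc n)"
    unfolding AE_all_countable using b by simp
  then show "AE x in lborel. \<bar>w \<tau> x\<bar> \<le> K"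
  proof eventually_elim
    case (elim x)
    have "(\<lambda>n. K + 1 / real (Suc n)) \<longlonglongrightarrow> K + 0"
      by (intro tendsto_add tendsto_const LIMSEQ_Suc[OF lim_1_over_n])
    then have "(\<lambda>n. K + 1 / real (Suc n)) \<longlonglongrightarrow> K" by (simp only: add_0_right)
    then show ?case using elim by (intro LIMSEQ_le_const[of _ K]) auto
  qed
  fix e :: real assume "0 < e"
  then have e3: "0 < e / 3" by simp
  obtain V where V: "admissible T K V" "\<And>\<tau>. 0 < \<tau> \<Longrightarrow> \<tau> < T \<Longrightarrow> AE x in lborel. \<bar>w \<tau> x - V \<tau> x\<bar> \<le> e / 3"
    using lim[OF e3] by blast
  show "\<forall>\<^sub>F \<sigma> in at_left \<tau>. AE x in lborel. \<bar>w \<sigma> x - w \<tau> x\<bar> \<le> e"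
    using admissibleD(3)[OF V(1) \<tau> e3] eventually_at_left_Ioo[OF \<tau>(1)]
  proof eventually_elim
    case (elim \<sigma>)
    then have \<sigma>: "0 < \<sigma>" "\<sigma> < T" using \<tau> by auto
    show ?case using elim(1) V(2)[OF \<tau>] V(2)[OF \<sigma>] by eventually_elim (simp only: abs_le_iff, linarith)
  qed
qed

section \<open>The reaction term and properties of mild solutions\<close>

locale fujita = heis_semigroup h for h :: "real \<Rightarrow> 'n::finite heis \<Rightarrow> real" +
  fixes p Mf :: real and f :: "'n heis \<Rightarrow> real"
  assumes exponent: "1 < p" and source_measurable: "f \<in> borel_measurable borel"
    and source_bounded: "AE x in lborel. \<bar>f x\<bar> \<le> Mf"
begin

definition reaction :: "(real \<Rightarrow> 'n heis \<Rightarrow> real) \<Rightarrow> real \<Rightarrow> 'n heis \<Rightarrow> real" where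
  "reaction u \<tau> x = \<bar>u \<tau> x\<bar> powr p + f x"

text \<open>A Lipschitz constant of \<open>\<bar>x\<bar> powr p\<close> on the interval from
  \<open>- K\<close> to \<open>K\<close>.\<close>

definition lip :: "real \<Rightarrow> real" where "lip K = p * K powr (p - 1)"

lemma lip_nonneg: "0 \<le> lip K" using exponent by (simp add: lip_def)

lemma reaction_measurable:
  assumes [measurable]: "u \<tau> \<in> borel_measurable borel"
  shows "reaction u \<tau> \<in> borel_measurable borel"
proof -
  note [measurable] = source_measurable
  show ?thesis unfolding reaction_def[abs_def] by measurable
qed

lemma reaction_bound:
  assumes "AE x in lborel. \<bar>u \<tau> x\<bar> \<le> K" shows "AE x in lborel. \<bar>reaction u \<tau> x\<bar> \<le> K powr p + Mf"
  using assms source_bounded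
proof eventually_elim
  case (elim x)
  have "\<bar>u \<tau> x\<bar> powr p \<le> K powr p" using elim exponent by (intro powr_mono2) auto
  moreover have "0 \<le> \<bar>u \<tau> x\<bar> powr p" by simp
  ultimately show ?case using elim(2) unfolding reaction_def by linarith
qed

lemma reaction_lipschitz:
  assumes "AE x in lborel. \<bar>u \<sigma> x\<bar> \<le> K" "AE x in lborel. \<bar>v \<tau> x\<bar> \<le> K" "AE x in lborel. \<bar>u \<sigma> x - v \<tau> x\<bar> \<le> d"
  shows "AE x in lborel. \<bar>reaction u \<sigma> x - reaction v \<tau> x\<bar> \<le> lip K * d"
  using assms
proof eventually_elim
  case (elim x)
  have "\<bar>reaction u \<sigma> x - reaction v \<tau> x\<bar> \<le> lip K * \<bar>u \<sigma> x - v \<tau> x\<bar>"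
    using powr_lipschitz[OF exponent elim(1,2)] by (simp add: reaction_def lip_def)
  also have "\<dots> \<le> lip K * d" using elim(3) lip_nonneg by (rule mult_left_mono)
  finally show ?case .
qed

lemma reaction_admissible:
  assumes u: "admissible T K u"
  shows "admissible T (K powr p + Mf) (reaction u)"
  unfolding admissible_def
proof (intro ballI conjI allI impI)
  fix \<tau> assume "\<tau> \<in> {0<..<T}"
  then have \<tau>: "0 < \<tau>" "\<tau> < T" by auto
  note u\<tau> = admissibleD(1,2)[OF u \<tau>]
  show "reaction u \<tau> \<in> borel_measurable borel" using u\<tau>(1) by (rule reaction_measurable)
  show "AE x in lborel. \<bar>reaction u \<tau> x\<bar> \<le> K powr p + Mf" using u\<tau>(2) by (rule reaction_bound)
  fix e :: real assume e: "0 < e"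
  define e' where "e' = e / (lip K + 1)"
  have e': "0 < e'" using e lip_nonneg[of K] by (simp add: e'_def)
  have le: "lip K * e' \<le> e"
  proof -
    have "lip K * e' \<le> e' * (lip K + 1)" using e' by (simp add: distrib_left mult.commute)
    also have "\<dots> = e" unfolding e'_def using lip_nonneg[of K] by (intro divide_mult_cancel_pos) simp
    finally show ?thesis .
  qed
  show "\<forall>\<^sub>F \<sigma> in at_left \<tau>. AE x in lborel. \<bar>reaction u \<sigma> x - reaction u \<tau> x\<bar> \<le> e"
    using admissibleD(3)[OF u \<tau> e'] eventually_at_left_Ioo[OF \<tau>(1)]
  proof eventually_elim
    case (elim \<sigma>)
    have "AE x in lborel. \<bar>u \<sigma> x\<bar> \<le> K" using elim \<tau> by (intro admissibleD(2)[OF u]) auto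
    from reaction_lipschitz[of u \<sigma> K u \<tau>, OF this u\<tau>(2) elim(1)] show ?case
      by eventually_elim (use le in linarith)
  qed
qed

lemma mild_solution_iff:
  "mild_solution h p u0 f T u \<longleftrightarrow> u \<in> C_Lq \<infinity> {0..T} \<and>
    (\<forall>t\<in>{0<..T}. AE x in lborel. u t x = hconv (h t) u0 x + duhamel (reaction u) t x)"
  unfolding mild_solution_def duhamel_def heat_op_eq_hconv reaction_def[abs_def] by simp

lemma mild_solution_C_Lq: "mild_solution h p u0 f T u \<Longrightarrow> u \<in> C_Lq \<infinity> {0..T}"
  and mild_solution_eq: "mild_solution h p u0 f T u \<Longrightarrow> 0 < t \<Longrightarrow> t \<le> T \<Longrightarrow>
    AE x in lborel. u t x = hconv (h t) u0 x + duhamel (reaction u) t x"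
  by (auto simp: mild_solution_iff)

lemma mild_solution_measurable: "mild_solution h p u0 f T u \<Longrightarrow> t \<in> {0..T} \<Longrightarrow> u t \<in> borel_measurable borel"
  using mild_solution_C_Lq by (rule C_Lq_measurable)

lemma mild_solution_bounded:
  assumes "mild_solution h p u0 f T u"
  obtains K where "0 \<le> K" "\<And>t. t \<in> {0..T} \<Longrightarrow> AE x in lborel. \<bar>u t x\<bar> \<le> K" "admissible T K u"
proof -
  have u: "u \<in> C_Lq \<infinity> {0..T}" using assms by (rule mild_solution_C_Lq)
  obtain K where K: "\<And>t. t \<in> {0..T} \<Longrightarrow> AE x in lborel. \<bar>u t x\<bar> \<le> K"
    by (rule C_Linf_bounded[OF u]) (rule that)
  have K': "AE x in lborel. \<bar>u t x\<bar> \<le> \<bar>K\<bar>" if "t \<in> {0..T}" for t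
    using K[OF that] by eventually_elim linarith
  show ?thesis using K' C_Linf_admissible[OF u, of "\<bar>K\<bar>"] by (intro that[of "\<bar>K\<bar>"]) auto
qed

context
  fixes u0 :: "'n heis \<Rightarrow> real" and M :: real
  assumes u0m: "u0 \<in> borel_measurable borel" and u0b: "AE x in lborel. \<bar>u0 x\<bar> \<le> M"
begin

text \<open>Keeping \<open>F\<close> apart from \<open>reaction w\<close> allows the source to be a
  representative already known to be admissible, which agrees with the reaction only almost
  everywhere at each time.\<close>

lemma mild_solutionI:
  assumes "0 < T" "admissible T K F" "\<And>t. t \<in> {0..T} \<Longrightarrow> w t \<in> borel_measurable borel"
    and "AE x in lborel. w 0 x = u0 x"
    and "\<And>t. 0 < t \<Longrightarrow> t \<le> T \<Longrightarrow> AE x in lborel. w t x = hconv (h t) u0 x + duhamel F t x"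
    and F: "\<And>t. 0 < t \<Longrightarrow> t < T \<Longrightarrow> AE x in lborel. reaction w t x = F t x"
  shows "mild_solution h p u0 f T w"
proof -
  have "w \<in> C_Lq \<infinity> {0..T}"
    by (rule duhamel_form_C_Linf[OF assms(1-3) u0m u0b assms(4,5)])
  moreover have "duhamel (reaction w) t x = duhamel F t x" if "t \<le> T" for t x
    using that assms(3) F admissibleD(1)[OF assms(2)] by (intro duhamel_cong_AE) (auto intro!: reaction_measurable)
  ultimately show ?thesis using assms(5) by (auto simp: mild_solution_iff)
qed

text \<open>The integral equation is imposed for positive times only. The initial value is recovered
  by comparing two weak-* limits at 0: that of the right-hand side, which is \<open>u0\<close>, and
  that of \<open>u\<close>, which is \<open>u 0\<close>.\<close>

lemma mild_solution_zero:
  assumes u: "mild_solution h p u0 f T u" and T: "0 < T"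
  shows "AE x in lborel. u 0 x = u0 x"
proof -
  obtain K where K: "\<And>t. t \<in> {0..T} \<Longrightarrow> AE x in lborel. \<bar>u t x\<bar> \<le> K" "admissible T K u"
    using mild_solution_bounded[OF u] by blast
  \<comment> \<open>The curve is given the value \<open>u0\<close> at 0 so that
    \<open>duhamel_form_weak_zero\<close> applies; the limit at 0 does not see this change.\<close>
  define w where "w t = (if t = 0 then u0 else u t)" for t
  have nb: "at 0 within {0..T} \<noteq> bot" unfolding at_within_Icc_at_right[OF T] by simp
  show ?thesis
  proof (rule AE_eq_if_integrals_eq)
    show "u 0 \<in> borel_measurable borel" using mild_solution_measurable[OF u, of 0] T by simp
    show "u0 \<in> borel_measurable borel" by (rule u0m)
    have "AE x in lborel. \<bar>u 0 x\<bar> \<le> K" using K(1)[of 0] T by simp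
    then show "AE x in lborel. \<bar>u 0 x\<bar> \<le> max K M" by eventually_elim simp
    show "AE x in lborel. \<bar>u0 x\<bar> \<le> max K M" using u0b by eventually_elim simp
    fix g :: "'n heis \<Rightarrow> real" assume g: "integrable lborel g"
    have "((\<lambda>\<tau>. LINT x|lborel. w \<tau> x * g x) \<longlongrightarrow> (LINT x|lborel. u0 x * g x)) (at 0 within {0..T})"
    proof (rule duhamel_form_weak_zero[OF T reaction_admissible[OF K(2)] _ u0m u0b _ _ g])
      show "w t \<in> borel_measurable borel" if "t \<in> {0..T}" for t
        using that mild_solution_measurable[OF u that] u0m by (simp add: w_def)
      show "AE x in lborel. w 0 x = u0 x" by (simp add: w_def)
      show "AE x in lborel. w t x = hconv (h t) u0 x + duhamel (reaction u) t x" if "0 < t" "t \<le> T" for t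
        using mild_solution_eq[OF u that] that by (simp add: w_def)
    qed
    moreover have "\<forall>\<^sub>F \<tau> in at 0 within {0..T}. (LINT x|lborel. w \<tau> x * g x) = (LINT x|lborel. u \<tau> x * g x)"
      unfolding eventually_at_filter w_def by simp
    ultimately have "((\<lambda>\<tau>. LINT x|lborel. u \<tau> x * g x) \<longlongrightarrow> (LINT x|lborel. u0 x * g x)) (at 0 within {0..T})"
      by (rule Lim_transform_eventually)
    moreover have "((\<lambda>\<tau>. LINT x|lborel. u \<tau> x * g x) \<longlongrightarrow> (LINT x|lborel. u 0 x * g x)) (at 0 within {0..T})"
      using T by (intro norm_continuous_imp_weak[OF mild_solution_C_Lq[OF u] _ g]) simp
    ultimately show "(LINT x|lborel. u 0 x * g x) = (LINT x|lborel. u0 x * g x)"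
      by (intro tendsto_unique[OF nb])
  qed
qed

text \<open>Solutions may be modified on a null set separately at each time. The maximal solution
  needs this, as it takes its value at each time from an independently chosen solution.\<close>

lemma mild_solution_cong:
  assumes u: "mild_solution h p u0 f T u" and T: "0 < T'" "T' \<le> T"
    and v: "\<And>t. t \<in> {0..T'} \<Longrightarrow> v t \<in> borel_measurable borel \<and> (AE x in lborel. v t x = u t x)"
  shows "mild_solution h p u0 f T' v"
proof -
  obtain K where K: "admissible T K u" using mild_solution_bounded[OF u] by blast
  show ?thesis
  proof (rule mild_solutionI[OF T(1) admissible_subset[OF reaction_admissible[OF K] T(2)]])
    show "v t \<in> borel_measurable borel" if "t \<in> {0..T'}" for t using v that by blast
    have "AE x in lborel. u 0 x = u0 x" "AE x in lborel. v 0 x = u 0 x" using mild_solution_zero[OF u] v[of 0] T by auto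
    then show "AE x in lborel. v 0 x = u0 x" by eventually_elim simp
    fix t :: real assume t: "0 < t"
    show "AE x in lborel. v t x = hconv (h t) u0 x + duhamel (reaction u) t x" if "t \<le> T'"
    proof -
      have "AE x in lborel. v t x = u t x" using v that t by auto
      then show ?thesis using mild_solution_eq[OF u t order_trans[OF that T(2)]] by eventually_elim simp
    qed
    show "AE x in lborel. reaction v t x = reaction u t x" if "t < T'"
    proof -
      have "AE x in lborel. v t x = u t x" using v that t by auto
      then show ?thesis by eventually_elim (simp add: reaction_def)
    qed
  qed
qed

lemma mild_solution_restrict:
  assumes u: "mild_solution h p u0 f T u" and T: "0 < T'" "T' \<le> T"
  shows "mild_solution h p u0 f T' u"
  using mild_solution_measurable[OF u] T by (intro mild_solution_cong[OF u T]) auto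

text \<open>Each use of the integral inequality for the difference gains a factor
  \<open>a * t\<close> over the step number, so the bounds decay like the terms of an exponential
  series. The bounds are explicit in \<open>t\<close>, and no measurability of the norm of the
  difference in time enters.\<close>

lemma mild_solution_unique:
  assumes u: "mild_solution h p u0 f T u" and v: "mild_solution h p u0 f T v" and T: "0 < T" and t: "t \<in> {0..T}"
  shows "AE x in lborel. u t x = v t x"
proof (cases "t = 0")
  case True
  show ?thesis unfolding True using mild_solution_zero[OF u T] mild_solution_zero[OF v T] by eventually_elim simp
next
  case False
  then have t: "0 < t" "t \<le> T" using t by auto
  obtain Ku where Ku: "0 \<le> Ku" "\<And>t. t \<in> {0..T} \<Longrightarrow> AE x in lborel. \<bar>u t x\<bar> \<le> Ku" "admissible T Ku u"
    using mild_solution_bounded[OF u] by blast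
  obtain Kv where Kv: "0 \<le> Kv" "\<And>t. t \<in> {0..T} \<Longrightarrow> AE x in lborel. \<bar>v t x\<bar> \<le> Kv" "admissible T Kv v"
    using mild_solution_bounded[OF v] by blast
  define K where "K = max Ku Kv"
  have K: "0 \<le> K" using Ku by (simp add: K_def)
  have bu: "AE x in lborel. \<bar>u t x\<bar> \<le> K" if "t \<in> {0..T}" for t
    using Ku(2)[OF that] by eventually_elim (simp add: K_def)
  have bv: "AE x in lborel. \<bar>v t x\<bar> \<le> K" if "t \<in> {0..T}" for t
    using Kv(2)[OF that] by eventually_elim (simp add: K_def)
  obtain C where C: "1 \<le> C" "\<And>t. 0 < t \<Longrightarrow> t \<le> T \<Longrightarrow> mass t \<le> C" using mass_bounded by blast
  define a where "a = C * lip K"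
  note au = reaction_admissible[OF Ku(3)] and av = reaction_admissible[OF Kv(3)]
  \<comment> \<open>The start \<open>2 * K\<close> is the trivial bound for a difference of two
    functions bounded by \<open>K\<close>.\<close>
  have claim: "AE x in lborel. \<bar>u t x - v t x\<bar> \<le> 2 * K * (inverse (fact n) * (a * t) ^ n)" if t: "0 < t" "t \<le> T" for n t
    using t
  proof (induction n arbitrary: t)
    case 0
    have "AE x in lborel. \<bar>u t x\<bar> \<le> K" "AE x in lborel. \<bar>v t x\<bar> \<le> K" using bu bv 0 by auto
    then show ?case by eventually_elim simp
  next
    case (Suc n)
    let ?c = "2 * K * (inverse (fact n) * a ^ n)"
    let ?D = "\<lambda>\<tau> x. reaction u \<tau> x - reaction v \<tau> x"
    have si: "set_integrable lborel {0<..<t} (\<lambda>\<tau>. lip K * (?c * \<tau> ^ n))"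
      using Suc.prems by (intro set_integrable_mult_right set_integral_power_Ioo) auto
    have D: "\<bar>duhamel ?D t x\<bar> \<le> C * (LINT \<tau>:{0<..<t}|lborel. lip K * (?c * \<tau> ^ n))" for x
    proof (rule duhamel_bound[OF admissible_diff[OF au av] Suc.prems(2) C(2) _ si])
      fix \<tau> assume \<tau>: "0 < \<tau>" "\<tau> < t"
      have "AE x in lborel. \<bar>u \<tau> x - v \<tau> x\<bar> \<le> ?c * \<tau> ^ n"
        using Suc.IH[of \<tau>] \<tau> Suc.prems by (simp add: power_mult_distrib mult_ac)
      then show "AE x in lborel. \<bar>?D \<tau> x\<bar> \<le> lip K * (?c * \<tau> ^ n)"
        using \<tau> Suc.prems by (intro reaction_lipschitz bu bv) auto
    qed
    have "C * (LINT \<tau>:{0<..<t}|lborel. lip K * (?c * \<tau> ^ n)) = C * (lip K * (?c * (t ^ Suc n / real (Suc n))))"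
      using Suc.prems set_integral_power_Ioo(2)[of t n] by (simp only: set_integral_mult_right less_imp_le)
    also have "\<dots> = 2 * K * (inverse (fact (Suc n)) * (a * t) ^ Suc n)"
    proof -
      have "inverse (fact (Suc n)) = inverse (fact n) / real (Suc n)" by (simp add: divide_simps)
      then show ?thesis by (simp add: a_def power_mult_distrib mult_ac del: fact_Suc of_nat_Suc)
    qed
    finally have E: "C * (LINT \<tau>:{0<..<t}|lborel. lip K * (?c * \<tau> ^ n)) = 2 * K * (inverse (fact (Suc n)) * (a * t) ^ Suc n)" .
    have D': "\<bar>duhamel ?D t x\<bar> \<le> 2 * K * (inverse (fact (Suc n)) * (a * t) ^ Suc n)" for x
      by (rule order_trans[OF D[of x] eq_refl[OF E]])
    show ?case using mild_solution_eq[OF u Suc.prems] mild_solution_eq[OF v Suc.prems]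
    proof eventually_elim
      case (elim x)
      have "u t x - v t x = duhamel ?D t x"
        using elim duhamel_diff[OF au av Suc.prems(2), of x] by simp
      then show ?case using D'[of x] by simp
    qed
  qed
  have "AE x in lborel. \<forall>n. \<bar>u t x - v t x\<bar> \<le> 2 * K * (inverse (fact n) * (a * t) ^ n)"
    unfolding AE_all_countable using claim[OF t] by blast
  then show ?thesis
  proof eventually_elim
    case (elim x)
    have "(\<lambda>n. 2 * K * (inverse (fact n) * (a * t) ^ n)) \<longlonglongrightarrow> 2 * K * 0"
      by (intro tendsto_mult tendsto_const summable_LIMSEQ_zero summable_exp)
    then have "\<bar>u t x - v t x\<bar> \<le> 2 * K * 0"
      using elim by (intro LIMSEQ_le_const[of _ "2 * K * 0"]) auto
    then show ?case by simp
  qed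
qed

end

end

section \<open>Mild solutions: existence and continuation\<close>

context fujita
begin

text \<open>Picard iteration in the ball of radius \<open>R\<close>. The time
  \<open>\<delta>\<close> is fixed before the datum and depends on it only through \<open>M\<close>;
  continuation and blow-up rest on this uniformity.\<close>

lemma local_existence:
  fixes M :: real
  assumes M: "0 \<le> M"
  obtains \<delta> where "0 < \<delta>"
    "\<And>a. a \<in> borel_measurable borel \<Longrightarrow> (AE x in lborel. \<bar>a x\<bar> \<le> M) \<Longrightarrow> \<exists>v. mild_solution h p a f \<delta> v"
proof -
  obtain C where C: "1 \<le> C" "\<And>t. 0 < t \<Longrightarrow> t \<le> 1 \<Longrightarrow> mass t \<le> C" using mass_bounded by blast
  \<comment> \<open>The semigroup part takes up \<open>C * M\<close>; the extra 1 leaves room for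
    the Duhamel term.\<close>
  define R where "R = C * M + 1"
  define N where "N = R powr p + Mf"
  define L where "L = lip R"
  have Mf: "0 \<le> Mf" using source_bounded by (rule ess_bound_nonneg)
  have R: "0 \<le> R" using C M by (simp add: R_def)
  have N: "0 \<le> N" using Mf by (simp add: N_def)
  have L: "0 \<le> L" by (simp add: L_def lip_nonneg)
  \<comment> \<open>The bound 1 makes \<open>C\<close> valid, the second entry keeps the Duhamel
    term below 1 so that the ball is preserved, and the third makes the iteration halve
    distances.\<close>
  define \<delta> where "\<delta> = min 1 (min (1 / (C * N + 1)) (1 / 2 / (C * L + 1)))"
  have CN: "0 < C * N + 1" and CL: "0 < C * L + 1" using C N L by (auto intro!: add_nonneg_pos mult_nonneg_nonneg)
  have \<delta>: "0 < \<delta>" "\<delta> \<le> 1" using CN CL by (auto simp: \<delta>_def)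
  have \<delta>N: "C * (N * t) \<le> 1" if "0 < t" "t \<le> \<delta>" for t
  proof -
    have "C * (N * t) \<le> t * (C * N + 1)" using that by (simp add: algebra_simps)
    also have "\<dots> \<le> 1 / (C * N + 1) * (C * N + 1)" using that CN by (intro mult_right_mono) (auto simp: \<delta>_def)
    also have "\<dots> = 1" using CN by (rule divide_mult_cancel_pos)
    finally show ?thesis .
  qed
  have \<delta>L: "C * (L * d * t) \<le> d / 2" if "0 < t" "t \<le> \<delta>" "0 \<le> d" for t d
  proof -
    have "C * L * t \<le> t * (C * L + 1)" using that by (simp add: algebra_simps)
    also have "\<dots> \<le> 1 / 2 / (C * L + 1) * (C * L + 1)" using that CL by (intro mult_right_mono) (auto simp: \<delta>_def)
    also have "\<dots> = 1 / 2" using CL by (rule divide_mult_cancel_pos)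
    finally have "d * (C * L * t) \<le> d * (1 / 2)" using that by (intro mult_left_mono)
    then show ?thesis by (simp add: mult_ac)
  qed
  have "\<exists>v. mild_solution h p a f \<delta> v"
    if am: "a \<in> borel_measurable borel" and ab: "AE x in lborel. \<bar>a x\<bar> \<le> M" for a
  proof -
    \<comment> \<open>At \<open>t = 0\<close> the datum is inserted directly, since
      \<open>h 0\<close> is not controlled.\<close>
    define step where "step U t = (if t = 0 then a else (\<lambda>x. hconv (h t) a x + duhamel (reaction U) t x))" for U t
    have step_pos: "step U t x = hconv (h t) a x + duhamel (reaction U) t x" if "0 < t" for U t x
      using that by (simp add: step_def)
    have rN: "admissible \<delta> N (reaction U)" if "admissible \<delta> R U" for U
      unfolding N_def using that by (rule reaction_admissible)
    have mass1: "mass t \<le> C" if "0 < t" "t \<le> \<delta>" for t using that \<delta> by (intro C(2)) auto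
    have stepm: "step U t \<in> borel_measurable borel" if U: "admissible \<delta> R U" and t: "t \<in> {0..\<delta>}" for U t
    proof (cases "t = 0")
      case False
      then have "0 < t" using t by auto
      then show ?thesis
        unfolding step_def using t duhamel_measurable[OF rN[OF U], of t] am by (auto intro!: borel_measurable_add)
    qed (simp add: step_def am)
    have stepb: "\<bar>step U t x\<bar> \<le> R" if U: "admissible \<delta> R U" and t: "0 < t" "t \<le> \<delta>" for U t x
    proof -
      have "\<bar>hconv (h t) a x\<bar> \<le> mass t * M" by (rule hconv_kernel_bound[OF t(1) am ab])
      also have "\<dots> \<le> C * M" using mass1[OF t] M by (rule mult_right_mono)
      finally have 1: "\<bar>hconv (h t) a x\<bar> \<le> C * M" .
      have "\<bar>duhamel (reaction U) t x\<bar> \<le> C * (N * t)"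
        using t by (intro duhamel_bound_const[OF rN[OF U] _ t(2) mass1] admissibleD(2)[OF rN[OF U]]) auto
      then show ?thesis using 1 \<delta>N[OF t] by (simp add: step_pos[OF t(1)] R_def)
    qed
    have stepC: "step U \<in> C_Lq \<infinity> {0..\<delta>}" if U: "admissible \<delta> R U" for U
      by (rule duhamel_form_C_Linf[OF \<delta>(1) rN[OF U] stepm[OF U] am ab]) (auto simp: step_def)
    have stepa: "admissible \<delta> R (step U)" if U: "admissible \<delta> R U" for U
      by (rule C_Linf_admissible[OF stepC[OF U]]) (use stepb[OF U] in auto)
    have stepd: "\<bar>step U t x - step V t x\<bar> \<le> d / 2"
      if U: "admissible \<delta> R U" and V: "admissible \<delta> R V" and t: "0 < t" "t \<le> \<delta>" and d: "0 \<le> d"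
        and UV: "\<And>\<tau>. 0 < \<tau> \<Longrightarrow> \<tau> < \<delta> \<Longrightarrow> AE x in lborel. \<bar>U \<tau> x - V \<tau> x\<bar> \<le> d" for U V t x d
    proof -
      have "\<bar>duhamel (\<lambda>\<tau> x. reaction U \<tau> x - reaction V \<tau> x) t x\<bar> \<le> C * (L * d * t)"
      proof (rule duhamel_bound_const[OF admissible_diff[OF rN[OF U] rN[OF V]] _ t(2) mass1])
        fix \<tau> assume "0 < \<tau>" "\<tau> < t"
        then show "AE x in lborel. \<bar>reaction U \<tau> x - reaction V \<tau> x\<bar> \<le> L * d"
          unfolding L_def using t by (intro reaction_lipschitz UV admissibleD(2)[OF U] admissibleD(2)[OF V]) auto
      qed (use t in auto)
      then show ?thesis
        using \<delta>L[OF t d] duhamel_diff[OF rN[OF U] rN[OF V] t(2), of x] by (simp add: step_pos[OF t(1)])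
    qed
    define v where "v n = (step ^^ n) (\<lambda>_ _. 0)" for n
    have vS: "v (Suc n) = step (v n)" for n by (simp add: v_def)
    have va: "admissible \<delta> R (v n)" for n
      by (induction n) (simp_all add: vS stepa, simp add: v_def admissible_zero R)
    have vd: "\<bar>v (Suc n) t x - v n t x\<bar> \<le> R * (1 / 2) ^ n" if "0 < t" "t \<le> \<delta>" for n t x
      using that
    proof (induction n arbitrary: t x)
      case 0
      then show ?case using stepb[OF va[of 0], of t x] by (simp add: vS) (simp add: v_def)
    next
      case (Suc n)
      have "\<bar>step (v (Suc n)) t x - step (v n) t x\<bar> \<le> R * (1 / 2) ^ n / 2"
        using Suc R by (intro stepd va) auto
      then show ?case by (simp add: vS)
    qed
    \<comment> \<open>The limit is chosen at every point of space, which makes the iterates converge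
      everywhere for each positive time; at 0 the curve takes the value of the datum.\<close>
    define w where "w t x = (if t \<in> {0<..\<delta>} then (SOME l. \<forall>n. \<bar>l - v n t x\<bar> \<le> 2 * R * (1 / 2) ^ n) else a x)" for t x
    have wv: "\<bar>w t x - v n t x\<bar> \<le> 2 * R * (1 / 2) ^ n" if "0 < t" "t \<le> \<delta>" for t x n
    proof -
      have "\<exists>l. \<forall>n. \<bar>l - v n t x\<bar> \<le> 2 * R * (1 / 2) ^ n"
        by (rule geometric_Cauchy_limit) (rule vd[OF that])
      from someI_ex[OF this] show ?thesis using that by (simp add: w_def)
    qed
    have null: "(\<lambda>n. 2 * R * (1 / 2) ^ n) \<longlonglongrightarrow> 2 * R * 0"
      by (intro tendsto_mult tendsto_const LIMSEQ_power_zero) simp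
    have wlim: "(\<lambda>n. v n t x) \<longlonglongrightarrow> w t x" if "0 < t" "t \<le> \<delta>" for t x
    proof -
      have "(\<lambda>n. v n t x - w t x) \<longlonglongrightarrow> 0"
      proof (rule Lim_null_comparison)
        show "\<forall>\<^sub>F n in sequentially. norm (v n t x - w t x) \<le> 2 * R * (1 / 2) ^ n"
          using wv[OF that] by (intro always_eventually allI) (simp add: abs_minus_commute)
        show "(\<lambda>n. 2 * R * (1 / 2) ^ n) \<longlonglongrightarrow> 0" using null by simp
      qed
      then show ?thesis by (rule LIM_zero_cancel)
    qed
    have vm: "v n t \<in> borel_measurable borel" if "t \<in> {0..\<delta>}" for n t
      using that by (cases n) (auto simp: vS stepm va, simp add: v_def)
    have wm: "w t \<in> borel_measurable borel" if "t \<in> {0..\<delta>}" for t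
    proof (cases "t = 0")
      case True
      then have "w t = a" by (auto simp: w_def)
      then show ?thesis using am by simp
    next
      case False
      then have t: "0 < t" "t \<le> \<delta>" using that by auto
      show ?thesis by (rule borel_measurable_LIMSEQ_real[OF wlim[OF t] vm[OF that]])
    qed
    have wa: "admissible \<delta> R w"
    proof (rule admissible_uniform_limit)
      fix e :: real assume "0 < e"
      have "\<forall>\<^sub>F n in sequentially. 2 * R * (1 / 2) ^ n < e" using null \<open>0 < e\<close> by (intro order_tendstoD) auto
      then obtain n where n: "2 * R * (1 / 2) ^ n < e" using eventually_happens'[of sequentially] by auto
      have "\<bar>w \<tau> x - v n \<tau> x\<bar> \<le> e" if "0 < \<tau>" "\<tau> < \<delta>" for \<tau> x
        using wv[of \<tau> x n] that n by simp
      then show "\<exists>V. admissible \<delta> R V \<and> (\<forall>\<tau>. 0 < \<tau> \<longrightarrow> \<tau> < \<delta> \<longrightarrow> (AE x in lborel. \<bar>w \<tau> x - V \<tau> x\<bar> \<le> e))"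
        using va[of n] by (intro exI[of _ "v n"]) auto
    qed (use wm in auto)
    \<comment> \<open>Both \<open>w\<close> and \<open>step w\<close> lie within geometrically small
      distance of \<open>v (Suc n)\<close>, so the limit is a fixed point at every spatial
      point.\<close>
    have ws: "w t x = step w t x" if t: "0 < t" "t \<le> \<delta>" for t x
    proof -
      have "\<bar>w t x - step w t x\<bar> \<le> 2 * R * (1 / 2) ^ n" for n
      proof -
        have "\<bar>step w t x - step (v n) t x\<bar> \<le> 2 * R * (1 / 2) ^ n / 2"
          using wv R by (intro stepd wa va t) auto
        moreover have "\<bar>w t x - step (v n) t x\<bar> \<le> 2 * R * (1 / 2) ^ n / 2"
          using wv[OF t, of x "Suc n"] by (simp add: vS)
        ultimately show ?thesis by linarith
      qed
      then have "\<bar>w t x - step w t x\<bar> \<le> 2 * R * 0"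
        by (intro LIMSEQ_le_const[OF null]) auto
      then show ?thesis by simp
    qed
    have "mild_solution h p a f \<delta> w"
    proof (rule mild_solutionI[OF am ab \<delta>(1) rN[OF wa] wm])
      show "AE x in lborel. w 0 x = a x" by (simp add: w_def)
      show "AE x in lborel. w t x = hconv (h t) a x + duhamel (reaction w) t x" if "0 < t" "t \<le> \<delta>" for t
        using ws[OF that] by (simp add: step_pos[OF that(1)])
    qed auto
    then show ?thesis by blast
  qed
  with \<delta>(1) show ?thesis by (rule that)
qed

text \<open>The second solution starts from \<open>u T\<close>. Applying the semigroup to the
  formula for \<open>u T\<close> restores the memory of \<open>u0\<close> and of the source on the
  first interval, so the two Duhamel formulas merge into one.\<close>

lemma mild_solution_extend:
  assumes u0m: "u0 \<in> borel_measurable borel" and u0b: "AE x in lborel. \<bar>u0 x\<bar> \<le> M"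
    and u: "mild_solution h p u0 f T u" and T: "0 < T"
    and v: "mild_solution h p (u T) f \<delta> v" and \<delta>: "0 < \<delta>"
  shows "\<exists>w. mild_solution h p u0 f (T + \<delta>) w"
proof -
  define w where "w t = (if t \<le> T then u t else v (t - T))" for t
  obtain Ku where Ku: "0 \<le> Ku" "\<And>t. t \<in> {0..T} \<Longrightarrow> AE x in lborel. \<bar>u t x\<bar> \<le> Ku" "admissible T Ku u"
    using mild_solution_bounded[OF u] by blast
  obtain Kv where Kv: "0 \<le> Kv" "\<And>t. t \<in> {0..\<delta>} \<Longrightarrow> AE x in lborel. \<bar>v t x\<bar> \<le> Kv" "admissible \<delta> Kv v"
    using mild_solution_bounded[OF v] by blast
  define K where "K = max Ku Kv"
  have um: "u t \<in> borel_measurable borel" if "t \<in> {0..T}" for t by (rule mild_solution_measurable[OF u that])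
  have vm: "v t \<in> borel_measurable borel" if "t \<in> {0..\<delta>}" for t by (rule mild_solution_measurable[OF v that])
  have uTm: "u T \<in> borel_measurable borel" using um T by auto
  have wm: "w t \<in> borel_measurable borel" if "t \<in> {0..T + \<delta>}" for t
    using that um[of t] vm[of "t - T"] by (auto simp: w_def)
  have wb: "AE x in lborel. \<bar>w t x\<bar> \<le> K" if t: "t \<in> {0..T + \<delta>}" for t
  proof (cases "t \<le> T")
    case True
    then have "AE x in lborel. \<bar>u t x\<bar> \<le> Ku" using t by (intro Ku(2)) auto
    then show ?thesis by eventually_elim (use True in \<open>simp add: w_def K_def\<close>)
  next
    case False
    then have "AE x in lborel. \<bar>v (t - T) x\<bar> \<le> Kv" using t by (intro Kv(2)) auto
    then show ?thesis by eventually_elim (use False in \<open>simp add: w_def K_def\<close>)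
  qed
  \<comment> \<open>At \<open>\<tau> = T\<close> left continuity involves \<open>u\<close> alone.
    For later \<open>\<tau>\<close> a left neighbourhood stays beyond \<open>T\<close> and involves
    \<open>v\<close> alone.\<close>
  have wa: "admissible (T + \<delta>) K w"
    unfolding admissible_def
  proof (intro ballI conjI allI impI)
    fix \<tau> assume \<tau>: "\<tau> \<in> {0<..<T + \<delta>}"
    show "w \<tau> \<in> borel_measurable borel" "AE x in lborel. \<bar>w \<tau> x\<bar> \<le> K" using wm wb \<tau> by auto
    fix e :: real assume e: "0 < e"
    show "\<forall>\<^sub>F \<sigma> in at_left \<tau>. AE x in lborel. \<bar>w \<sigma> x - w \<tau> x\<bar> \<le> e"
    proof (cases "\<tau> \<le> T")
      case True
      have "\<forall>\<^sub>F \<sigma> in at_left \<tau>. AE x in lborel. \<bar>u \<sigma> x - u \<tau> x\<bar> \<le> e"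
        using True \<tau> e by (intro C_Linf_left_continuous[OF mild_solution_C_Lq[OF u]]) auto
      moreover have "\<forall>\<^sub>F \<sigma> in at_left \<tau>. 0 < \<sigma> \<and> \<sigma> < \<tau>" using \<tau> by (intro eventually_at_left_Ioo) auto
      ultimately show ?thesis
        by eventually_elim (use True in \<open>simp add: w_def\<close>)
    next
      case False
      have "\<forall>\<^sub>F \<sigma> in at_left (\<tau> - T). AE x in lborel. \<bar>v \<sigma> x - v (\<tau> - T) x\<bar> \<le> e"
        using False \<tau> e by (intro C_Linf_left_continuous[OF mild_solution_C_Lq[OF v]]) auto
      then obtain b where b: "b < \<tau> - T" "\<And>\<sigma>. b < \<sigma> \<Longrightarrow> \<sigma> < \<tau> - T \<Longrightarrow> AE x in lborel. \<bar>v \<sigma> x - v (\<tau> - T) x\<bar> \<le> e"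
        unfolding eventually_at_left_field by blast
      show ?thesis
        unfolding eventually_at_left_field
      proof (intro exI[of _ "max T (b + T)"] conjI allI impI)
        show "max T (b + T) < \<tau>" using False b by simp
        fix \<sigma> assume "max T (b + T) < \<sigma>" "\<sigma> < \<tau>"
        then show "AE x in lborel. \<bar>w \<sigma> x - w \<tau> x\<bar> \<le> e"
          using b(2)[of "\<sigma> - T"] False by (simp add: w_def)
      qed
    qed
  qed
  note ra = reaction_admissible[OF wa] and rua = reaction_admissible[OF Ku(3)]
  have du: "duhamel (reaction w) t x = duhamel (reaction u) t x" if "t \<le> T" for t x
    using that um by (intro duhamel_cong_AE) (auto simp: w_def reaction_def[abs_def] intro!: reaction_measurable[unfolded reaction_def[abs_def]])
  have form: "AE x in lborel. w t x = hconv (h t) u0 x + duhamel (reaction w) t x" if t: "0 < t" "t \<le> T + \<delta>" for t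
  proof (cases "t \<le> T")
    case True
    then show ?thesis using mild_solution_eq[OF u t(1) True] by (simp add: w_def du)
  next
    case False
    define r where "r = t - T"
    have r: "0 < r" "r \<le> \<delta>" and tr: "t = T + r" using False t by (auto simp: r_def)
    obtain C where C: "1 \<le> C" "\<And>t. 0 < t \<Longrightarrow> t \<le> T \<Longrightarrow> mass t \<le> C" using mass_bounded by blast
    \<comment> \<open>The semigroup law turns \<open>r\<close> after \<open>T\<close> into
      \<open>t = T + r\<close>, both for the datum and, by \<open>hconv_duhamel\<close>, for the
      source.\<close>
    have S: "hconv (h r) (u T) x = hconv (h t) u0 x + (LINT \<tau>:{0<..<T}|lborel. hconv (h (t - \<tau>)) (reaction u \<tau>) x)" for x
    proof -
      have m1: "hconv (h T) u0 \<in> borel_measurable borel" using T u0m by (intro measurable_hconv kernel_measurable)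
      have m2: "duhamel (reaction u) T \<in> borel_measurable borel" by (rule duhamel_measurable[OF rua]) simp
      have b1: "AE x in lborel. \<bar>hconv (h T) u0 x\<bar> \<le> mass T * M"
        by (intro AE_I2 hconv_kernel_bound[OF T u0m u0b])
      have b2: "AE x in lborel. \<bar>duhamel (reaction u) T x\<bar> \<le> C * ((Ku powr p + Mf) * T)"
        using T by (intro AE_I2 duhamel_bound_const[OF rua _ _ C(2)] admissibleD(2)[OF rua]) auto
      have "hconv (h r) (u T) x = hconv (h r) (\<lambda>x. hconv (h T) u0 x + duhamel (reaction u) T x) x"
        using mild_solution_eq[OF u T order_refl] r m1 m2 uTm by (intro hconv_cong_AE borel_measurable_add) auto
      also have "\<dots> = hconv (h r) (hconv (h T) u0) x + hconv (h r) (duhamel (reaction u) T) x"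
        using r by (intro hconv_add_right[OF kernel_integrable m1 b1 m2 b2])
      also have "hconv (h r) (hconv (h T) u0) x = hconv (h t) u0 x"
        using hconv_kernel_add[OF r(1) T u0m u0b, of x] by (simp add: tr add.commute)
      also have "hconv (h r) (duhamel (reaction u) T) x = (LINT \<tau>:{0<..<T}|lborel. hconv (h (t - \<tau>)) (reaction u \<tau>) x)"
        using hconv_duhamel[OF rua T order_refl r(1), of x] by (simp add: tr add.commute)
      finally show ?thesis .
    qed
    \<comment> \<open>The integral is split at \<open>T\<close>, a null set, and the later part is
      shifted by \<open>T\<close> to become the Duhamel integral of \<open>v\<close>.\<close>
    have D: "duhamel (reaction w) t x = (LINT \<tau>:{0<..<T}|lborel. hconv (h (t - \<tau>)) (reaction u \<tau>) x) + duhamel (reaction v) r x" for x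
    proof -
      let ?\<phi> = "\<lambda>\<tau>. hconv (h (t - \<tau>)) (reaction w \<tau>) x"
      have i: "set_integrable lborel {0<..<t} ?\<phi>"
        using duhamel_integrable[OF ra t(2), of x] by (simp add: set_integrable_def)
      have i1: "set_integrable lborel {0<..<T} ?\<phi>"
        by (rule set_integrable_subset[OF i]) (use T r tr in auto)
      have i2: "set_integrable lborel {T<..<t} ?\<phi>"
        by (rule set_integrable_subset[OF i]) (use T r tr in auto)
      have "duhamel (reaction w) t x = (LINT \<tau>:{0<..<T} \<union> {T<..<t}|lborel. ?\<phi> \<tau>)"
        unfolding duhamel_def set_lebesgue_integral_def
      proof (rule integral_cong_AE)
        show "AE \<tau> in lborel. indicator {0<..<t} \<tau> *\<^sub>R ?\<phi> \<tau> = indicator ({0<..<T} \<union> {T<..<t}) \<tau> *\<^sub>R ?\<phi> \<tau>"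
          using AE_lborel_singleton[of T] by eventually_elim (use T r in \<open>auto simp: indicator_def tr\<close>)
        show "(\<lambda>\<tau>. indicator {0<..<t} \<tau> *\<^sub>R ?\<phi> \<tau>) \<in> borel_measurable lborel"
          using i unfolding set_integrable_def by (rule borel_measurable_integrable)
        have "set_integrable lborel ({0<..<T} \<union> {T<..<t}) ?\<phi>" using i1 i2 by (intro set_integrable_Un) auto
        then show "(\<lambda>\<tau>. indicator ({0<..<T} \<union> {T<..<t}) \<tau> *\<^sub>R ?\<phi> \<tau>) \<in> borel_measurable lborel"
          unfolding set_integrable_def by (rule borel_measurable_integrable)
      qed
      also have "\<dots> = (LINT \<tau>:{0<..<T}|lborel. ?\<phi> \<tau>) + (LINT \<tau>:{T<..<t}|lborel. ?\<phi> \<tau>)"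
        by (rule set_integral_Un[OF _ i1 i2]) auto
      also have "(LINT \<tau>:{0<..<T}|lborel. ?\<phi> \<tau>) = (LINT \<tau>:{0<..<T}|lborel. hconv (h (t - \<tau>)) (reaction u \<tau>) x)"
        by (intro set_lebesgue_integral_cong) (auto simp: w_def reaction_def[abs_def])
      also have "(LINT \<tau>:{T<..<t}|lborel. ?\<phi> \<tau>) = duhamel (reaction v) r x"
      proof -
        have "(LINT \<tau>:{T<..<t}|lborel. ?\<phi> \<tau>) = (LINT \<tau>|lborel. indicator {T<..<t} (T + 1 * \<tau>) *\<^sub>R ?\<phi> (T + 1 * \<tau>))"
          unfolding set_lebesgue_integral_def by (subst lborel_integral_real_affine[where c = 1 and t = T]) auto
        also have "\<dots> = duhamel (reaction v) r x"
          unfolding duhamel_def set_lebesgue_integral_def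
          by (intro Bochner_Integration.integral_cong) (auto simp: indicator_def tr w_def reaction_def[abs_def])
        finally show ?thesis .
      qed
      finally show ?thesis .
    qed
    have "AE x in lborel. v r x = hconv (h r) (u T) x + duhamel (reaction v) r x"
      by (rule mild_solution_eq[OF v r])
    then show ?thesis
    proof eventually_elim
      case (elim x)
      then show ?case using False by (simp add: w_def r_def[symmetric] S D)
    qed
  qed
  have "mild_solution h p u0 f (T + \<delta>) w"
  proof (rule mild_solutionI[OF u0m u0b _ ra wm _ form])
    show "0 < T + \<delta>" using T \<delta> by simp
    show "AE x in lborel. w 0 x = u0 x" using mild_solution_zero[OF u0m u0b u T] T by (simp add: w_def)
  qed auto
  then show ?thesis by blast
qed

end

section \<open>Mild solutions in Lebesgue spaces\<close>

text \<open>Fatou's lemma for the powers of the functions.\<close>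

lemma Lq_bound_limit:
  assumes q: "1 \<le> q" "q \<noteq> \<infinity>" and v: "\<And>n. Lq_bound q (v n) A"
    and lim: "\<And>x. (\<lambda>n. v n x) \<longlonglongrightarrow> w x" and wm: "w \<in> borel_measurable borel"
  shows "Lq_bound q w A"
proof -
  let ?r = "enn2real q"
  have r: "1 \<le> ?r" using q by (rule enn2real_exponent)
  have [measurable]: "v n \<in> borel_measurable borel" for n using v by (rule Lq_bound_measurable)
  have l: "(\<lambda>n. ennreal (\<bar>v n x\<bar> powr ?r)) \<longlonglongrightarrow> ennreal (\<bar>w x\<bar> powr ?r)" for x
  proof (rule tendsto_ennrealI)
    show "(\<lambda>n. \<bar>v n x\<bar> powr ?r) \<longlonglongrightarrow> \<bar>w x\<bar> powr ?r"
      using r by (intro tendsto_powr' tendsto_rabs lim tendsto_const) auto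
  qed
  have "(\<integral>\<^sup>+x. ennreal (\<bar>w x\<bar> powr ?r) \<partial>lborel) = (\<integral>\<^sup>+x. liminf (\<lambda>n. ennreal (\<bar>v n x\<bar> powr ?r)) \<partial>lborel)"
    using lim_imp_Liminf[OF _ l] by simp
  also have "\<dots> \<le> liminf (\<lambda>n. \<integral>\<^sup>+x. ennreal (\<bar>v n x\<bar> powr ?r) \<partial>lborel)"
    by (rule nn_integral_liminf) simp
  also have "\<dots> \<le> liminf (\<lambda>n::nat. ennreal (A powr ?r))"
    using v q by (intro Liminf_mono always_eventually) (auto simp: Lq_bound_def)
  also have "\<dots> = ennreal (A powr ?r)" by (simp add: Liminf_const)
  finally show ?thesis using v[of 0] q wm by (simp add: Lq_bound_def)
qed

lemma set_integral_exp_Ioo: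
  fixes t l :: real
  assumes t: "0 \<le> t" and l: "0 < l"
  shows "set_integrable lborel {0<..<t} (\<lambda>x. exp (l * x))"
    and "(LINT x:{0<..<t}|lborel. exp (l * x)) \<le> exp (l * t) / l"
proof -
  show "set_integrable lborel {0<..<t} (\<lambda>x. exp (l * x))"
    unfolding set_integrable_def
  proof (rule Bochner_Integration.integrable_bound)
    show "integrable lborel (\<lambda>x. exp (l * t) * indicator {0<..<t} x)"
      by (intro integrable_mult_right integrable_indicator_bounded) auto
  qed (use l in \<open>auto simp: indicator_def\<close>)
  have "(LINT x:{0<..<t}|lborel. exp (l * x)) = (LINT x|lborel. exp (l * x) * indicator {0..t} x)"
    unfolding set_lebesgue_integral_def
  proof (rule integral_cong_AE)
    show "AE x in lborel. indicator {0<..<t} x *\<^sub>R exp (l * x) = exp (l * x) * indicator {0..t} x"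
      using AE_lborel_singleton[of 0] AE_lborel_singleton[of t] by eventually_elim (auto simp: indicator_def)
  qed auto
  also have "\<dots> = exp (l * t) / l - exp (l * 0) / l"
    using l by (intro integral_FTC_Icc_real[OF t]) (auto intro!: derivative_eq_intros)
  also have "\<dots> \<le> exp (l * t) / l" using l by simp
  finally show "(LINT x:{0<..<t}|lborel. exp (l * x)) \<le> exp (l * t) / l" .
qed

text \<open>The function \<open>max 0 (\<bar>y\<bar> - r)\<close> is 1-Lipschitz in \<open>y\<close>
  and in \<open>r\<close>, so left continuity of \<open>u\<close> and continuity of
  \<open>\<rho>\<close> suffice. The result is the majorant used for the \<open>L^q\<close>
  estimate.\<close>

lemma admissible_truncation:
  assumes u: "admissible T K u" and f: "f \<in> borel_measurable borel" "AE x in lborel. \<bar>f x\<bar> \<le> M"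
    and \<rho>: "\<And>\<tau>. isCont \<rho> \<tau>" "\<And>\<tau>. 0 < \<tau> \<Longrightarrow> 0 \<le> \<rho> \<tau>" and B: "0 \<le> B"
  shows "admissible T (B * K + M) (\<lambda>\<tau> x. B * max 0 (\<bar>u \<tau> x\<bar> - \<rho> \<tau>) + \<bar>f x\<bar>)"
  unfolding admissible_def
proof (intro ballI conjI allI impI)
  fix \<tau> assume "\<tau> \<in> {0<..<T}"
  then have \<tau>: "0 < \<tau>" "\<tau> < T" by auto
  note [measurable] = admissibleD(1)[OF u \<tau>] f(1)
  show "(\<lambda>x. B * max 0 (\<bar>u \<tau> x\<bar> - \<rho> \<tau>) + \<bar>f x\<bar>) \<in> borel_measurable borel" by measurable
  show "AE x in lborel. \<bar>B * max 0 (\<bar>u \<tau> x\<bar> - \<rho> \<tau>) + \<bar>f x\<bar>\<bar> \<le> B * K + M"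
    using admissibleD(2)[OF u \<tau>] f(2)
  proof eventually_elim
    case (elim x)
    have "max 0 (\<bar>u \<tau> x\<bar> - \<rho> \<tau>) \<le> K" using elim \<rho>(2)[OF \<tau>(1)] by linarith
    then have "B * max 0 (\<bar>u \<tau> x\<bar> - \<rho> \<tau>) \<le> B * K" using B by (rule mult_left_mono)
    moreover have "0 \<le> B * max 0 (\<bar>u \<tau> x\<bar> - \<rho> \<tau>)" using B by simp
    ultimately show ?case using elim(2) by linarith
  qed
  fix e :: real assume e: "0 < e"
  define e' where "e' = e / 2 / (B + 1)"
  have e': "0 < e'" using e B by (simp add: e'_def)
  have le: "B * (e' + e') \<le> e"
  proof -
    have "B * e' \<le> e' * (B + 1)" using e' by (simp add: algebra_simps)
    also have "\<dots> = e / 2" unfolding e'_def using B by (intro divide_mult_cancel_pos) simp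
    finally show ?thesis by (simp add: distrib_left)
  qed
  have "(\<rho> \<longlongrightarrow> \<rho> \<tau>) (at_left \<tau>)"
    using \<rho>(1)[of \<tau>] by (simp add: isCont_def filterlim_at_split)
  then have "\<forall>\<^sub>F \<sigma> in at_left \<tau>. dist (\<rho> \<sigma>) (\<rho> \<tau>) < e'" using e' by (rule tendstoD)
  with admissibleD(3)[OF u \<tau> e']
  show "\<forall>\<^sub>F \<sigma> in at_left \<tau>. AE x in lborel. \<bar>B * max 0 (\<bar>u \<sigma> x\<bar> - \<rho> \<sigma>) + \<bar>f x\<bar> - (B * max 0 (\<bar>u \<tau> x\<bar> - \<rho> \<tau>) + \<bar>f x\<bar>)\<bar> \<le> e"
  proof eventually_elim
    case (elim \<sigma>)
    from elim(1) show ?case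
    proof eventually_elim
      case (elim x)
      have r: "\<bar>\<rho> \<sigma> - \<rho> \<tau>\<bar> \<le> e'" using \<open>dist (\<rho> \<sigma>) (\<rho> \<tau>) < e'\<close> by (simp add: dist_real_def)
      have "\<bar>max 0 (\<bar>u \<sigma> x\<bar> - \<rho> \<sigma>) - max 0 (\<bar>u \<tau> x\<bar> - \<rho> \<tau>)\<bar> \<le> e' + e'"
        using elim r by linarith
      then have "B * \<bar>max 0 (\<bar>u \<sigma> x\<bar> - \<rho> \<sigma>) - max 0 (\<bar>u \<tau> x\<bar> - \<rho> \<tau>)\<bar> \<le> B * (e' + e')"
        using B by (rule mult_left_mono)
      then have "\<bar>B * (max 0 (\<bar>u \<sigma> x\<bar> - \<rho> \<sigma>) - max 0 (\<bar>u \<tau> x\<bar> - \<rho> \<tau>))\<bar> \<le> e"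
        using B le unfolding abs_mult by simp
      then show ?case by (simp add: right_diff_distrib)
    qed
  qed
qed

context fujita
begin

text \<open>Only \<open>u \<in> L\<^sup>\<infinity>\<close> is known, so the Gronwall argument in \<open>L\<^sup>q\<close> is run on \<open>(\<bar>u\<bar> - \<rho> n)\<^sub>+\<close>, where
  \<open>\<rho> n\<close> is the remainder after \<open>n\<close> iterations of the integral inequality for \<open>\<bar>u\<bar>\<close>.\<close>

lemma mild_solution_Lq_bound:
  assumes q: "1 \<le> q" "q \<noteq> \<infinity>"
    and u0b: "AE x in lborel. \<bar>u0 x\<bar> \<le> M" and u0q: "Lq_bound q u0 A0" and fq: "Lq_bound q f Af"
    and u: "mild_solution h p u0 f T u" and T: "0 < T"
  shows "\<exists>A. \<forall>t\<in>{0..T}. Lq_bound q (u t) A"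
proof -
  have u0m: "u0 \<in> borel_measurable borel" using u0q by (rule Lq_bound_measurable)
  obtain K where K: "0 \<le> K" "\<And>t. t \<in> {0..T} \<Longrightarrow> AE x in lborel. \<bar>u t x\<bar> \<le> K" "admissible T K u"
    using mild_solution_bounded[OF u] by blast
  obtain C where C: "1 \<le> C" "\<And>t. 0 < t \<Longrightarrow> t \<le> T \<Longrightarrow> mass t \<le> C" using mass_bounded by blast
  note ra = reaction_admissible[OF K(3)]
  \<comment> \<open>Since \<open>\<bar>u\<bar>\<close> is at most \<open>K\<close>, the reaction is
    dominated linearly: its power part is at most \<open>B * \<bar>u\<bar>\<close>.\<close>
  define B where "B = K powr (p - 1)"
  have B: "0 \<le> B" by (simp add: B_def)
  have nn: "0 \<le> A0" "0 \<le> Af" using u0q fq by (auto intro: Lq_bound_nonneg)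
  define a where "a = C * B"
  \<comment> \<open>One linear integral step maps \<open>\<rho> n\<close> to
    \<open>\<rho> (Suc n)\<close>. The start \<open>\<rho> 0 = K\<close> dominates
    \<open>\<bar>u\<bar>\<close>, so the first truncation vanishes almost everywhere.\<close>
  define \<rho> where "\<rho> n t = K * (inverse (fact n) * (a * t) ^ n)" for n :: nat and t :: real
  have a: "0 \<le> a" using B C by (simp add: a_def)
  have \<rho>0: "0 \<le> \<rho> n t" if "0 \<le> t" for n t using that a K by (simp add: \<rho>_def)
  have \<rho>c: "isCont (\<rho> n) t" for n t unfolding \<rho>_def by (intro continuous_intros)
  have \<rho>S: "C * (LINT \<tau>:{0<..<t}|lborel. B * \<rho> n \<tau>) = \<rho> (Suc n) t" if t: "0 < t" for n t
  proof -
    have "(LINT \<tau>:{0<..<t}|lborel. B * \<rho> n \<tau>) = (LINT \<tau>:{0<..<t}|lborel. (B * K * inverse (fact n) * a ^ n) * \<tau> ^ n)"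
      unfolding \<rho>_def by (intro set_lebesgue_integral_cong) (auto simp: power_mult_distrib)
    also have "\<dots> = (B * K * inverse (fact n) * a ^ n) * (t ^ Suc n / real (Suc n))"
      using set_integral_power_Ioo(2)[of t n] t by (simp only: set_integral_mult_right less_imp_le)
    finally have "C * (LINT \<tau>:{0<..<t}|lborel. B * \<rho> n \<tau>) = C * ((B * K * inverse (fact n) * a ^ n) * (t ^ Suc n / real (Suc n)))"
      by simp
    moreover have "inverse (fact (Suc n)) = inverse (fact n) / real (Suc n)" by (simp add: divide_simps)
    ultimately show ?thesis by (simp add: \<rho>_def a_def power_mult_distrib mult_ac del: fact_Suc of_nat_Suc)
  qed
  have \<rho>i: "set_integrable lborel {0<..<t} (\<lambda>\<tau>. B * \<rho> n \<tau>)" if "0 < t" for n t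
    unfolding \<rho>_def power_mult_distrib using that by (intro set_integrable_mult_right set_integral_power_Ioo) auto
  define v where "v n t x = max 0 (\<bar>u t x\<bar> - \<rho> n t)" for n t x
  \<comment> \<open>The exponential weight absorbs the linear growth: integrating
    \<open>exp (l * \<tau>)\<close> yields a factor \<open>1 / l\<close>, and 8 makes the Duhamel
    contribution a quarter of \<open>A * exp (l * t)\<close>.\<close>
  define l where "l = 8 * C * (B + 1)"
  have l: "0 < l" using B C by (simp add: l_def)
  \<comment> \<open>The multiple of \<open>A0\<close> absorbs the semigroup part, \<open>Af\<close>
    lets the source fit under the same exponential, and 1 makes the weight positive.\<close>
  define A where "A = 4 * C * A0 + Af + 1"
  have A: "1 \<le> A" "Af \<le> A" "2 * (C * A0) \<le> A / 2" using nn C by (simp_all add: A_def)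
  have um: "u t \<in> borel_measurable borel" if "t \<in> {0..T}" for t by (rule mild_solution_measurable[OF u that])
  have vm: "v n t \<in> borel_measurable borel" if "t \<in> {0..T}" for n t
  proof -
    note [measurable] = um[OF that]
    show ?thesis unfolding v_def[abs_def] by measurable
  qed
  have u0a: "AE x in lborel. \<bar>\<bar>u0 x\<bar>\<bar> \<le> M" using u0b by simp
  have u0am: "(\<lambda>x. \<bar>u0 x\<bar>) \<in> borel_measurable borel" using u0m by simp
  have u0aq: "Lq_bound q (\<lambda>x. \<bar>u0 x\<bar>) A0" using u0q by (rule Lq_bound_dominated) (use u0am in auto)
  have faq: "Lq_bound q (\<lambda>x. \<bar>f x\<bar>) Af" using fq by (rule Lq_bound_dominated) (use source_measurable in auto)
  \<comment> \<open>The bound does not depend on \<open>n\<close>; this makes the passage to the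
    limit at the end possible.\<close>
  have main: "Lq_bound q (v n t) (A * exp (l * t))" if t: "0 < t" "t \<le> T" for n t
    using t
  proof (induction n arbitrary: t)
    case 0
    have "AE x in lborel. \<bar>u t x\<bar> \<le> K" using K(2)[of t] 0 by simp
    then have "AE x in lborel. \<bar>v 0 t x\<bar> \<le> \<bar>0\<bar>"
      by eventually_elim (simp add: v_def \<rho>_def)
    then have "Lq_bound q (v 0 t) 0"
      using 0 by (intro Lq_bound_dominated[OF Lq_bound_zero] vm) auto
    then show ?case by (rule Lq_bound_mono) (use A in simp)
  next
    case (Suc n)
    \<comment> \<open>The part of the linear majorant that is controlled in \<open>L^q\<close>. The
      discarded part \<open>B * \<rho> n \<tau>\<close> is constant in space, hence in general not
      in \<open>L^q\<close>, and is treated separately.\<close>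
    define G where "G \<tau> x = B * v n \<tau> x + \<bar>f x\<bar>" for \<tau> x
    have Ga: "admissible T (B * K + Mf) G"
      unfolding G_def[abs_def] v_def using \<rho>0
      by (intro admissible_truncation[OF K(3) source_measurable source_bounded \<rho>c _ B]) simp
    have hG: "\<bar>hconv (h (t - \<tau>)) (reaction u \<tau>) x\<bar> \<le> hconv (h (t - \<tau>)) (G \<tau>) x + C * (B * \<rho> n \<tau>)"
      if \<tau>: "0 < \<tau>" "\<tau> < t" for \<tau> x
    proof -
      have \<tau>T: "\<tau> < T" "0 < t - \<tau>" "t - \<tau> \<le> T" using \<tau> Suc.prems by auto
      note k = kernel_integrable[OF \<tau>T(2)] kernel_nonneg[OF \<tau>T(2)]
      note r\<tau> = admissibleD(1,2)[OF ra \<tau>(1) \<tau>T(1)] and G\<tau> = admissibleD(1,2)[OF Ga \<tau>(1) \<tau>T(1)]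
      have \<rho>n: "0 \<le> B * \<rho> n \<tau>" using B \<rho>0 \<tau> by simp
      let ?H = "\<lambda>x. G \<tau> x + B * \<rho> n \<tau>"
      have Hm: "?H \<in> borel_measurable borel" using G\<tau>(1) by simp
      have Hb: "AE x in lborel. \<bar>?H x\<bar> \<le> (B * K + Mf) + B * \<rho> n \<tau>"
        using G\<tau>(2) by eventually_elim (use \<rho>n in linarith)
      have rH: "AE x in lborel. \<bar>reaction u \<tau> x\<bar> \<le> ?H x"
      proof -
        have "AE x in lborel. \<bar>u \<tau> x\<bar> \<le> K" using K(2)[of \<tau>] \<tau> \<tau>T by simp
        then show ?thesis
        proof eventually_elim
          case (elim x)
          have "\<bar>u \<tau> x\<bar> powr p = \<bar>u \<tau> x\<bar> powr (p - 1) * \<bar>u \<tau> x\<bar>"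
            by (cases "u \<tau> x = 0") (auto simp: powr_diff)
          also have "\<dots> \<le> B * \<bar>u \<tau> x\<bar>"
            unfolding B_def using elim exponent by (intro mult_right_mono powr_mono2) auto
          also have "\<dots> \<le> B * (v n \<tau> x + \<rho> n \<tau>)"
            using B by (intro mult_left_mono) (auto simp: v_def)
          finally have "\<bar>u \<tau> x\<bar> powr p \<le> B * v n \<tau> x + B * \<rho> n \<tau>" by (simp add: distrib_left)
          moreover have "0 \<le> \<bar>u \<tau> x\<bar> powr p" by simp
          ultimately show ?case unfolding reaction_def G_def by linarith
        qed
      qed
      have "hconv (h (t - \<tau>)) (reaction u \<tau>) x \<le> hconv (h (t - \<tau>)) ?H x"
        by (rule hconv_mono[OF k r\<tau> Hm Hb]) (use rH in \<open>auto elim!: eventually_mono\<close>)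
      moreover have "hconv (h (t - \<tau>)) (\<lambda>x. (- 1) * reaction u \<tau> x) x \<le> hconv (h (t - \<tau>)) ?H x"
        by (rule hconv_mono[OF k _ _ Hm Hb, where M = "K powr p + Mf"])
          (use rH r\<tau> in \<open>auto elim!: eventually_mono\<close>)
      ultimately have 1: "\<bar>hconv (h (t - \<tau>)) (reaction u \<tau>) x\<bar> \<le> hconv (h (t - \<tau>)) ?H x"
        unfolding hconv_cmult_right by linarith
      have cm: "(\<lambda>_::'n heis. B * \<rho> n \<tau>) \<in> borel_measurable borel" by simp
      have cb': "AE x::'n heis in lborel. \<bar>B * \<rho> n \<tau>\<bar> \<le> B * \<rho> n \<tau>" using \<rho>n by simp
      have "hconv (h (t - \<tau>)) ?H x = hconv (h (t - \<tau>)) (G \<tau>) x + hconv (h (t - \<tau>)) (\<lambda>_. B * \<rho> n \<tau>) x"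
        by (rule hconv_add_right[OF k(1) G\<tau> cm cb'])
      moreover have "\<bar>hconv (h (t - \<tau>)) (\<lambda>_. B * \<rho> n \<tau>) x\<bar> \<le> C * (B * \<rho> n \<tau>)"
        using hconv_kernel_bound[OF \<tau>T(2) cm cb', of x] mult_right_mono[OF C(2)[OF \<tau>T(2,3)] \<rho>n] by linarith
      ultimately show ?thesis using 1 by linarith
    qed
    \<comment> \<open>The constants in space integrate to \<open>\<rho> (Suc n) t\<close>, exactly
      what the next truncation subtracts.\<close>
    have Dle: "\<bar>duhamel (reaction u) t x\<bar> \<le> duhamel G t x + \<rho> (Suc n) t" for x
    proof -
      have i1: "set_integrable lborel {0<..<t} (\<lambda>\<tau>. hconv (h (t - \<tau>)) (reaction u \<tau>) x)"
        using duhamel_integrable[OF ra Suc.prems(2), of x] by (simp add: set_integrable_def)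
      have i2: "set_integrable lborel {0<..<t} (\<lambda>\<tau>. hconv (h (t - \<tau>)) (G \<tau>) x)"
        using duhamel_integrable[OF Ga Suc.prems(2), of x] by (simp add: set_integrable_def)
      have i3: "set_integrable lborel {0<..<t} (\<lambda>\<tau>. C * (B * \<rho> n \<tau>))"
        by (rule set_integrable_mult_right[OF \<rho>i[OF Suc.prems(1)]])
      have "\<bar>duhamel (reaction u) t x\<bar> \<le> (LINT \<tau>:{0<..<t}|lborel. \<bar>hconv (h (t - \<tau>)) (reaction u \<tau>) x\<bar>)"
        unfolding duhamel_def set_lebesgue_integral_def
        using integral_abs_bound[of lborel "\<lambda>\<tau>. indicator {0<..<t} \<tau> *\<^sub>R hconv (h (t - \<tau>)) (reaction u \<tau>) x"]
        by (simp add: abs_mult)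
      also have "\<dots> \<le> (LINT \<tau>:{0<..<t}|lborel. hconv (h (t - \<tau>)) (G \<tau>) x + C * (B * \<rho> n \<tau>))"
        by (intro set_integral_mono set_integrable_abs i1 set_integral_add i2 i3) (use hG in auto)
      also have "\<dots> = duhamel G t x + C * (LINT \<tau>:{0<..<t}|lborel. B * \<rho> n \<tau>)"
        unfolding duhamel_def by (subst set_integral_add(2)[OF i2 i3]) (simp only: set_integral_mult_right)
      finally show ?thesis unfolding \<rho>S[OF Suc.prems(1)] .
    qed
    have ut: "AE x in lborel. \<bar>v (Suc n) t x\<bar> \<le> \<bar>hconv (h t) (\<lambda>x. \<bar>u0 x\<bar>) x + duhamel G t x\<bar>"
      using mild_solution_eq[OF u Suc.prems]
    proof eventually_elim
      case (elim x)
      note k = kernel_integrable[OF Suc.prems(1)] kernel_nonneg[OF Suc.prems(1)]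
      have "hconv (h t) u0 x \<le> hconv (h t) (\<lambda>x. \<bar>u0 x\<bar>) x"
        by (rule hconv_mono[OF k u0m u0b u0am u0a]) auto
      moreover have "hconv (h t) (\<lambda>x. (- 1) * u0 x) x \<le> hconv (h t) (\<lambda>x. \<bar>u0 x\<bar>) x"
        by (rule hconv_mono[OF k _ _ u0am u0a, where M = M]) (use u0m u0b in auto)
      ultimately have "\<bar>hconv (h t) u0 x\<bar> \<le> hconv (h t) (\<lambda>x. \<bar>u0 x\<bar>) x"
        unfolding hconv_cmult_right by linarith
      then have "\<bar>u t x\<bar> \<le> hconv (h t) (\<lambda>x. \<bar>u0 x\<bar>) x + duhamel G t x + \<rho> (Suc n) t"
        using elim Dle[of x] by linarith
      then show ?case unfolding v_def by linarith
    qed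
    have D1: "Lq_bound q (duhamel G t) (C * (LINT \<tau>:{0<..<t}|lborel. 2 * (B * A + A) * exp (l * \<tau>)))"
    proof (rule duhamel_Lq_bound[OF q(1) Ga Suc.prems(2) C])
      fix \<tau> assume \<tau>: "0 < \<tau>" "\<tau> < t"
      have "Lq_bound q (v n \<tau>) (A * exp (l * \<tau>))" using Suc \<tau> by auto
      then have "Lq_bound q (G \<tau>) (2 * (\<bar>B\<bar> * (A * exp (l * \<tau>)) + Af))"
        unfolding G_def[abs_def] by (intro Lq_bound_add[OF q(1)] Lq_bound_scale faq)
      moreover have "2 * (\<bar>B\<bar> * (A * exp (l * \<tau>)) + Af) \<le> 2 * (B * A + A) * exp (l * \<tau>)"
      proof -
        have "Af * 1 \<le> A * exp (l * \<tau>)" using A l \<tau> nn by (intro mult_mono) auto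
        then show ?thesis using B by (simp add: algebra_simps)
      qed
      ultimately show "Lq_bound q (G \<tau>) (2 * (B * A + A) * exp (l * \<tau>))" by (rule Lq_bound_mono)
      show "0 < 2 * (B * A + A) * exp (l * \<tau>)" using A B by (simp add: add_nonneg_pos)
    next
      show "set_integrable lborel {0<..<t} (\<lambda>\<tau>. 2 * (B * A + A) * exp (l * \<tau>))"
        using Suc.prems l by (intro set_integrable_mult_right set_integral_exp_Ioo) auto
    qed
    have le: "C * (LINT \<tau>:{0<..<t}|lborel. 2 * (B * A + A) * exp (l * \<tau>)) \<le> A / 4 * exp (l * t)"
    proof -
      have BA: "0 \<le> 2 * (B * A + A)" using A B by simp
      have "(LINT \<tau>:{0<..<t}|lborel. 2 * (B * A + A) * exp (l * \<tau>)) = 2 * (B * A + A) * (LINT \<tau>:{0<..<t}|lborel. exp (l * \<tau>))"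
        by (rule set_integral_mult_right)
      also have "\<dots> \<le> 2 * (B * A + A) * (exp (l * t) / l)"
        using Suc.prems l BA by (intro mult_left_mono set_integral_exp_Ioo) auto
      finally have "C * (LINT \<tau>:{0<..<t}|lborel. 2 * (B * A + A) * exp (l * \<tau>)) \<le> C * (2 * (B * A + A) * (exp (l * t) / l))"
        using C by (intro mult_left_mono) auto
      also have "\<dots> = (2 * C * (B + 1)) / l * (A * exp (l * t))" by (simp add: algebra_simps add_divide_distrib)
      also have "(2 * C * (B + 1)) / l = 1 / 4" using B C by (simp add: l_def divide_simps)
      finally show ?thesis by simp
    qed
    have "Lq_bound q (\<lambda>x. hconv (h t) (\<lambda>x. \<bar>u0 x\<bar>) x + duhamel G t x) (2 * (C * A0 + A / 4 * exp (l * t)))"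
      using Lq_bound_hconv_kernel[OF q(1) Suc.prems(1) u0a u0aq C(2)[OF Suc.prems]]
      by (intro Lq_bound_add[OF q(1)] Lq_bound_mono[OF D1 le])
    then have "Lq_bound q (v (Suc n) t) (2 * (C * A0 + A / 4 * exp (l * t)))"
      using Suc.prems by (intro Lq_bound_dominated[OF _ vm ut]) auto
    moreover have "2 * (C * A0 + A / 4 * exp (l * t)) \<le> A * exp (l * t)"
    proof -
      have "A / 2 * 1 \<le> A / 2 * exp (l * t)" using A l Suc.prems by (intro mult_left_mono) auto
      then show ?thesis using A(3) by (simp add: algebra_simps)
    qed
    ultimately show ?case by (rule Lq_bound_mono)
  qed
  define A1 where "A1 = A0 + A * exp (l * T)"
  have "Lq_bound q (u t) A1" if t: "t \<in> {0..T}" for t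
  proof (cases "t = 0")
    case True
    have "Lq_bound q (u 0) A0"
      using mild_solution_zero[OF u0m u0b u T] T by (intro Lq_bound_cong_AE[OF u0q um]) auto
    then show ?thesis unfolding True by (rule Lq_bound_mono) (use A in \<open>simp add: A1_def\<close>)
  next
    case False
    then have t': "0 < t" "t \<le> T" using t by auto
    \<comment> \<open>As \<open>\<rho> n t\<close> tends to 0, the truncations increase to nothing
      less than \<open>\<bar>u t\<bar>\<close> itself, and Fatou's lemma keeps the bound.\<close>
    have "Lq_bound q (\<lambda>x. \<bar>u t x\<bar>) (A * exp (l * t))"
    proof (rule Lq_bound_limit[OF q main[OF t']])
      fix x
      have "(\<lambda>n. \<rho> n t) \<longlonglongrightarrow> K * 0"
        unfolding \<rho>_def by (intro tendsto_mult tendsto_const summable_LIMSEQ_zero summable_exp)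
      then have "(\<lambda>n. v n t x) \<longlonglongrightarrow> max 0 (\<bar>u t x\<bar> - K * 0)"
        unfolding v_def by (intro tendsto_max tendsto_diff tendsto_const)
      then show "(\<lambda>n. v n t x) \<longlonglongrightarrow> \<bar>u t x\<bar>" by simp
    qed (use um[OF t] in simp)
    then have "Lq_bound q (u t) (A * exp (l * t))"
      by (rule Lq_bound_dominated) (use um[OF t] in auto)
    then show ?thesis
    proof (rule Lq_bound_mono)
      have "A * exp (l * t) \<le> A * exp (l * T)" using A l t' by (intro mult_left_mono) auto
      then show "A * exp (l * t) \<le> A1" using nn by (simp add: A1_def)
    qed
  qed
  then show ?thesis by blast
qed

text \<open>Once \<open>u\<close> is bounded in \<open>L^q\<close>, domination of the power by
  \<open>B * \<bar>u\<bar>\<close> bounds the source in \<open>L^q\<close>, and the continuity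
  results for Duhamel curves apply.\<close>

lemma mild_solution_C_Lq_finite:
  assumes q: "1 \<le> q" "q \<noteq> \<infinity>"
    and u0b: "AE x in lborel. \<bar>u0 x\<bar> \<le> M" and u0q: "Lq_bound q u0 A0" and fq: "Lq_bound q f Af"
    and u: "mild_solution h p u0 f T u" and T: "0 < T"
  shows "u \<in> C_Lq q {0..T}"
proof -
  have u0m: "u0 \<in> borel_measurable borel" using u0q by (rule Lq_bound_measurable)
  obtain K where K: "0 \<le> K" "\<And>t. t \<in> {0..T} \<Longrightarrow> AE x in lborel. \<bar>u t x\<bar> \<le> K" "admissible T K u"
    using mild_solution_bounded[OF u] by blast
  obtain A where A: "\<And>t. t \<in> {0..T} \<Longrightarrow> Lq_bound q (u t) A"
    using mild_solution_Lq_bound[OF assms] by blast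
  define B where "B = K powr (p - 1)"
  have "Lq_bound q (reaction u \<tau>) (2 * (\<bar>B\<bar> * A + Af))" if \<tau>: "0 < \<tau>" "\<tau> < T" for \<tau>
  proof -
    have um: "u \<tau> \<in> borel_measurable borel" using admissibleD(1)[OF K(3) \<tau>] .
    have "Lq_bound q (\<lambda>x. B * u \<tau> x) (\<bar>B\<bar> * A)" using A[of \<tau>] \<tau> by (intro Lq_bound_scale) auto
    then have "Lq_bound q (\<lambda>x. \<bar>u \<tau> x\<bar> powr p) (\<bar>B\<bar> * A)"
    proof (rule Lq_bound_dominated)
      show "(\<lambda>x. \<bar>u \<tau> x\<bar> powr p) \<in> borel_measurable borel" using um by measurable
      show "AE x in lborel. \<bar>\<bar>u \<tau> x\<bar> powr p\<bar> \<le> \<bar>B * u \<tau> x\<bar>"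
        using admissibleD(2)[OF K(3) \<tau>]
      proof eventually_elim
        case (elim x)
        have "\<bar>u \<tau> x\<bar> powr p = \<bar>u \<tau> x\<bar> powr (p - 1) * \<bar>u \<tau> x\<bar>"
          by (cases "u \<tau> x = 0") (auto simp: powr_diff)
        also have "\<dots> \<le> B * \<bar>u \<tau> x\<bar>"
          unfolding B_def using elim exponent by (intro mult_right_mono powr_mono2) auto
        finally show ?case by (simp add: abs_mult B_def)
      qed
    qed
    then show ?thesis unfolding reaction_def[abs_def] by (rule Lq_bound_add[OF q(1) _ fq])
  qed
  then show ?thesis
    using mild_solution_measurable[OF u] mild_solution_zero[OF u0m u0b u T] mild_solution_eq[OF u]
    by (intro duhamel_form_C_Lq[OF T reaction_admissible[OF K(3)] _ u0m u0b _ _ q u0q]) auto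
qed

end

section \<open>The maximal solution\<close>

text \<open>Continuity is local: for a closed interval reaching beyond \<open>t\<close> and inside
  the half-open one, the two filters at \<open>t\<close> coincide.\<close>

lemma C_Lq_half_open:
  assumes u: "\<And>T. 0 < T \<Longrightarrow> ereal T < S \<Longrightarrow> u \<in> C_Lq q {0..T}"
  shows "u \<in> C_Lq q {t. 0 \<le> t \<and> ereal t < S}"
proof -
  let ?I = "{t. 0 \<le> t \<and> ereal t < S}"
  have "u t \<in> Lq q \<and> (if q = \<infinity> \<and> t = 0 then weak_star_continuous ?I u t else norm_continuous q ?I u t)"
    if t: "t \<in> ?I" for t
  proof -
    have "ereal t < S" "0 \<le> t" using t by auto
    from ereal_dense2[OF this(1)] obtain T where T: "t < T" "ereal T < S" by auto
    then have T0: "0 < T" using \<open>0 \<le> t\<close> by simp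
    have "u \<in> C_Lq q {0..T}" by (rule u[OF T0 T(2)])
    then have ut: "u t \<in> Lq q \<and> (if q = \<infinity> \<and> t = 0 then weak_star_continuous {0..T} u t else norm_continuous q {0..T} u t)"
      using T \<open>0 \<le> t\<close> unfolding C_Lq_def by auto
    have at_eq: "at t within ?I = at t within {0..T}"
    proof (rule at_within_nhd[of t "{..<T}"])
      have "ereal x < S" if "x < T" for x using that T(2) by (meson ereal_less_eq(3) less_imp_le order_le_less_trans)
      then show "?I \<inter> {..<T} - {t} = {0..T} \<inter> {..<T} - {t}" by auto
    qed (use T in auto)
    show ?thesis using ut unfolding weak_star_continuous_def norm_continuous_def at_eq .
  qed
  then show ?thesis unfolding C_Lq_def by blast
qed

lemma heis_semigroup_heat_kernel:
  assumes hk: "heat_kernel c s h" shows "heis_semigroup h"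
proof
  have int: "integrable lborel (h t)" if "0 < t" for t
    using hk that by (simp add: heat_kernel_def Lq_1_iff)
  show "integrable lborel (h t)" if "0 < t" for t using int that .
  show "AE x in lborel. 0 \<le> h t x" if "0 < t" for t using hk that by (simp add: heat_kernel_def)
  show "AE \<xi> in lborel. hconv (h (t + \<tau>)) g \<xi> = hconv (h t) (hconv (h \<tau>) g) \<xi>"
    if "0 < t" "0 < \<tau>" "integrable lborel g" for t \<tau> g
    using hk that by (simp add: heat_kernel_def heat_op_eq_hconv Lq_1_iff)
  fix g :: "'a heis \<Rightarrow> real" assume g: "integrable lborel g"
  have "((\<lambda>t. Lq_norm 1 (\<lambda>\<xi>. hconv (h t) g \<xi> - g \<xi>)) \<longlongrightarrow> 0) (at_right 0)"
    using hk g by (simp add: heat_kernel_def heat_op_eq_hconv Lq_1_iff)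
  moreover have "\<forall>\<^sub>F t in at_right 0. Lq_norm 1 (\<lambda>\<xi>. hconv (h t) g \<xi> - g \<xi>) = ennreal (L1_norm (\<lambda>\<xi>. hconv (h t) g \<xi> - g \<xi>))"
    unfolding eventually_at_right_field
    by (intro exI[of _ 1]) (auto intro!: Lq_norm_1_eq_L1_norm Bochner_Integration.integrable_diff hconv_L1_integrable int g)
  ultimately have "((\<lambda>t. ennreal (L1_norm (\<lambda>\<xi>. hconv (h t) g \<xi> - g \<xi>))) \<longlongrightarrow> ennreal 0) (at_right 0)"
    by (simp add: tendsto_cong)
  then show "((\<lambda>t. L1_norm (\<lambda>\<xi>. hconv (h t) g \<xi> - g \<xi>)) \<longlongrightarrow> 0) (at_right 0)"
    by (rule tendsto_ennrealD) auto
qed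

context fujita
begin

lemma mild_solution_norm_continuous_zero:
  assumes u0m: "u0 \<in> borel_measurable borel" and u0b: "AE x in lborel. \<bar>u0 x\<bar> \<le> M"
    and S: "((\<lambda>t. Lq_norm \<infinity> (\<lambda>\<xi>. hconv (h t) u0 \<xi> - u0 \<xi>)) \<longlongrightarrow> 0) (at_right 0)"
    and u: "mild_solution h p u0 f T u" and T: "0 < T"
  shows "norm_continuous \<infinity> {0..T} u 0"
proof -
  obtain K where K: "admissible T K u" using mild_solution_bounded[OF u] by blast
  note ra = reaction_admissible[OF K]
  have Fb: "Lq_bound \<infinity> (reaction u \<tau>) (K powr p + Mf)" if "0 < \<tau>" "\<tau> < T" for \<tau>
    using admissibleD(1,2)[OF ra that] Lq_bound_infinity by blast
  have ev: "\<forall>\<^sub>F t in at_right 0. Lq_bound \<infinity> (\<lambda>x. hconv (h t) u0 x - u0 x) e" if e: "0 < e" for e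
  proof -
    have "\<forall>\<^sub>F t in at_right 0. Lq_norm \<infinity> (\<lambda>\<xi>. hconv (h t) u0 \<xi> - u0 \<xi>) < ennreal e"
      using e by (intro order_tendstoD[OF S]) simp
    moreover have "\<forall>\<^sub>F t in at_right 0. 0 < (t::real)" by (simp add: eventually_at_right_less)
    ultimately show ?thesis
    proof eventually_elim
      case (elim t)
      have "(\<lambda>x. hconv (h t) u0 x - u0 x) \<in> borel_measurable borel"
        using elim u0m by (intro borel_measurable_diff measurable_hconv kernel_measurable)
      from Lq_bound_iff[OF this _ one_le_infinity_ennreal, of e] e elim(1) show ?case by (simp add: less_imp_le)
    qed
  qed
  show ?thesis
    by (rule duhamel_form_norm_continuous_zero[OF T ra mild_solution_measurable[OF u] u0m u0b
          mild_solution_zero[OF u0m u0b u T] mild_solution_eq[OF u] one_le_infinity_ennreal Fb ev])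
qed

section \<open>Maximal lifetime, continuation and blow-up\<close>

context
  fixes u0 :: "'n heis \<Rightarrow> real" and M :: real
  assumes u0m: "u0 \<in> borel_measurable borel" and u0b: "AE x in lborel. \<bar>u0 x\<bar> \<le> M"
begin

lemma local_solution: "\<exists>T>0. \<exists>u. mild_solution h p u0 f T u"
  using local_existence[of M] ess_bound_nonneg[OF u0b] u0m u0b by metis

lemma T_max_upper: "mild_solution h p u0 f T u \<Longrightarrow> 0 < T \<Longrightarrow> ereal T \<le> T_max h p u0 f"
  unfolding T_max_def by (rule Sup_upper) auto

lemma T_max_pos: "0 < T_max h p u0 f"
proof -
  obtain T u where "0 < T" "mild_solution h p u0 f T u" using local_solution by blast
  then show ?thesis using T_max_upper[of T u] by (metis ereal_less(2) less_le_trans)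
qed

lemma less_T_maxD:
  assumes "ereal t < T_max h p u0 f"
  shows "\<exists>T u. t < T \<and> 0 < T \<and> mild_solution h p u0 f T u"
  using assms unfolding T_max_def less_Sup_iff by auto

lemma mild_solution_unique':
  assumes u: "mild_solution h p u0 f T u" "0 < T" and v: "mild_solution h p u0 f T' v" "0 < T'"
    and t: "0 \<le> t" "t \<le> T" "t \<le> T'"
  shows "AE x in lborel. u t x = v t x"
proof (rule mild_solution_unique[OF u0m u0b])
  show "mild_solution h p u0 f (min T T') u" using u v by (intro mild_solution_restrict[OF u0m u0b u(1)]) auto
  show "mild_solution h p u0 f (min T T') v" using u v by (intro mild_solution_restrict[OF u0m u0b v(1)]) auto
qed (use u v t in auto)

text \<open>Every time below \<open>T_max\<close> picks its own solution living beyond it. By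
  uniqueness the picks agree almost everywhere at common times, and
  \<open>mild_solution_cong\<close> makes the patchwork a solution.\<close>

lemma maximal_solution_exists: "\<exists>u. maximal_solution h p u0 f u"
proof -
  let ?P = "\<lambda>t w. t < fst w \<and> 0 < fst w \<and> mild_solution h p u0 f (fst w) (snd w)"
  \<comment> \<open>A pair of a lifetime and a solution, chosen anew for each \<open>t\<close>;
    \<open>U\<close> reads it off at \<open>t\<close> only.\<close>
  define w where "w t = (SOME w. ?P t w)" for t
  define U where "U t = snd (w t) t" for t
  have w: "?P t (w t)" if lt: "ereal t < T_max h p u0 f" for t
  proof -
    obtain T u where "t < T \<and> 0 < T \<and> mild_solution h p u0 f T u" using less_T_maxD[OF lt] by blast
    then have "\<exists>w. ?P t w" by (intro exI[of _ "(T, u)"]) simp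
    then show ?thesis unfolding w_def by (rule someI_ex)
  qed
  have "mild_solution h p u0 f T U" if T: "0 < T" "ereal T < T_max h p u0 f" for T
  proof -
    have wT: "T < fst (w T)" "0 < fst (w T)" "mild_solution h p u0 f (fst (w T)) (snd (w T))" using w[OF T(2)] by auto
    show ?thesis
    proof (rule mild_solution_cong[OF u0m u0b wT(3) T(1)])
      show "T \<le> fst (w T)" using wT by simp
      fix t assume t: "t \<in> {0..T}"
      then have "ereal t < T_max h p u0 f" by (intro order_le_less_trans[OF _ T(2)]) simp
      from w[OF this] have wt: "t < fst (w t)" "0 < fst (w t)" "mild_solution h p u0 f (fst (w t)) (snd (w t))" by auto
      show "U t \<in> borel_measurable borel \<and> (AE x in lborel. U t x = snd (w T) t x)"
        unfolding U_def using t wt wT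
        by (intro conjI mild_solution_measurable[OF wt(3)] mild_solution_unique'[OF wt(3,2) wT(3,2)]) auto
    qed
  qed
  then show ?thesis unfolding maximal_solution_def by blast
qed

lemma maximal_solution_mild:
  assumes U: "maximal_solution h p u0 f U" and t: "0 \<le> t" "ereal t < T_max h p u0 f"
  obtains T where "0 < T" "t < T" "mild_solution h p u0 f T U"
proof -
  from ereal_dense2[OF t(2)] obtain T where T: "t < T" "ereal T < T_max h p u0 f" by auto
  then have "mild_solution h p u0 f T U" using U t unfolding maximal_solution_def by simp
  with T t show ?thesis by (intro that[of T]) auto
qed

lemma maximal_solution_unique:
  assumes U: "maximal_solution h p u0 f U" and V: "maximal_solution h p u0 f V"
    and t: "0 \<le> t" "ereal t < T_max h p u0 f"
  shows "AE x in lborel. V t x = U t x"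
proof -
  obtain T where T: "0 < T" "t < T" "mild_solution h p u0 f T U" by (rule maximal_solution_mild[OF U t])
  obtain T' where T': "0 < T'" "t < T'" "mild_solution h p u0 f T' V" by (rule maximal_solution_mild[OF V t])
  show ?thesis using T T' t by (intro mild_solution_unique'[OF T'(3,1) T(3,1)]) auto
qed

text \<open>A bound on the final value alone determines how much longer the solution lives, because
  \<open>local_existence\<close> fixes its time before the datum.\<close>

lemma extension_time:
  assumes M: "0 \<le> M'"
  obtains \<delta> where "0 < \<delta>"
    "\<And>T u. 0 < T \<Longrightarrow> mild_solution h p u0 f T u \<Longrightarrow> (AE x in lborel. \<bar>u T x\<bar> \<le> M') \<Longrightarrow> ereal (T + \<delta>) \<le> T_max h p u0 f"
proof -
  obtain \<delta> where \<delta>: "0 < \<delta>"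
    "\<And>a. a \<in> borel_measurable borel \<Longrightarrow> (AE x in lborel. \<bar>a x\<bar> \<le> M') \<Longrightarrow> \<exists>v. mild_solution h p a f \<delta> v"
    by (rule local_existence[OF M]) (rule that)
  have "ereal (T + \<delta>) \<le> T_max h p u0 f"
    if T: "0 < T" and u: "mild_solution h p u0 f T u" and b: "AE x in lborel. \<bar>u T x\<bar> \<le> M'" for T u
  proof -
    have "u T \<in> borel_measurable borel" using mild_solution_measurable[OF u, of T] T by simp
    then obtain v where v: "mild_solution h p (u T) f \<delta> v" using \<delta>(2) b by blast
    obtain w where "mild_solution h p u0 f (T + \<delta>) w"
      using mild_solution_extend[OF u0m u0b u T v \<delta>(1)] by blast
    then show ?thesis using T \<delta> by (intro T_max_upper) auto
  qed
  with \<delta>(1) show ?thesis by (rule that)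
qed

text \<open>The supremum is never attained: a solution on a closed interval is bounded at its right
  end and can be restarted there.\<close>

lemma mild_solution_less_T_max:
  assumes u: "mild_solution h p u0 f T u" and T: "0 < T"
  shows "ereal T < T_max h p u0 f"
proof -
  obtain K where K: "0 \<le> K" "\<And>t. t \<in> {0..T} \<Longrightarrow> AE x in lborel. \<bar>u t x\<bar> \<le> K"
    using mild_solution_bounded[OF u] by blast
  obtain \<delta> where \<delta>: "0 < \<delta>"
    "\<And>T u. 0 < T \<Longrightarrow> mild_solution h p u0 f T u \<Longrightarrow> (AE x in lborel. \<bar>u T x\<bar> \<le> K) \<Longrightarrow> ereal (T + \<delta>) \<le> T_max h p u0 f"
    by (rule extension_time[OF K(1)]) (rule that)
  have "ereal T < ereal (T + \<delta>)" using \<delta>(1) by simp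
  also have "\<dots> \<le> T_max h p u0 f" using K(2)[of T] T by (intro \<delta>(2)[OF T u]) auto
  finally show ?thesis .
qed

text \<open>A norm of at most \<open>r\<close> at any time within \<open>\<delta>\<close> of
  \<open>b\<close> would allow a restart that passes \<open>b\<close>. As this excludes every such
  time, the norm tends to infinity and is not merely unbounded.\<close>

lemma maximal_solution_blowup:
  assumes U: "maximal_solution h p u0 f U" and b: "T_max h p u0 f = ereal b"
  shows "((\<lambda>t. Lq_norm \<infinity> (U t)) \<longlongrightarrow> \<infinity>) (at_left b)"
proof -
  have b0: "0 < b" using T_max_pos unfolding b by simp
  have "\<forall>\<^sub>F t in at_left b. ennreal r < Lq_norm \<infinity> (U t)" if r: "0 \<le> r" for r
  proof -
    obtain \<delta> where \<delta>: "0 < \<delta>"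
      "\<And>T u. 0 < T \<Longrightarrow> mild_solution h p u0 f T u \<Longrightarrow> (AE x in lborel. \<bar>u T x\<bar> \<le> r) \<Longrightarrow> ereal (T + \<delta>) \<le> T_max h p u0 f"
      by (rule extension_time[OF r]) (rule that)
    show ?thesis
      unfolding eventually_at_left_field
    proof (intro exI[of _ "max 0 (b - \<delta>)"] conjI allI impI)
      show "max 0 (b - \<delta>) < b" using b0 \<delta> by simp
      fix t assume t: "max 0 (b - \<delta>) < t" "t < b"
      have u: "mild_solution h p u0 f t U" using U t unfolding maximal_solution_def b by simp
      have Um: "U t \<in> borel_measurable borel" using t by (intro mild_solution_measurable[OF u]) auto
      show "ennreal r < Lq_norm \<infinity> (U t)"
      proof (rule ccontr)
        assume "\<not> ?thesis"
        then have "Lq_bound \<infinity> (U t) r"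
          using Lq_bound_iff[OF Um r one_le_infinity_ennreal] by (simp add: not_less)
        then have "AE x in lborel. \<bar>U t x\<bar> \<le> r" by (simp add: Lq_bound_def)
        then have "ereal (t + \<delta>) \<le> ereal b" using \<delta>(2)[OF _ u] t unfolding b by auto
        then show False using t by simp
      qed
    qed
  qed
  note large = this
  show ?thesis
  proof (rule order_tendstoI)
    fix a :: ennreal assume "a < \<infinity>"
    then obtain r where "a = ennreal r" "0 \<le> r" by (cases a) auto
    then show "\<forall>\<^sub>F t in at_left b. a < Lq_norm \<infinity> (U t)" using large by blast
  qed simp
qed

end

end

theorem theorem1p1:
  fixes h :: "real \<Rightarrow> 'n::finite heis \<Rightarrow> real"
    and u0 f :: "'n heis \<Rightarrow> real"
    and c s p :: real
  assumes "c > 0" and "0 < s" "s < 1" and "p > 1"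
    and "heat_kernel c s h"
    and "u0 \<in> Lq \<infinity>" and "f \<in> Lq \<infinity>"
  shows
    \<comment> \<open>(i)\<close>
    "(\<exists>T>0. \<exists>u. mild_solution h p u0 f T u \<and>
        (\<forall>v. mild_solution h p u0 f T v \<longrightarrow> (\<forall>t\<in>{0..T}. AE \<xi> in lborel. v t \<xi> = u t \<xi>))) \<and>
     \<comment> \<open>norm continuity at time 0 as well, whenever the initial datum admits it\<close>
     (((\<lambda>t. Lq_norm \<infinity> (\<lambda>\<xi>. heat_op h t u0 \<xi> - u0 \<xi>)) \<longlongrightarrow> 0) (at_right 0) \<longrightarrow>
       (\<forall>T>0. \<forall>u. mild_solution h p u0 f T u \<longrightarrow> (\<forall>t\<in>{0..T}. norm_continuous \<infinity> {0..T} u t))) \<and>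
     (\<exists>u. 
       \<comment> \<open>(ii)\<close>
       maximal_solution h p u0 f u \<and>
       (\<forall>v. maximal_solution h p u0 f v \<longrightarrow>
          (\<forall>t\<ge>0. ereal t < T_max h p u0 f \<longrightarrow> (AE \<xi> in lborel. v t \<xi> = u t \<xi>))) \<and>
       (\<forall>T>0. \<forall>v. mild_solution h p u0 f T v \<longrightarrow>
          ereal T < T_max h p u0 f \<and> (\<forall>t\<in>{0..T}. AE \<xi> in lborel. v t \<xi> = u t \<xi>)) \<and>
       (\<forall>b. T_max h p u0 f = ereal b \<longrightarrow> ((\<lambda>t. Lq_norm \<infinity> (u t)) \<longlongrightarrow> \<infinity>) (at_left b)) \<and>
       \<comment> \<open>(iii)\<close>
       (\<forall>q\<ge>1. u0 \<in> Lq q \<and> f \<in> Lq q \<longrightarrow>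
          u \<in> C_Lq \<infinity> {t. 0 \<le> t \<and> ereal t < T_max h p u0 f} \<and>
          u \<in> C_Lq q {t. 0 \<le> t \<and> ereal t < T_max h p u0 f}))"
proof -
  obtain M where u0: "u0 \<in> borel_measurable borel" "AE x in lborel. \<bar>u0 x\<bar> \<le> M"
    using assms(6) unfolding Lq_infinity_iff by blast
  obtain Mf where f: "f \<in> borel_measurable borel" "AE x in lborel. \<bar>f x\<bar> \<le> Mf"
    using assms(7) unfolding Lq_infinity_iff by blast
  interpret heis_semigroup h using assms(5) by (rule heis_semigroup_heat_kernel)
  interpret fujita h p Mf f by unfold_locales (use assms(4) f in auto)
  obtain U where U: "maximal_solution h p u0 f U" using maximal_solution_exists[OF u0] by blast
  have Umild: "mild_solution h p u0 f T U" if "0 < T" "ereal T < T_max h p u0 f" for T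
    using U that unfolding maximal_solution_def by blast
  have local: "\<exists>T>0. \<exists>u. mild_solution h p u0 f T u \<and>
        (\<forall>v. mild_solution h p u0 f T v \<longrightarrow> (\<forall>t\<in>{0..T}. AE \<xi> in lborel. v t \<xi> = u t \<xi>))"
  proof -
    obtain T u where T: "0 < T" and u: "mild_solution h p u0 f T u" using local_solution[OF u0] by blast
    have "\<forall>v. mild_solution h p u0 f T v \<longrightarrow> (\<forall>t\<in>{0..T}. AE \<xi> in lborel. v t \<xi> = u t \<xi>)"
      using mild_solution_unique[OF u0 _ u T] by blast
    with T u show ?thesis by blast
  qed
  \<comment> \<open>The assumption on the datum decides the case \<open>t = 0\<close>; at positive
    times norm continuity is built into \<open>C_Lq\<close>.\<close>
  have cont: "norm_continuous \<infinity> {0..T} u t"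
    if S: "((\<lambda>t. Lq_norm \<infinity> (\<lambda>\<xi>. heat_op h t u0 \<xi> - u0 \<xi>)) \<longlongrightarrow> 0) (at_right 0)"
      and T: "0 < T" and u: "mild_solution h p u0 f T u" and t: "t \<in> {0..T}" for T u t
  proof (cases "t = 0")
    case True
    show ?thesis unfolding True
      by (rule mild_solution_norm_continuous_zero[OF u0 S[unfolded heat_op_eq_hconv] u T])
  next
    case False
    then show ?thesis by (intro C_Lq_norm_continuous[OF mild_solution_C_Lq[OF u] t]) simp
  qed
  have unique: "ereal T < T_max h p u0 f \<and> (\<forall>t\<in>{0..T}. AE \<xi> in lborel. v t \<xi> = U t \<xi>)"
    if T: "0 < T" and v: "mild_solution h p u0 f T v" for T v
    using mild_solution_less_T_max[OF u0 v T] mild_solution_unique[OF u0 v Umild[OF T] T] by blast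
  have C: "U \<in> C_Lq q {t. 0 \<le> t \<and> ereal t < T_max h p u0 f}"
    if q: "1 \<le> q" and u0q: "u0 \<in> Lq q" and fq: "f \<in> Lq q" for q
  proof (cases "q = \<infinity>")
    case True
    show ?thesis unfolding True by (rule C_Lq_half_open) (rule mild_solution_C_Lq[OF Umild])
  next
    case False
    obtain A0 where A0: "Lq_bound q u0 A0" by (rule Lq_imp_Lq_bound[OF q u0q])
    obtain Af where Af: "Lq_bound q f Af" by (rule Lq_imp_Lq_bound[OF q fq])
    show ?thesis
      by (rule C_Lq_half_open) (rule mild_solution_C_Lq_finite[OF q False u0(2) A0 Af Umild])
  qed
  show ?thesis
  proof (rule conjI[OF local], rule conjI)
    show "((\<lambda>t. Lq_norm \<infinity> (\<lambda>\<xi>. heat_op h t u0 \<xi> - u0 \<xi>)) \<longlongrightarrow> 0) (at_right 0) \<longrightarrow>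
       (\<forall>T>0. \<forall>u. mild_solution h p u0 f T u \<longrightarrow> (\<forall>t\<in>{0..T}. norm_continuous \<infinity> {0..T} u t))"
      using cont by blast
  qed (intro exI[of _ U] conjI U allI impI maximal_solution_unique[OF u0 U] unique maximal_solution_blowup[OF u0 U]
      C C[OF one_le_infinity_ennreal assms(6,7)]; blast)
qed

end
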